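(* Let $Z>0$ and let $\psi\in H^1(\mathbb{R}^3)$ be the minimizer of the Hartree functional $\mathcal{E}$ (taken nonnegative), and set $N=\int_{\mathbb{R}^3}\psi^2\,dx$. Then $$N\le \frac{5}{4\beta}\,Z,$$ where $\beta$ is the constant defined in the context. In particular, since $\beta\ge 0.8218$, one has $N\le \frac{5}{4\cdot 0.8218}Z\approx 1.5211\,Z$.
   Context: For $Z>0$, the Hartree functional on real-valued $\psi\in H^1(\mathbb{R}^3)$ is $$\mathcal{E}[\psi]=\int_{\mathbb{R}^3}|\nabla\psi|^2\,dx-\int_{\mathbb{R}^3}\frac{Z}{|x|}\psi^2\,dx+\frac12\int_{\mathbb{R}^3}\int_{\mathbb{R}^3}\frac{\psi^2(x)\psi^2(y)}{|x-y|}\,dx\,dy .$$ This functional has a minimizer over $H^1(\mathbb{R}^3)$ (no normalization constraint), unique up to sign, radially symmetric, with $\int\psi^2<\infty$; it satisfies the Hartree equation $-\Delta\psi=\phi\psi$ with $\phi(x)=\frac{Z}{|x|}-\int_{\mathbb{R}^3}\frac{\psi^2(y)}{|x-y|}\,dy$. The constant $\beta$ is defined by $$\beta=\inf\ \frac12\,\frac{\int_{\mathbb{R}^3}\int_{\mathbb{R}^3}\psi^2(x)\frac{|x|^2+|y|^2}{|x-y|}\psi^2(y)\,dx\,dy}{\left(\int_{\mathbb{R}^3}|x|\psi^2(x)\,dx\right)\left(\int_{\mathbb{R}^3}\psi^2(x)\,dx\right)},$$ the infimum taken over all real $\psi\not\equiv 0$ with $\int\psi^2<\infty$ (and $\int|x|\psi^2<\infty$).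 It is known (Nam) that $0.8218\le\beta\le 0.8705$. *)

theory Defs
  imports "HOL-Analysis.Analysis"
begin

type_synonym R3 = "real ^ 3"

definition test_fun :: "(R3 \<Rightarrow> real) \<Rightarrow> bool" where
  "test_fun \<phi> \<longleftrightarrow>
     (\<exists>D. (\<forall>x. (\<phi> has_derivative D x) (at x)) \<and>
          (\<forall>v. continuous_on UNIV (\<lambda>x. D x v))) \<and>
     (\<exists>R. \<forall>x. norm x \<ge> R \<longrightarrow> \<phi> x = 0)"

definition partial_deriv :: "(R3 \<Rightarrow> real) \<Rightarrow> 3 \<Rightarrow> R3 \<Rightarrow> real" where
  "partial_deriv \<phi> i x = frechet_derivative \<phi> (at x) (axis i 1)"

definition weak_gradient :: "(R3 \<Rightarrow> real) \<Rightarrow> (R3 \<Rightarrow> R3) \<Rightarrow> bool" where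
  "weak_gradient \<psi> g \<longleftrightarrow>
     \<psi> \<in> borel_measurable lborel \<and> g \<in> borel_measurable lborel \<and>
     (\<forall>\<phi> i. test_fun \<phi> \<longrightarrow>
        integrable lborel (\<lambda>x. \<psi> x * partial_deriv \<phi> i x) \<and>
        integrable lborel (\<lambda>x. g x $ i * \<phi> x) \<and>
        (\<integral>x. \<psi> x * partial_deriv \<phi> i x \<partial>lborel) = - (\<integral>x. g x $ i * \<phi> x \<partial>lborel))"

definition H1_with_grad :: "(R3 \<Rightarrow> real) \<Rightarrow> (R3 \<Rightarrow> R3) \<Rightarrow> bool" where
  "H1_with_grad \<psi> g \<longleftrightarrow>
     weak_gradient \<psi> g \<and>
     integrable lborel (\<lambda>x. (\<psi> x)\<^sup>2) \<and>
     integrable lborel (\<lambda>x. (norm (g x))\<^sup>2)"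

text \<open>The Hartree functional; for H^1 functions all three terms are finite.\<close>
definition hartree_energy :: "real \<Rightarrow> (R3 \<Rightarrow> real) \<Rightarrow> (R3 \<Rightarrow> R3) \<Rightarrow> real" where
  "hartree_energy Z \<psi> g =
     (\<integral>x. (norm (g x))\<^sup>2 \<partial>lborel)
     - (\<integral>x. Z / norm x * (\<psi> x)\<^sup>2 \<partial>lborel)
     + 1/2 * (\<integral>x. (\<integral>y. (\<psi> x)\<^sup>2 * (\<psi> y)\<^sup>2 / norm (x - y) \<partial>lborel) \<partial>lborel)"

definition hartree_minimizer :: "real \<Rightarrow> (R3 \<Rightarrow> real) \<Rightarrow> bool" where
  "hartree_minimizer Z \<psi> \<longleftrightarrow>
     (\<exists>g. H1_with_grad \<psi> g \<and>
          (\<forall>\<phi> h. H1_with_grad \<phi> h \<longrightarrow> hartree_energy Z \<psi> g \<le> hartree_energy Z \<phi> h))"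

definition beta_num :: "(R3 \<Rightarrow> real) \<Rightarrow> ennreal" where
  "beta_num \<psi> =
     (\<integral>\<^sup>+x. (\<integral>\<^sup>+y. ennreal ((\<psi> x)\<^sup>2 * ((norm x)\<^sup>2 + (norm y)\<^sup>2) / norm (x - y) * (\<psi> y)\<^sup>2)
        \<partial>lborel) \<partial>lborel)"

text \<open>The constant beta. Trial functions with infinite numerator give quotient +infinity
  and therefore do not affect the infimum; they are omitted.\<close>
definition hartree_beta :: real where
  "hartree_beta = Inf
     { (1/2) * enn2real (beta_num \<psi>) /
         ((\<integral>x. norm x * (\<psi> x)\<^sup>2 \<partial>lborel) * (\<integral>x. (\<psi> x)\<^sup>2 \<partial>lborel)) | \<psi>.
       \<psi> \<in> borel_measurable lborel \<and>
       integrable lborel (\<lambda>x. (\<psi> x)\<^sup>2) \<and>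
       integrable lborel (\<lambda>x. norm x * (\<psi> x)\<^sup>2) \<and>
       (\<integral>x. (\<psi> x)\<^sup>2 \<partial>lborel) \<noteq> 0 \<and>
       beta_num \<psi> < \<infinity> }"

end

theory Submission
  imports Defs
begin

text \<open>
  Write \<open>N = \<integral>\<psi>\<^sup>2\<close>, \<open>B = \<integral>\<psi>\<^sup>2/|x|\<close> and \<open>M = \<integral>|x|\<psi>\<^sup>2\<close>. Testing
  minimality with \<open>(1 - \<tau> |x|\<^sup>2) \<psi>\<close> and using Hardy's inequality gives \<open>\<beta> M N \<le> Z M + 3/4 N\<close>. Scaling gives the virial relation \<open>3 \<integral>|\<nabla>\<psi>|\<^sup>2 \<le> Z B\<close>,
  which with the Coulomb uncertainty principle \<open>B\<^sup>2 \<le> N \<integral>|\<nabla>\<psi>|\<^sup>2\<close> yields \<open>B \<le> Z N / 3\<close>, hence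
  \<open>M \<ge> N\<^sup>2 / B \<ge> 3 N / Z\<close>, so that \<open>\<beta> N \<le> Z + Z / 4\<close>. Since \<open>M\<close> is not known to be finite
  beforehand, the weight \<open>|x|\<^sup>2\<close> is replaced by \<open>|x|\<^sup>2 / (1 + \<epsilon> |x|\<^sup>2)\<close>, for which the Hardy estimate
  still holds with the constant \<open>3/4\<close>. The integrations by parts rest on the product
  rule for \<open>\<psi>\<^sup>2\<close>, obtained from the weak gradient alone by mollification.
\<close>

text \<open>The weight |x|^2 is dictated by the definition of beta: symmetrising |x|^2 / |x - y| in
  x and y gives half the kernel in \<open>beta_num\<close>. Its price is the kinetic term. Formally,
  the integral of grad \<open>\<psi>\<close> . grad (|x|^2 \<open>\<psi>\<close>) is that of |grad
  (|x| \<open>\<psi>\<close>)|^2 minus N, and Hardy with constant 1/4 leaves -3/4 N. No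
  Euler-Lagrange equation is derived. Competitors that shrink \<open>\<psi>\<close> are compared
  with it, and the resulting one-sided inequality has the sign that bounds the repulsion from above.
  When the damping is removed, convergence of the damped first moments is never shown; they only
  need a lower bound that survives the limit. Multiplying by such a bound requires the sign of beta
  N - Z, which is why the last step argues by contradiction. An infimum of reals is informative only
  over a nonempty set that is bounded below. This is the purpose of the crude bound 1/2 and of the
  explicit trial function.\<close>

section \<open>Affine changes of variables in Lebesgue integrals\<close>

lemma nn_integral_lborel_affine:
  fixes f :: "'a::euclidean_space \<Rightarrow> ennreal"
  assumes [measurable]: "f \<in> borel_measurable borel" and c: "c \<noteq> 0"
  shows "(\<integral>\<^sup>+x. f x \<partial>lborel) = ennreal (\<bar>c\<bar> ^ DIM('a)) * (\<integral>\<^sup>+x. f (t + c *\<^sub>R x) \<partial>lborel)"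
proof -
  have "(\<integral>\<^sup>+x. f x \<partial>lborel) =
      (\<integral>\<^sup>+x. f x \<partial>(density (distr lborel borel (\<lambda>x. t + c *\<^sub>R x)) (\<lambda>_. ennreal (\<bar>c\<bar> ^ DIM('a)))))"
    using lborel_affine[OF c, of t] by simp
  then show ?thesis
    by (simp add: nn_integral_density nn_integral_distr nn_integral_cmult)
qed

lemma integral_lborel_affine:
  fixes f :: "'a::euclidean_space \<Rightarrow> real"
  assumes f[measurable]: "f \<in> borel_measurable borel" and c: "c \<noteq> 0"
  shows "(\<integral>x. f x \<partial>lborel) = \<bar>c\<bar> ^ DIM('a) * (\<integral>x. f (t + c *\<^sub>R x) \<partial>lborel)"
proof -
  have "(\<integral>x. f x \<partial>lborel) =
      (\<integral>x. f x \<partial>(density (distr lborel borel (\<lambda>x. t + c *\<^sub>R x)) (\<lambda>_. ennreal (\<bar>c\<bar> ^ DIM('a)))))"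
    using lborel_affine[OF c, of t] by simp
  then show ?thesis
    by (simp add: integral_density integral_distr)
qed

lemma integrable_lborel_affine:
  fixes f :: "'a::euclidean_space \<Rightarrow> real"
  assumes f[measurable]: "f \<in> borel_measurable borel" and c: "c \<noteq> 0"
  shows "integrable lborel (\<lambda>x. f (t + c *\<^sub>R x)) \<longleftrightarrow> integrable lborel f"
proof -
  have "integrable lborel f \<longleftrightarrow>
      integrable (density (distr lborel borel (\<lambda>x. t + c *\<^sub>R x)) (\<lambda>_. ennreal (\<bar>c\<bar> ^ DIM('a)))) f"
    using lborel_affine[OF c, of t] by simp
  then show ?thesis using c
    by (simp add: integrable_density integrable_distr_eq)
qed

subsection \<open>Square-integrable functions and their correlations\<close>

definition sq_integrable :: "('a::euclidean_space \<Rightarrow> real) \<Rightarrow> bool" where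
  "sq_integrable f \<longleftrightarrow> f \<in> borel_measurable lborel \<and> integrable lborel (\<lambda>x. (f x)\<^sup>2)"

lemma sq_integrable_measurable: "sq_integrable f \<Longrightarrow> f \<in> borel_measurable borel"
  by (simp add: sq_integrable_def)

text \<open>The free weight \<open>l\<close> makes this a substitute for Cauchy-Schwarz under the
  integral: it is taken small in the density argument and equal to Z / 3 when the Coulomb
  uncertainty principle is applied.\<close>

lemma abs_mult_le_weighted_squares:
  fixes a b l :: real
  assumes "l > 0"
  shows "\<bar>a * b\<bar> \<le> (l * a\<^sup>2 + b\<^sup>2 / l) / 2"
proof -
  have "0 \<le> (l * \<bar>a\<bar> - \<bar>b\<bar>)\<^sup>2" by simp
  then have "2 * l * \<bar>a * b\<bar> \<le> l\<^sup>2 * a\<^sup>2 + b\<^sup>2"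
    by (simp add: power2_diff power_mult_distrib abs_mult algebra_simps)
  then show ?thesis using assms by (simp add: field_simps power2_eq_square)
qed

lemma sq_integrable_mult_integrable:
  assumes "sq_integrable f" "sq_integrable g"
  shows "integrable lborel (\<lambda>x. f x * g x)"
proof (rule Bochner_Integration.integrable_bound)
  show "integrable lborel (\<lambda>x. ((f x)\<^sup>2 + (g x)\<^sup>2) / 2)"
    using assms by (simp add: sq_integrable_def)
  show "AE x in lborel. norm (f x * g x) \<le> norm (((f x)\<^sup>2 + (g x)\<^sup>2) / 2)"
    using abs_mult_le_weighted_squares[of 1] by (auto intro!: AE_I2)
  show "(\<lambda>x. f x * g x) \<in> borel_measurable lborel"
    using assms by (simp add: sq_integrable_def borel_measurable_times)
qed

lemma sq_integrable_bounded_mult: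
  assumes "sq_integrable f" "u \<in> borel_measurable borel" "\<And>x. \<bar>u x\<bar> \<le> C"
  shows "sq_integrable (\<lambda>x. f x * u x)"
  unfolding sq_integrable_def
proof
  show m: "(\<lambda>x. f x * u x) \<in> borel_measurable lborel"
    using assms by (simp add: sq_integrable_def borel_measurable_times)
  show "integrable lborel (\<lambda>x. (f x * u x)\<^sup>2)"
  proof (rule Bochner_Integration.integrable_bound)
    show "integrable lborel (\<lambda>x. C\<^sup>2 * (f x)\<^sup>2)"
      using assms by (simp add: sq_integrable_def)
    have "(f x * u x)\<^sup>2 \<le> C\<^sup>2 * (f x)\<^sup>2" for x
    proof -
      have "(u x)\<^sup>2 \<le> C\<^sup>2" using power_mono[OF assms(3)[of x] abs_ge_zero, of 2] by simp
      from mult_right_mono[OF this, of "(f x)\<^sup>2"] show ?thesis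
        by (simp add: power_mult_distrib mult.commute)
    qed
    then show "AE x in lborel. norm ((f x * u x)\<^sup>2) \<le> norm (C\<^sup>2 * (f x)\<^sup>2)"
      by (intro AE_I2) simp
  qed (use m in measurable)
qed

lemma sq_integrable_shift:
  assumes "sq_integrable f"
  shows "sq_integrable (\<lambda>x. f (x - z))" "(\<integral>x. (f (x - z))\<^sup>2 \<partial>lborel) = (\<integral>x. (f x)\<^sup>2 \<partial>lborel)"
proof -
  have [measurable]: "f \<in> borel_measurable borel" using assms by (simp add: sq_integrable_def)
  show "sq_integrable (\<lambda>x. f (x - z))"
    using assms integrable_lborel_affine[of "\<lambda>x. (f x)\<^sup>2" 1 "- z"]
    by (simp add: sq_integrable_def)
  show "(\<integral>x. (f (x - z))\<^sup>2 \<partial>lborel) = (\<integral>x. (f x)\<^sup>2 \<partial>lborel)"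
    using integral_lborel_affine[of "\<lambda>x. (f x)\<^sup>2" 1 "- z"] by simp
qed

lemma sq_integrable_diff:
  assumes "sq_integrable f" "sq_integrable g"
  shows "sq_integrable (\<lambda>x. f x - g x)"
  using assms sq_integrable_mult_integrable[OF assms]
  by (simp add: sq_integrable_def power2_diff mult.assoc borel_measurable_diff)

lemma integrable_const_on_cball:
  fixes C :: real
  shows "integrable lborel (\<lambda>x::'a::euclidean_space. C * indicator (cball 0 R) x)"
  by (auto intro!: integrable_mult_right integrable_real_indicator emeasure_bounded_finite)

text \<open>The continuous approximants of measurable functions are clipped and cut off, which
  turns almost everywhere convergence into convergence in the mean.\<close>

lemma sq_integrable_approx_continuous_bounded:
  fixes H :: "'a::euclidean_space \<Rightarrow> real"
  assumes H: "H \<in> borel_measurable borel" and b: "\<And>x. \<bar>H x\<bar> \<le> n" and s: "\<And>x. norm x > n \<Longrightarrow> H x = 0"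
    and e: "e > 0"
  obtains c R where "continuous_on UNIV c" "\<And>x. norm x \<ge> R \<Longrightarrow> c x = 0"
    "sq_integrable c" "(\<integral>x. (H x - c x)\<^sup>2 \<partial>lborel) < e"
proof -
  have n: "n \<ge> 0" using b[of 0] by linarith
  have "H \<in> borel_measurable lebesgue" using H by (simp add: measurable_completion)
  then have "H measurable_on UNIV" by (rule lebesgue_measurable_imp_measurable_on) simp
  then obtain N g where N: "negligible N" and g: "\<And>k. continuous_on UNIV (g k)"
    and lim: "\<And>x. x \<notin> N \<Longrightarrow> (\<lambda>k. g k x) \<longlonglongrightarrow> H x"
    unfolding measurable_on_def by auto
  \<comment> \<open>A continuous cutoff, 1 on the ball of radius \<open>n\<close> and 0 beyond
    \<open>n + 1\<close>. It does not disturb the limit because \<open>H\<close> already vanishes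
    outside radius \<open>n\<close>.\<close>
  define ch where "ch x = max 0 (min 1 (n + 1 - norm x))" for x :: 'a
  define c where "c k x = ch x * max (-n) (min n (g k x))" for k x
  have c: "continuous_on UNIV (c k)" for k
    unfolding c_def ch_def by (intro continuous_intros g)
  have [measurable]: "c k \<in> borel_measurable borel" for k
    using c by (rule borel_measurable_continuous_onI)
  have sup: "c k x = 0" if "norm x \<ge> n + 1" for k x
    using that by (simp add: c_def ch_def)
  have cb: "\<bar>c k x\<bar> \<le> n" for k x
  proof -
    have "\<bar>ch x\<bar> \<le> 1" by (simp add: ch_def)
    moreover have "\<bar>max (-n) (min n (g k x))\<bar> \<le> n" using n by auto
    ultimately show ?thesis using mult_mono[of "\<bar>ch x\<bar>" 1 "\<bar>max (-n) (min n (g k x))\<bar>" n]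
      by (simp add: c_def abs_mult)
  qed
  have sqc: "sq_integrable (c k)" for k
    unfolding sq_integrable_def
  proof
    show "integrable lborel (\<lambda>x. (c k x)\<^sup>2)"
    proof (rule Bochner_Integration.integrable_bound[OF integrable_const_on_cball])
      show "AE x in lborel. norm ((c k x)\<^sup>2) \<le> norm (n\<^sup>2 * indicator (cball 0 (n+1)) x :: real)"
        using sup power_mono[OF cb abs_ge_zero, where n=2]
        by (auto intro!: AE_I2 simp: indicator_def)
    qed measurable
  qed simp
  have [measurable]: "H \<in> borel_measurable borel" by fact
  have "(\<lambda>k. \<integral>x. (H x - c k x)\<^sup>2 \<partial>lborel) \<longlonglongrightarrow> (\<integral>x. 0 \<partial>(lborel::'a measure))"
  proof (rule integral_dominated_convergence)
    show "integrable lborel (\<lambda>x::'a. (2*n)\<^sup>2 * indicator (cball 0 (n+1)) x)"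
      by (rule integrable_const_on_cball)
    have "AE x in lebesgue. x \<notin> N"
      using N AE_not_in negligible_iff_null_sets by blast
    then have "AE x in lborel. x \<notin> N" by (simp add: AE_completion_iff)
    then show "AE x in lborel. (\<lambda>k. (H x - c k x)\<^sup>2) \<longlonglongrightarrow> 0"
    proof eventually_elim
      case (elim x)
      have "(\<lambda>k. c k x) \<longlonglongrightarrow> ch x * max (-n) (min n (H x))"
        unfolding c_def by (intro tendsto_intros lim elim)
      also have "ch x * max (-n) (min n (H x)) = H x"
        using b[of x] s[of x] by (cases "norm x > n") (auto simp: ch_def max_def min_def abs_le_iff)
      finally have "(\<lambda>k. (H x - c k x)\<^sup>2) \<longlonglongrightarrow> (H x - H x)\<^sup>2"
        by (intro tendsto_intros)
      then show ?case by simp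
    qed
    fix k
    have "(H x - c k x)\<^sup>2 \<le> (2*n)\<^sup>2" for x
      using power_mono[of "\<bar>H x - c k x\<bar>" "2*n" 2] b[of x] cb[of k x] by (simp add: abs_le_iff)
    then show "AE x in lborel. norm ((H x - c k x)\<^sup>2) \<le> (2*n)\<^sup>2 * indicator (cball 0 (n+1)) x"
      using sup[of _ k] s by (auto intro!: AE_I2 simp: indicator_def)
  qed measurable
  then have "eventually (\<lambda>k. (\<integral>x. (H x - c k x)\<^sup>2 \<partial>lborel) < e) sequentially"
    using e by (intro order_tendstoD(2)) simp_all
  then obtain k where "(\<integral>x. (H x - c k x)\<^sup>2 \<partial>lborel) < e"
    by (auto simp: eventually_sequentially)
  with that c sup sqc show thesis by blast
qed

text \<open>Truncating \<open>H\<close> both in domain and in range leaves an error dominated by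
  \<open>H\<close> itself and reduces to the bounded case. Each of the two errors is kept below
  \<open>e/4\<close> because squaring a sum costs a factor 2.\<close>

lemma sq_integrable_approx_continuous:
  fixes H :: "'a::euclidean_space \<Rightarrow> real"
  assumes H: "sq_integrable H" and e: "e > 0"
  obtains c R where "continuous_on UNIV c" "\<And>x. norm x \<ge> R \<Longrightarrow> c x = 0"
    "sq_integrable c" "(\<integral>x. (H x - c x)\<^sup>2 \<partial>lborel) < e"
proof -
  have [measurable]: "H \<in> borel_measurable borel" using H by (rule sq_integrable_measurable)
  define h where "h n x = (if norm x \<le> real n \<and> \<bar>H x\<bar> \<le> real n then H x else 0)" for n x
  have hm[measurable]: "h n \<in> borel_measurable borel" for n unfolding h_def by measurable
  have lim: "(\<lambda>n. \<integral>x. (H x - h n x)\<^sup>2 \<partial>lborel) \<longlonglongrightarrow> (\<integral>x. 0 \<partial>(lborel::'a measure))"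
  proof (rule integral_dominated_convergence)
    show "integrable lborel (\<lambda>x. (H x)\<^sup>2)" using H by (simp add: sq_integrable_def)
    show "AE x in lborel. (\<lambda>n. (H x - h n x)\<^sup>2) \<longlonglongrightarrow> 0"
    proof (intro AE_I2 tendsto_eventually)
      fix x
      obtain m where m: "max (norm x) \<bar>H x\<bar> \<le> real m" using real_arch_simple by blast
      have "\<bar>H x\<bar> \<le> real n \<and> norm x \<le> real n" if "n \<ge> m" for n
        using m that by (simp add: max_def split: if_splits)
      then show "eventually (\<lambda>n. (H x - h n x)\<^sup>2 = 0) sequentially"
        by (auto simp: h_def eventually_sequentially intro!: exI[of _ m])
    qed
    show "AE x in lborel. norm ((H x - h n x)\<^sup>2) \<le> (H x)\<^sup>2" for n
      by (auto intro!: AE_I2 simp: h_def)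
  qed measurable
  have "eventually (\<lambda>k. (\<integral>x. (H x - h k x)\<^sup>2 \<partial>lborel) < e/4) sequentially"
    using e by (intro order_tendstoD(2)[OF lim]) simp
  then obtain n where n: "(\<integral>x. (H x - h n x)\<^sup>2 \<partial>lborel) < e/4"
    by (auto simp: eventually_sequentially)
  have hsq: "sq_integrable (h n)" unfolding sq_integrable_def
  proof
    show "integrable lborel (\<lambda>x. (h n x)\<^sup>2)"
      by (rule Bochner_Integration.integrable_bound[of _ "\<lambda>x. (H x)\<^sup>2"])
        (use H in \<open>auto simp: sq_integrable_def h_def\<close>)
  qed simp
  obtain c R where c: "continuous_on UNIV c" "\<And>x. norm x \<ge> R \<Longrightarrow> c x = 0"
    "sq_integrable c" "(\<integral>x. (h n x - c x)\<^sup>2 \<partial>lborel) < e/4"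
    by (rule sq_integrable_approx_continuous_bounded[of "h n" n "e/4"])
      (use e in \<open>auto simp: h_def\<close>)
  have i1: "integrable lborel (\<lambda>x. (H x - h n x)\<^sup>2)" and i2: "integrable lborel (\<lambda>x. (h n x - c x)\<^sup>2)"
    and i3: "integrable lborel (\<lambda>x. (H x - c x)\<^sup>2)"
    using sq_integrable_diff[OF H hsq] sq_integrable_diff[OF hsq c(3)] sq_integrable_diff[OF H c(3)]
    by (auto simp: sq_integrable_def)
  have "(H x - c x)\<^sup>2 \<le> 2 * (H x - h n x)\<^sup>2 + 2 * (h n x - c x)\<^sup>2" for x
    using sum_squares_bound[of "H x - h n x" "h n x - c x"]
    by (simp add: power2_eq_square algebra_simps)
  then have "(\<integral>x. (H x - c x)\<^sup>2 \<partial>lborel) \<le> (\<integral>x. 2 * (H x - h n x)\<^sup>2 + 2 * (h n x - c x)\<^sup>2 \<partial>lborel)"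
    using i1 i2 i3 by (intro integral_mono) auto
  also have "\<dots> < e" using n c(4) i1 i2 by simp
  finally show thesis using that c by blast
qed

lemma continuous_compact_support_bounded:
  fixes c :: "'a::euclidean_space \<Rightarrow> real"
  assumes c: "continuous_on UNIV c" "\<And>x. norm x \<ge> R \<Longrightarrow> c x = 0"
  obtains K where "K \<ge> 0" "\<And>x. \<bar>c x\<bar> \<le> K" "\<And>x. \<bar>c x\<bar> \<le> K * indicator (cball 0 R) x"
proof -
  have "bounded (c ` cball 0 R)"
    using c(1) by (intro compact_imp_bounded compact_continuous_image) (auto intro: continuous_on_subset)
  then obtain K where "\<forall>y\<in>c ` cball 0 R. norm y \<le> K" unfolding bounded_iff by metis
  then have K: "\<bar>c x\<bar> \<le> K" if "x \<in> cball 0 R" for x using that by force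
  have K': "\<bar>c x\<bar> \<le> max K 0" for x
    using K[of x] c(2)[of x] by (cases "norm x \<le> R") (auto simp: max_def)
  have "\<bar>c x\<bar> \<le> max K 0 * indicator (cball 0 R) x" for x
    using K'[of x] c(2)[of x] by (auto simp: indicator_def)
  with that K' show thesis by (metis max.cobounded2)
qed

text \<open>The bound 1 on the shifts puts the supports of all translates of \<open>c\<close> into
  one ball of radius \<open>R + 1\<close>, so a multiple of |F| on that ball dominates.\<close>

lemma correlation_tendsto_continuous:
  fixes F :: "'a::euclidean_space \<Rightarrow> real"
  assumes F: "sq_integrable F" and c: "continuous_on UNIV c" "\<And>x. norm x \<ge> R \<Longrightarrow> c x = 0"
    and z: "z \<longlonglongrightarrow> (0::'a)" "\<And>n::nat. norm (z n) \<le> 1"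
  shows "(\<lambda>n. \<integral>x. F x * c (x - z n) \<partial>lborel) \<longlonglongrightarrow> (\<integral>x. F x * c x \<partial>lborel)"
proof -
  have [measurable]: "F \<in> borel_measurable borel" using F by (rule sq_integrable_measurable)
  have [measurable]: "c \<in> borel_measurable borel" using c(1) by (rule borel_measurable_continuous_onI)
  from continuous_compact_support_bounded[OF c] obtain K
    where K: "K \<ge> 0" "\<And>x. \<bar>c x\<bar> \<le> K" by metis
  have sqi: "sq_integrable (\<lambda>x::'a. K * indicator (cball 0 (R+1)) x)"
  proof -
    have "(K * indicator (cball 0 (R+1)) x)\<^sup>2 = K\<^sup>2 * indicator (cball 0 (R+1)) x" for x :: 'a
      by (simp add: indicator_def)
    then show ?thesis using integrable_const_on_cball[of "K\<^sup>2" "R+1", where 'a='a]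
      by (simp add: sq_integrable_def borel_measurable_times borel_measurable_indicator)
  qed
  show ?thesis
  proof (rule integral_dominated_convergence)
    show "integrable lborel (\<lambda>x. \<bar>F x * (K * indicator (cball 0 (R+1)) x)\<bar>)"
      using sq_integrable_mult_integrable[OF F sqi] by simp
    have "(\<lambda>n. c (x - z n)) \<longlonglongrightarrow> c (x - 0)" for x
      using c(1) by (intro continuous_on_tendsto_compose[OF c(1)] tendsto_intros z) auto
    then show "AE x in lborel. (\<lambda>n. F x * c (x - z n)) \<longlonglongrightarrow> F x * c x"
      by (auto intro!: AE_I2 tendsto_intros)
    fix n
    have "\<bar>c (x - z n)\<bar> \<le> K * indicator (cball 0 (R+1)) x" for x
    proof (cases "norm x \<le> R + 1")
      case True then show ?thesis using K(2)[of "x - z n"] by simp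
    next
      case False
      then have "norm (x - z n) \<ge> R" using z(2)[of n] norm_triangle_ineq2[of x "z n"] by linarith
      then show ?thesis using c(2) K(1) by simp
    qed
    then have "\<bar>F x\<bar> * \<bar>c (x - z n)\<bar> \<le> \<bar>F x\<bar> * \<bar>K * indicator (cball 0 (R+1)) x\<bar>" for x
      by (intro mult_left_mono[OF order.trans[OF _ abs_ge_self]]) auto
    then have "\<bar>F x * c (x - z n)\<bar> \<le> \<bar>F x * (K * indicator (cball 0 (R+1)) x)\<bar>" for x
      by (simp only: abs_mult)
    then show "AE x in lborel. norm (F x * c (x - z n)) \<le> \<bar>F x * (K * indicator (cball 0 (R+1)) x)\<bar>"
      by auto
  qed measurable
qed

text \<open>Translation preserves the L2 norm, so the estimate is uniform in the shift
  \<open>z\<close>; this uniformity carries the limit from continuous functions to all of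
  L2.\<close>

lemma correlation_bound:
  assumes F: "sq_integrable F" and v: "sq_integrable v" "(\<integral>x. (v x)\<^sup>2 \<partial>lborel) \<le> l\<^sup>2" and l: "l > 0"
  shows "\<bar>\<integral>x. F x * v (x - z) \<partial>lborel\<bar> \<le> l * ((\<integral>x. (F x)\<^sup>2 \<partial>lborel) + 1) / 2"
proof -
  note sv = sq_integrable_shift[OF v(1), of z]
  have "\<bar>\<integral>x. F x * v (x - z) \<partial>lborel\<bar> \<le> (\<integral>x. \<bar>F x * v (x - z)\<bar> \<partial>lborel)"
    by (rule integral_abs_bound)
  also have "\<dots> \<le> (\<integral>x. (l * (F x)\<^sup>2 + (v (x - z))\<^sup>2 / l) / 2 \<partial>lborel)"
    using F sv sq_integrable_mult_integrable[OF F sv(1)] abs_mult_le_weighted_squares[OF l]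
    by (intro integral_mono) (auto simp: sq_integrable_def)
  also have "\<dots> = (l * (\<integral>x. (F x)\<^sup>2 \<partial>lborel) + (\<integral>x. (v x)\<^sup>2 \<partial>lborel) / l) / 2"
    using F sv by (simp add: sq_integrable_def)
  also have "\<dots> \<le> (l * (\<integral>x. (F x)\<^sup>2 \<partial>lborel) + l) / 2"
    using v(2) l by (simp add: field_simps power2_eq_square)
  finally show ?thesis by (simp add: algebra_simps)
qed

lemma correlation_tendsto:
  fixes F :: "'a::euclidean_space \<Rightarrow> real"
  assumes F: "sq_integrable F" and H: "sq_integrable H"
    and z: "z \<longlonglongrightarrow> (0::'a)" "\<And>n::nat. norm (z n) \<le> 1"
  shows "(\<lambda>n. \<integral>x. F x * H (x - z n) \<partial>lborel) \<longlonglongrightarrow> (\<integral>x. F x * H x \<partial>lborel)"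
proof (rule LIMSEQ_I)
  fix r :: real assume r: "r > 0"
  \<comment> \<open>The added 1 keeps \<open>Q\<close> positive. With this \<open>l\<close> the
    error of replacing \<open>H\<close> by \<open>c\<close> is at most \<open>r / 4\<close> for
    every shift; it is paid at \<open>z n\<close> and at 0, with a third \<open>r / 4\<close> for
    the continuous limit.\<close>
  define Q where "Q = (\<integral>x. (F x)\<^sup>2 \<partial>lborel) + 1"
  have Q: "Q \<ge> 1" by (simp add: Q_def)
  define l where "l = r / (2 * Q)"
  have l: "l > 0" using r Q by (simp add: l_def)
  obtain c R where c: "continuous_on UNIV c" "\<And>x. norm x \<ge> R \<Longrightarrow> c x = 0"
    "sq_integrable c" "(\<integral>x. (H x - c x)\<^sup>2 \<partial>lborel) < l\<^sup>2"
    by (rule sq_integrable_approx_continuous[OF H, of "l\<^sup>2"]) (use l in auto)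
  have v: "sq_integrable (\<lambda>x. H x - c x)" using H c by (intro sq_integrable_diff)
  have bd: "\<bar>\<integral>x. F x * (H (x - y) - c (x - y)) \<partial>lborel\<bar> \<le> r / 4" for y
  proof -
    have "l * Q / 2 = r / 4" using Q by (simp add: l_def)
    then show ?thesis using correlation_bound[OF F v _ l, of y] c(4) by (simp add: Q_def)
  qed
  have eq: "(\<integral>x. F x * H (x - y) \<partial>lborel) - (\<integral>x. F x * c (x - y) \<partial>lborel)
      = (\<integral>x. F x * (H (x - y) - c (x - y)) \<partial>lborel)" for y
    using sq_integrable_mult_integrable[OF F sq_integrable_shift(1)[OF H]]
      sq_integrable_mult_integrable[OF F sq_integrable_shift(1)[OF c(3)]]
    by (simp add: right_diff_distrib)
  have r4: "r / 4 > 0" using r by simp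
  obtain n0 where n0: "\<And>n. n \<ge> n0 \<Longrightarrow>
      norm ((\<integral>x. F x * c (x - z n) \<partial>lborel) - (\<integral>x. F x * c x \<partial>lborel)) < r / 4"
    using LIMSEQ_D[OF correlation_tendsto_continuous[OF F c(1,2) z] r4] by blast
  have "norm ((\<integral>x. F x * H (x - z n) \<partial>lborel) - (\<integral>x. F x * H x \<partial>lborel)) < r" if "n \<ge> n0" for n
    using n0[OF that] bd[of "z n"] bd[of 0] eq[of "z n"] eq[of 0] r
    unfolding real_norm_def diff_zero by linarith
  then show "\<exists>no. \<forall>n\<ge>no. norm ((\<integral>x. F x * H (x - z n) \<partial>lborel) - (\<integral>x. F x * H x \<partial>lborel)) < r"
    by blast
qed

subsection \<open>Integration by parts for squares of weakly differentiable functions\<close>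

text \<open>Since |a b| is at most a^2 + b^2, the integrand is dominated by two kernels, each
  containing one square only. In each of these the kernel can be integrated first, and Tonelli
  applies.\<close>

lemma kernel_product_integrable:
  fixes a b \<kappa> :: "'a::euclidean_space \<Rightarrow> real"
  assumes \<kappa>: "integrable lborel \<kappa>" and a: "sq_integrable a" and b: "sq_integrable b"
  shows "integrable (lborel \<Otimes>\<^sub>M lborel) (\<lambda>(x, y). \<kappa> (x - y) * a x * b y)"
    and "integrable (lborel \<Otimes>\<^sub>M lborel) (\<lambda>(x, z). \<kappa> z * a x * b (x - z))"
proof -
  have [measurable]: "\<kappa> \<in> borel_measurable borel" "a \<in> borel_measurable borel" "b \<in> borel_measurable borel"
    using assms by (auto simp: sq_integrable_def dest: borel_measurable_integrable)
  have \<kappa>s: "integrable lborel (\<lambda>y. \<kappa> (x - y))" "(\<integral>y. \<bar>\<kappa> (x - y)\<bar> \<partial>lborel) = (\<integral>y. \<bar>\<kappa> y\<bar> \<partial>lborel)" for x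
    using \<kappa> integrable_lborel_affine[of \<kappa> "-1" x] integral_lborel_affine[of "\<lambda>x. \<bar>\<kappa> x\<bar>" "-1" x] by auto
  have \<kappa>t: "integrable lborel (\<lambda>y. \<kappa> (y - x))" "(\<integral>y. \<bar>\<kappa> (y - x)\<bar> \<partial>lborel) = (\<integral>y. \<bar>\<kappa> y\<bar> \<partial>lborel)" for x
    using \<kappa> integrable_lborel_affine[of \<kappa> "1" "-x"] integral_lborel_affine[of "\<lambda>x. \<bar>\<kappa> x\<bar>" "1" "-x"] by auto
  have 1: "integrable (lborel \<Otimes>\<^sub>M lborel) (\<lambda>(x, y). \<kappa> (x - y) * (a x)\<^sup>2)"
    using a \<kappa>s by (intro lborel_pair.Fubini_integrable) (auto simp: sq_integrable_def abs_mult)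
  have "integrable (lborel \<Otimes>\<^sub>M lborel) (\<lambda>(y, x). \<kappa> (x - y) * (b y)\<^sup>2)"
    using b \<kappa>t by (intro lborel_pair.Fubini_integrable) (auto simp: sq_integrable_def abs_mult)
  from lborel_pair.integrable_product_swap[OF this]
  have 2: "integrable (lborel \<Otimes>\<^sub>M lborel) (\<lambda>(x, y). \<kappa> (x - y) * (b y)\<^sup>2)" by simp
  have bd: "\<bar>k * p * q\<bar> \<le> \<bar>k * p\<^sup>2\<bar> + \<bar>k * q\<^sup>2\<bar>" for k p q :: real
  proof -
    have "\<bar>p * q\<bar> \<le> p\<^sup>2 + q\<^sup>2"
      using abs_mult_le_weighted_squares[of 1 p q] zero_le_power2[of p] zero_le_power2[of q] by simp
    from mult_left_mono[OF this abs_ge_zero[of k]] show ?thesis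
      by (simp add: abs_mult algebra_simps)
  qed
  show "integrable (lborel \<Otimes>\<^sub>M lborel) (\<lambda>(x, y). \<kappa> (x - y) * a x * b y)"
    by (rule Bochner_Integration.integrable_bound
        [OF Bochner_Integration.integrable_add[OF integrable_abs[OF 1] integrable_abs[OF 2]]])
      (auto intro!: AE_I2 bd order.trans[OF bd])
  have 3: "integrable (lborel \<Otimes>\<^sub>M lborel) (\<lambda>(x, z). \<kappa> z * (a x)\<^sup>2)"
    using a \<kappa> by (intro lborel_pair.Fubini_integrable) (auto simp: sq_integrable_def abs_mult)
  have "integrable (lborel \<Otimes>\<^sub>M lborel) (\<lambda>(z, x). \<kappa> z * (b (x - z))\<^sup>2)"
    using \<kappa> sq_integrable_shift[OF b]
    by (intro lborel_pair.Fubini_integrable) (auto simp: sq_integrable_def abs_mult)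
  from lborel_pair.integrable_product_swap[OF this]
  have 4: "integrable (lborel \<Otimes>\<^sub>M lborel) (\<lambda>(x, z). \<kappa> z * (b (x - z))\<^sup>2)" by simp
  show "integrable (lborel \<Otimes>\<^sub>M lborel) (\<lambda>(x, z). \<kappa> z * a x * b (x - z))"
    by (rule Bochner_Integration.integrable_bound
        [OF Bochner_Integration.integrable_add[OF integrable_abs[OF 3] integrable_abs[OF 4]]])
      (auto intro!: AE_I2 bd order.trans[OF bd])
qed

text \<open>The substitution z = x - y in the inner integral, followed by Fubini, exhibits a
  mollified product as an average of the correlation function over the shifts
  \<open>z\<close>.\<close>

lemma kernel_product_eq_correlation:
  fixes a b \<kappa> :: "'a::euclidean_space \<Rightarrow> real"
  assumes \<kappa>: "integrable lborel \<kappa>" and a: "sq_integrable a" and b: "sq_integrable b"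
  shows "(\<integral>x. (\<integral>y. \<kappa> (x - y) * a x * b y \<partial>lborel) \<partial>lborel) =
      (\<integral>z. \<kappa> z * (\<integral>x. a x * b (x - z) \<partial>lborel) \<partial>lborel)"
    and "integrable lborel (\<lambda>z. \<kappa> z * (\<integral>x. a x * b (x - z) \<partial>lborel))"
proof -
  have [measurable]: "\<kappa> \<in> borel_measurable borel" "a \<in> borel_measurable borel" "b \<in> borel_measurable borel"
    using assms by (auto simp: sq_integrable_def dest: borel_measurable_integrable)
  have "(\<integral>y. \<kappa> (x - y) * a x * b y \<partial>lborel) = (\<integral>z. \<kappa> z * a x * b (x - z) \<partial>lborel)" for x
    using integral_lborel_affine[of "\<lambda>y. \<kappa> (x - y) * a x * b y" "-1" x] by simp
  then have "(\<integral>x. (\<integral>y. \<kappa> (x - y) * a x * b y \<partial>lborel) \<partial>lborel) =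
      (\<integral>z. (\<integral>x. \<kappa> z * a x * b (x - z) \<partial>lborel) \<partial>lborel)"
    using lborel_pair.Fubini_integral[OF kernel_product_integrable(2)[OF assms]] by simp
  then show "(\<integral>x. (\<integral>y. \<kappa> (x - y) * a x * b y \<partial>lborel) \<partial>lborel) =
      (\<integral>z. \<kappa> z * (\<integral>x. a x * b (x - z) \<partial>lborel) \<partial>lborel)"
    by (simp add: mult.assoc)
  show "integrable lborel (\<lambda>z. \<kappa> z * (\<integral>x. a x * b (x - z) \<partial>lborel))"
    using lborel_pair.integrable_snd[OF kernel_product_integrable(2)[OF assms]]
    by (simp add: mult.assoc)
qed

lemma continuous_compact_support_integrable:
  fixes c :: "'a::euclidean_space \<Rightarrow> real"
  assumes c: "continuous_on UNIV c" "\<And>x. norm x \<ge> R \<Longrightarrow> c x = 0"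
  shows "integrable lborel c" "sq_integrable c"
proof -
  have int: "integrable lborel d" if "continuous_on UNIV d" "\<And>x. norm x \<ge> R \<Longrightarrow> d x = 0"
    for d :: "'a \<Rightarrow> real"
  proof -
    from continuous_compact_support_bounded[OF that] obtain K
      where "\<And>x. \<bar>d x\<bar> \<le> K * indicator (cball 0 R) x" by metis
    then show ?thesis
      using borel_measurable_continuous_onI[OF that(1)]
      by (intro Bochner_Integration.integrable_bound[OF integrable_const_on_cball[of K R]])
        (auto intro!: AE_I2 order.trans[OF _ abs_ge_self])
  qed
  show "integrable lborel c" using c by (rule int)
  have "integrable lborel (\<lambda>x. (c x)\<^sup>2)"
    using c by (intro int continuous_intros) auto
  then show "sq_integrable c"
    using borel_measurable_continuous_onI[OF c(1)] by (simp add: sq_integrable_def)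
qed

section \<open>Calculus of test functions\<close>

lemma partial_deriv_eq:
  "(\<phi> has_derivative D) (at x) \<Longrightarrow> partial_deriv \<phi> i x = D (axis i 1)"
  by (simp add: partial_deriv_def frechet_derivative_at[symmetric])

lemma test_fun_continuous: "test_fun \<phi> \<Longrightarrow> continuous_on UNIV \<phi>"
  unfolding test_fun_def
  by (blast intro: continuous_at_imp_continuous_on has_derivative_continuous)

lemma test_fun_partial_deriv_continuous:
  assumes "test_fun \<phi>" shows "continuous_on UNIV (partial_deriv \<phi> i)"
proof -
  from assms obtain D where D: "\<And>x. (\<phi> has_derivative D x) (at x)"
    "\<And>v. continuous_on UNIV (\<lambda>x. D x v)" unfolding test_fun_def by blast
  have "partial_deriv \<phi> i = (\<lambda>x. D x (axis i 1))" using partial_deriv_eq[OF D(1)] by auto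
  then show ?thesis using D(2) by simp
qed

lemma test_fun_support:
  assumes "test_fun \<phi>"
  obtains R where "\<And>x. norm x \<ge> R \<Longrightarrow> \<phi> x = 0" "\<And>x i. norm x \<ge> R \<Longrightarrow> partial_deriv \<phi> i x = 0"
proof -
  from assms obtain R where R: "\<And>x. norm x \<ge> R \<Longrightarrow> \<phi> x = 0" unfolding test_fun_def by blast
  \<comment> \<open>The margin 1 leaves a whole unit ball around \<open>x\<close> on which
    \<open>\<phi>\<close> vanishes, so the derivative there is that of the zero function.\<close>
  have "partial_deriv \<phi> i x = 0" if "norm x \<ge> R + 1" for x i
  proof -
    have "((\<lambda>_. 0) has_derivative (\<lambda>_. 0)) (at x)" by simp
    then have "(\<phi> has_derivative (\<lambda>_. 0)) (at x)"
    proof (rule has_derivative_transform_within)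
      fix y assume "dist y x < 1"
      then have "norm y \<ge> R" using that norm_triangle_ineq2[of x y] by (simp add: dist_norm norm_minus_commute)
      then show "0 = \<phi> y" using R by simp
    qed auto
    from partial_deriv_eq[OF this] show ?thesis .
  qed
  then show thesis using that[of "R + 1"] R by simp
qed

lemma test_fun_sq_integrable:
  assumes "test_fun \<phi>"
  shows "sq_integrable \<phi>" "sq_integrable (partial_deriv \<phi> i)"
    "integrable lborel \<phi>" "integrable lborel (partial_deriv \<phi> i)"
proof -
  obtain R where R: "\<And>x. norm x \<ge> R \<Longrightarrow> \<phi> x = 0" "\<And>x i. norm x \<ge> R \<Longrightarrow> partial_deriv \<phi> i x = 0"
    using test_fun_support[OF assms] by metis
  show "sq_integrable \<phi>" "sq_integrable (partial_deriv \<phi> i)"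
    "integrable lborel \<phi>" "integrable lborel (partial_deriv \<phi> i)"
    using continuous_compact_support_integrable[OF test_fun_continuous[OF assms] R(1)]
      continuous_compact_support_integrable[OF test_fun_partial_deriv_continuous[OF assms] R(2)]
    by auto
qed

lemma test_fun_bounded:
  assumes "test_fun \<phi>"
  obtains K where "K \<ge> 0" "\<And>x. \<bar>\<phi> x\<bar> \<le> K" "\<And>x. \<bar>partial_deriv \<phi> i x\<bar> \<le> K"
proof -
  obtain R where R: "\<And>x. norm x \<ge> R \<Longrightarrow> \<phi> x = 0" "\<And>x i. norm x \<ge> R \<Longrightarrow> partial_deriv \<phi> i x = 0"
    using test_fun_support[OF assms] by metis
  obtain K1 where K1: "K1 \<ge> 0" "\<And>x. \<bar>\<phi> x\<bar> \<le> K1"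
    using continuous_compact_support_bounded[OF test_fun_continuous[OF assms] R(1)] by metis
  obtain K2 where K2: "K2 \<ge> 0" "\<And>x. \<bar>partial_deriv \<phi> i x\<bar> \<le> K2"
    using continuous_compact_support_bounded[OF test_fun_partial_deriv_continuous[OF assms] R(2)] by metis
  have "\<bar>\<phi> x\<bar> \<le> max K1 K2" "\<bar>partial_deriv \<phi> i x\<bar> \<le> max K1 K2" for x
    using K1(2)[of x] K2(2)[of x] by auto
  with that K1(1) show thesis by (metis max.coboundedI1)
qed

text \<open>The factor \<open>f\<close> is continuously differentiable without compact support. This
  allows a product rule for a weakly differentiable function to be shifted onto its test
  function.\<close>

lemma test_fun_mult:
  assumes \<phi>: "test_fun \<phi>" and f: "\<And>x. (f has_derivative E x) (at x)" "\<And>v. continuous_on UNIV (\<lambda>x. E x v)"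
  shows "test_fun (\<lambda>x. f x * \<phi> x)"
    and "partial_deriv (\<lambda>x. f x * \<phi> x) i x = f x * partial_deriv \<phi> i x + E x (axis i 1) * \<phi> x"
proof -
  from \<phi> obtain D R where D: "\<And>x. (\<phi> has_derivative D x) (at x)"
    "\<And>v. continuous_on UNIV (\<lambda>x. D x v)" and R: "\<And>x. norm x \<ge> R \<Longrightarrow> \<phi> x = 0"
    unfolding test_fun_def by blast
  have d: "((\<lambda>x. f x * \<phi> x) has_derivative (\<lambda>v. f x * D x v + E x v * \<phi> x)) (at x)" for x
    using has_derivative_mult[OF f(1) D(1)] .
  have "continuous_on UNIV f"
    using f(1) by (auto intro!: continuous_at_imp_continuous_on has_derivative_continuous)
  then have c: "continuous_on UNIV (\<lambda>x. f x * D x v + E x v * \<phi> x)" for v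
    by (intro continuous_intros f D test_fun_continuous[OF \<phi>])
  show "test_fun (\<lambda>x. f x * \<phi> x)"
    unfolding test_fun_def
    using d c R by (intro conjI exI[of _ "\<lambda>x v. f x * D x v + E x v * \<phi> x"] exI[of _ R]) auto
  show "partial_deriv (\<lambda>x. f x * \<phi> x) i x = f x * partial_deriv \<phi> i x + E x (axis i 1) * \<phi> x"
    using partial_deriv_eq[OF d] partial_deriv_eq[OF D(1)] by simp
qed

lemma test_fun_affine:
  assumes \<phi>: "test_fun \<phi>" and c: "c \<noteq> 0"
  shows "test_fun (\<lambda>x. \<phi> (t + c *\<^sub>R x))"
    and "partial_deriv (\<lambda>x. \<phi> (t + c *\<^sub>R x)) i x = c * partial_deriv \<phi> i (t + c *\<^sub>R x)"
proof -
  from \<phi> obtain D R where D: "\<And>x. (\<phi> has_derivative D x) (at x)"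
    "\<And>v. continuous_on UNIV (\<lambda>x. D x v)" and R: "\<And>x. norm x \<ge> R \<Longrightarrow> \<phi> x = 0"
    unfolding test_fun_def by blast
  have d: "((\<lambda>x. \<phi> (t + c *\<^sub>R x)) has_derivative (\<lambda>v. D (t + c *\<^sub>R x) (c *\<^sub>R v))) (at x)" for x
    by (rule has_derivative_compose[where g=\<phi>, OF _ D(1)]) (auto intro!: derivative_eq_intros)
  have "continuous_on UNIV (\<lambda>x. D (t + c *\<^sub>R x) v)" for v
    by (rule continuous_on_compose2[OF D(2)]) (auto intro!: continuous_intros)
  moreover have "\<phi> (t + c *\<^sub>R x) = 0" if "norm x \<ge> (R + norm t) / \<bar>c\<bar>" for x
  proof (rule R)
    have "R + norm t \<le> \<bar>c\<bar> * norm x" using that c by (simp add: field_simps)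
    then show "R \<le> norm (t + c *\<^sub>R x)" using norm_triangle_ineq4[of "t + c *\<^sub>R x" t] by simp
  qed
  ultimately show "test_fun (\<lambda>x. \<phi> (t + c *\<^sub>R x))"
    unfolding test_fun_def using d
    by (intro conjI exI[of _ "\<lambda>x v. D (t + c *\<^sub>R x) (c *\<^sub>R v)"] exI[of _ "(R + norm t) / \<bar>c\<bar>"]) auto
  show "partial_deriv (\<lambda>x. \<phi> (t + c *\<^sub>R x)) i x = c * partial_deriv \<phi> i (t + c *\<^sub>R x)"
    using partial_deriv_eq[OF d] partial_deriv_eq[OF D(1)]
      linear_scale[OF has_derivative_linear[OF D(1)]] by simp
qed

section \<open>A mollifier, and recovery of a value from mollified averages\<close>

lemma has_real_derivative_max_0_power2:
  "((\<lambda>t::real. (max 0 t)\<^sup>2) has_real_derivative 2 * max 0 t) (at t)"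
proof -
  consider "t > 0" | "t < 0" | "t = 0" by linarith
  then show ?thesis
  proof cases
    case 1
    have "((\<lambda>t::real. t\<^sup>2) has_real_derivative 2 * t) (at t)"
      by (auto intro!: derivative_eq_intros)
    then show ?thesis using 1
      by (auto intro!: has_field_derivative_transform_within[where d=t and f="\<lambda>t. t\<^sup>2"] simp: dist_real_def max_def)
  next
    case 2
    have "((\<lambda>t::real. 0) has_real_derivative 0) (at t)" by simp
    from has_field_derivative_transform_within[OF this, of "- t" "\<lambda>t. (max 0 t)\<^sup>2"]
    show ?thesis using 2 by (simp add: dist_real_def max_def)
  next
    case 3
    have "((\<lambda>h::real. (max 0 h)\<^sup>2 / h) \<longlongrightarrow> 0) (at 0)"
    proof (rule Lim_null_comparison)
      show "eventually (\<lambda>h::real. norm ((max 0 h)\<^sup>2 / h) \<le> \<bar>h\<bar>) (at 0)"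
        by (auto simp: eventually_at_filter max_def power2_eq_square)
      show "((\<lambda>h::real. \<bar>h\<bar>) \<longlongrightarrow> 0) (at 0)"
        using tendsto_rabs[OF tendsto_ident_at, of "0::real" UNIV] by simp
    qed
    then show ?thesis using 3 by (simp add: has_field_derivative_iff)
  qed
qed

text \<open>The inner square makes the function smooth at the origin, the outer square removes the
  kink on the sphere of radius \<open>d\<close>, so that it is continuously differentiable. It is
  left unnormalised: what matters is that it is positive exactly on a ball and that its averages
  vanish.\<close>

definition bump :: "real \<Rightarrow> R3 \<Rightarrow> real" where
  "bump d x = (max 0 (d\<^sup>2 - (norm x)\<^sup>2))\<^sup>2"

lemma bump_nonneg: "bump d x \<ge> 0"
  by (simp add: bump_def)

lemma bump_pos: "norm x < d \<Longrightarrow> bump d x > 0"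
  using power_strict_mono[of "norm x" d 2] by (simp add: bump_def max_def)

lemma bump_support: "d \<ge> 0 \<Longrightarrow> norm x \<ge> d \<Longrightarrow> bump d x = 0"
  using power_mono[of d "norm x" 2] by (simp add: bump_def max_def)

lemma test_fun_bump:
  assumes "d \<ge> 0" shows "test_fun (bump d)"
proof -
  have "(bump d has_derivative (\<lambda>v. - 4 * max 0 (d\<^sup>2 - (norm x)\<^sup>2) * (x \<bullet> v))) (at x)" for x
  proof -
    have "((\<lambda>x::R3. d\<^sup>2 - (norm x)\<^sup>2) has_derivative (\<lambda>v. - 2 * (x \<bullet> v))) (at x)"
      unfolding power2_norm_eq_inner
      by (auto intro!: derivative_eq_intros simp: inner_commute)
    from has_derivative_compose[OF this
        has_real_derivative_max_0_power2[unfolded has_field_derivative_def]]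
    show ?thesis by (simp add: bump_def[abs_def] algebra_simps)
  qed
  moreover have "continuous_on UNIV (\<lambda>x. - 4 * max 0 (d\<^sup>2 - (norm x)\<^sup>2) * (x \<bullet> v))" for v :: R3
    by (intro continuous_intros)
  ultimately show ?thesis unfolding test_fun_def using bump_support[OF assms]
    by (intro conjI exI[of _ "\<lambda>x v. - 4 * max 0 (d\<^sup>2 - (norm x)\<^sup>2) * (x \<bullet> v)"] exI[of _ d]) auto
qed

text \<open>If \<open>T 0\<close> were nonzero, sequential continuity at 0 would give
  \<open>T\<close> a constant sign on some ball. A bump supported there has a strictly signed
  product with \<open>T\<close>, and a zero integral would make the ball a null set. The restriction
  to shifts of norm at most 1 matches \<open>correlation_tendsto\<close>.\<close>

lemma bump_means_zero_imp_zero: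
  fixes T :: "R3 \<Rightarrow> real"
  assumes lim: "\<And>z. z \<longlonglongrightarrow> 0 \<Longrightarrow> (\<And>n::nat. norm (z n) \<le> 1) \<Longrightarrow> (\<lambda>n. T (z n)) \<longlonglongrightarrow> T 0"
    and int: "\<And>d. d > 0 \<Longrightarrow> integrable lborel (\<lambda>z. bump d z * T z)"
    and zero: "\<And>d. d > 0 \<Longrightarrow> (\<integral>z. bump d z * T z \<partial>lborel) = 0"
  shows "T 0 = 0"
proof (rule ccontr)
  assume "T 0 \<noteq> 0"
  then obtain s where s: "s * T 0 > 0" by (metis not_square_less_zero linorder_neqE_linordered_idom mult_eq_0_iff)
  have "\<exists>d>0. \<forall>z. norm z < d \<longrightarrow> s * T z > 0"
  proof (rule ccontr)
    \<comment> \<open>Failure on every ball of radius 1 / (n + 1) yields a null sequence along which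
      \<open>s * T\<close> is nonpositive; the radii never exceed 1, as \<open>lim\<close>
      demands.\<close>
    assume "\<not> ?thesis"
    then have "\<forall>n. \<exists>z. norm z < 1 / real (Suc n) \<and> s * T z \<le> 0"
      by (metis of_nat_0_less_iff zero_less_Suc not_le zero_less_divide_1_iff)
    then obtain z where z: "\<And>n. norm (z n) < 1 / real (Suc n)" "\<And>n. s * T (z n) \<le> 0"
      by metis
    have "z \<longlonglongrightarrow> 0"
    proof (rule Lim_null_comparison)
      show "eventually (\<lambda>n. norm (z n) \<le> 1 / real (Suc n)) sequentially"
        using z(1) by (auto intro!: always_eventually less_imp_le)
      show "(\<lambda>n. 1 / real (Suc n)) \<longlonglongrightarrow> 0"
        using LIMSEQ_inverse_real_of_nat by (simp add: inverse_eq_divide)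
    qed
    moreover have "norm (z n) \<le> 1" for n
      using z(1)[of n] by (rule order.trans[OF less_imp_le]) (simp add: field_simps)
    ultimately have "(\<lambda>n. s * T (z n)) \<longlonglongrightarrow> s * T 0" by (intro tendsto_intros lim)
    then have "s * T 0 \<le> 0" by (rule LIMSEQ_le_const2) (use z(2) in auto)
    with s show False by simp
  qed
  then obtain d where d: "d > 0" "\<And>z. norm z < d \<Longrightarrow> s * T z > 0" by blast
  have nn: "s * (bump d z * T z) \<ge> 0" for z
    using d(2)[of z] bump_nonneg[of d z] bump_support[of d z] d(1) mult_nonneg_nonneg[of "bump d z" "s * T z"]
    by (cases "norm z < d") (auto simp: algebra_simps)
  have "(\<integral>z. s * (bump d z * T z) \<partial>lborel) = 0" using zero[OF d(1)] by simp
  then have "AE z in lborel. s * (bump d z * T z) = 0"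
    using int[OF d(1)] nn by (subst (asm) integral_nonneg_eq_0_iff_AE) auto
  then have "AE z in lborel. z \<notin> ball (0::R3) d"
  proof eventually_elim
    case (elim z)
    then show ?case using d(2)[of z] bump_pos[of z d] by force
  qed
  then have "ball 0 d \<in> null_sets (lborel :: R3 measure)"
    by (subst AE_iff_null_sets) auto
  then have "negligible (ball (0::R3) d)"
    by (metis negligible_iff_null_sets null_sets_completionI)
  then show False using d(1) open_not_negligible[of "ball (0::R3) d"] by simp
qed

lemma measurable_vec_nth_comp:
  fixes g :: "R3 \<Rightarrow> R3"
  shows "g \<in> borel_measurable borel \<Longrightarrow> (\<lambda>x. g x $ i) \<in> borel_measurable borel"
  using borel_measurable_inner[of g borel "\<lambda>_. axis i 1"] by (simp add: inner_axis)

lemma H1_sq_integrable: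
  assumes "H1_with_grad \<psi> g"
  shows "sq_integrable \<psi>" "sq_integrable (\<lambda>x. norm (g x))" "sq_integrable (\<lambda>x. g x $ i)"
    "g \<in> borel_measurable borel"
proof -
  show m: "sq_integrable \<psi>" "g \<in> borel_measurable borel" "sq_integrable (\<lambda>x. norm (g x))"
    using assms by (auto simp: H1_with_grad_def weak_gradient_def sq_integrable_def)
  have "integrable lborel (\<lambda>x. (g x $ i)\<^sup>2)"
  proof (rule Bochner_Integration.integrable_bound)
    show "integrable lborel (\<lambda>x. (norm (g x))\<^sup>2)" using assms by (simp add: H1_with_grad_def)
    show "AE x in lborel. norm ((g x $ i)\<^sup>2) \<le> norm ((norm (g x))\<^sup>2)"
      using power_mono[OF component_le_norm_cart abs_ge_zero, of _ i 2] by (auto intro!: AE_I2)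
  qed (use measurable_vec_nth_comp[OF m(2)] in simp)
  then show "sq_integrable (\<lambda>x. g x $ i)"
    using measurable_vec_nth_comp[OF m(2)] by (simp add: sq_integrable_def)
qed

text \<open>Testing the weak gradient with \<open>x \<mapsto> \<kappa> (x - y) u x\<close> and with \<open>y \<mapsto> \<kappa> (x - y)\<close> for a bump
  \<open>\<kappa>\<close> shows that the correlation function \<open>T\<close> below has vanishing bump averages around the origin;
  being continuous there, it vanishes at the origin, which is the product rule for \<open>\<psi>\<^sup>2\<close>.\<close>

lemma H1_square_weak_derivative_test:
  assumes H: "H1_with_grad \<psi> g" and u: "test_fun u"
  shows "(\<integral>x. (\<psi> x)\<^sup>2 * partial_deriv u i x \<partial>lborel) = - 2 * (\<integral>x. \<psi> x * g x $ i * u x \<partial>lborel)"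
proof -
  have W: "(\<integral>x. \<psi> x * partial_deriv \<phi> i x \<partial>lborel) = - (\<integral>x. g x $ i * \<phi> x \<partial>lborel)"
    if "test_fun \<phi>" for \<phi>
    using H that by (simp add: H1_with_grad_def weak_gradient_def)
  note sq = H1_sq_integrable[OF H]
  obtain C where C: "\<And>x. \<bar>u x\<bar> \<le> C" "\<And>x. \<bar>partial_deriv u i x\<bar> \<le> C"
    using test_fun_bounded[OF u] by metis
  have um: "u \<in> borel_measurable borel" "partial_deriv u i \<in> borel_measurable borel"
    using test_fun_sq_integrable[OF u] by (auto simp: sq_integrable_def)
  have s1: "sq_integrable (\<lambda>x. \<psi> x * u x)" "sq_integrable (\<lambda>x. \<psi> x * partial_deriv u i x)"
    "sq_integrable (\<lambda>x. g x $ i * u x)"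
    using sq um C by (auto intro!: sq_integrable_bounded_mult)
  \<comment> \<open>The three terms come from moving the derivative off the kernel in y, from the
    derivative falling on \<open>u\<close>, and from the weak derivative in x. At z = 0 the first
    and third coincide, so that \<open>T 0 = 0\<close> is the claim.\<close>
  define T where "T z = (\<integral>x. (\<psi> x * u x) * g (x - z) $ i \<partial>lborel) +
      (\<integral>x. (\<psi> x * partial_deriv u i x) * \<psi> (x - z) \<partial>lborel) + (\<integral>x. (g x $ i * u x) * \<psi> (x - z) \<partial>lborel)" for z
  have "T 0 = 0"
  proof (rule bump_means_zero_imp_zero)
    fix z :: "nat \<Rightarrow> R3" assume z: "z \<longlonglongrightarrow> 0" "\<And>n. norm (z n) \<le> 1"
    show "(\<lambda>n. T (z n)) \<longlonglongrightarrow> T 0"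
      unfolding T_def using correlation_tendsto[OF s1(1) sq(3) z] correlation_tendsto[OF s1(2) sq(1) z]
        correlation_tendsto[OF s1(3) sq(1) z]
      by (intro tendsto_add) simp_all
  next
    fix d :: real assume d: "d > 0"
    then have tK: "test_fun (bump d)" by (intro test_fun_bump) simp
    let ?K = "bump d" and ?dK = "partial_deriv (bump d) i"
    have iK: "integrable lborel ?K" "integrable lborel ?dK"
      using test_fun_sq_integrable[OF tK] by auto
    have tKy: "test_fun (\<lambda>x. ?K (x - y))" "partial_deriv (\<lambda>x. ?K (x - y)) i x = ?dK (x - y)" for x y
      using test_fun_affine[OF tK, of 1 "-y"] by auto
    have tKx: "test_fun (\<lambda>y. ?K (x - y))" "partial_deriv (\<lambda>y. ?K (x - y)) i y = - ?dK (x - y)" for x y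
      using test_fun_affine[OF tK, of "-1" x] by auto
    have Km: "?K \<in> borel_measurable borel" "?dK \<in> borel_measurable borel"
      using test_fun_sq_integrable[OF tK] by (auto simp: sq_integrable_def)
    note k1 = kernel_product_eq_correlation[OF iK(1) s1(1) sq(3)]
    note k2 = kernel_product_eq_correlation[OF iK(1) s1(2) sq(1)]
    note k3 = kernel_product_eq_correlation[OF iK(1) s1(3) sq(1)]
    show "integrable lborel (\<lambda>z. bump d z * T z)"
      using k1(2) k2(2) k3(2) unfolding T_def distrib_left by (intro Bochner_Integration.integrable_add)
    \<comment> \<open>Integration by parts in y. Differentiating the kernel in its second argument
      gives a minus sign, which cancels the one in the definition of the weak gradient.\<close>
    have p1: "(\<integral>y. ?dK (x - y) * (\<psi> x * u x) * \<psi> y \<partial>lborel) = (\<integral>y. ?K (x - y) * (\<psi> x * u x) * g y $ i \<partial>lborel)" for x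
    proof -
      have "(\<integral>y. ?dK (x - y) * (\<psi> x * u x) * \<psi> y \<partial>lborel) = - (\<psi> x * u x) * (\<integral>y. \<psi> y * - ?dK (x - y) \<partial>lborel)"
        by (subst integral_mult_right_zero[symmetric]) (simp add: mult_ac)
      also have "\<dots> = (\<psi> x * u x) * (\<integral>y. g y $ i * ?K (x - y) \<partial>lborel)"
        using W[OF tKx(1), of x] by (simp add: tKx(2))
      also have "\<dots> = (\<integral>y. ?K (x - y) * (\<psi> x * u x) * g y $ i \<partial>lborel)"
        by (subst integral_mult_right_zero[symmetric]) (simp add: mult_ac)
      finally show ?thesis .
    qed
    \<comment> \<open>Integration by parts in x. The test function is \<open>u\<close> times the
      kernel, so the product rule contributes the additional term with
      \<open>partial_deriv u i\<close>.\<close>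
    have p2: "(\<integral>x. ?dK (x - y) * (\<psi> x * u x) * \<psi> y \<partial>lborel) + (\<integral>x. ?K (x - y) * (\<psi> x * partial_deriv u i x) * \<psi> y \<partial>lborel)
        = - (\<integral>x. ?K (x - y) * (g x $ i * u x) * \<psi> y \<partial>lborel)" for y
    proof -
      from u obtain E where E: "\<And>x. (u has_derivative E x) (at x)" "\<And>v. continuous_on UNIV (\<lambda>x. E x v)"
        unfolding test_fun_def by blast
      have t: "test_fun (\<lambda>x. u x * ?K (x - y))"
        "partial_deriv (\<lambda>x. u x * ?K (x - y)) i x = u x * ?dK (x - y) + partial_deriv u i x * ?K (x - y)" for x
        using test_fun_mult[OF tKy(1) E] partial_deriv_eq[OF E(1)] by (auto simp: tKy(2))
      have sK: "sq_integrable (\<lambda>x. ?K (x - y))" "sq_integrable (\<lambda>x. ?dK (x - y))"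
        using sq_integrable_shift(1) test_fun_sq_integrable[OF tK] by auto
      have i: "integrable lborel (\<lambda>x. (\<psi> x * u x) * ?dK (x - y))"
        "integrable lborel (\<lambda>x. (\<psi> x * partial_deriv u i x) * ?K (x - y))"
        using s1 sK by (auto intro!: sq_integrable_mult_integrable)
      have "(\<integral>x. (\<psi> x * u x) * ?dK (x - y) \<partial>lborel) + (\<integral>x. (\<psi> x * partial_deriv u i x) * ?K (x - y) \<partial>lborel)
          = (\<integral>x. \<psi> x * partial_deriv (\<lambda>x. u x * ?K (x - y)) i x \<partial>lborel)"
        using Bochner_Integration.integral_add[OF i, symmetric] by (simp add: t(2) algebra_simps)
      also have "\<dots> = - (\<integral>x. (g x $ i * u x) * ?K (x - y) \<partial>lborel)"
        using W[OF t(1)] by (simp add: mult_ac)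
      finally have "((\<integral>x. (\<psi> x * u x) * ?dK (x - y) \<partial>lborel) + (\<integral>x. (\<psi> x * partial_deriv u i x) * ?K (x - y) \<partial>lborel)) * \<psi> y
          = - (\<integral>x. (g x $ i * u x) * ?K (x - y) \<partial>lborel) * \<psi> y" by simp
      then have "(\<integral>x. (\<psi> x * u x) * ?dK (x - y) * \<psi> y \<partial>lborel)
          + (\<integral>x. (\<psi> x * partial_deriv u i x) * ?K (x - y) * \<psi> y \<partial>lborel)
          = - (\<integral>x. (g x $ i * u x) * ?K (x - y) * \<psi> y \<partial>lborel)"
        by (simp only: distrib_right integral_mult_left_zero mult_minus_left)
      then show ?thesis by (simp add: mult_ac)
    qed
    note kp = kernel_product_integrable(1)
    \<comment> \<open>Fubini lets the same double integral with the differentiated kernel be read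
      through \<open>p1\<close> and through \<open>p2\<close>; eliminating it leaves a relation with
      undifferentiated kernels only.\<close>
    have "(\<integral>x. (\<integral>y. ?dK (x - y) * (\<psi> x * u x) * \<psi> y \<partial>lborel) \<partial>lborel)
        + (\<integral>x. (\<integral>y. ?K (x - y) * (\<psi> x * partial_deriv u i x) * \<psi> y \<partial>lborel) \<partial>lborel)
        = (\<integral>y. (\<integral>x. ?dK (x - y) * (\<psi> x * u x) * \<psi> y \<partial>lborel) \<partial>lborel)
        + (\<integral>y. (\<integral>x. ?K (x - y) * (\<psi> x * partial_deriv u i x) * \<psi> y \<partial>lborel) \<partial>lborel)"
      using lborel_pair.Fubini_integral[OF kp[OF iK(2) s1(1) sq(1)]]
        lborel_pair.Fubini_integral[OF kp[OF iK(1) s1(2) sq(1)]] by simp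
    also have "\<dots> = (\<integral>y. (\<integral>x. ?dK (x - y) * (\<psi> x * u x) * \<psi> y \<partial>lborel)
        + (\<integral>x. ?K (x - y) * (\<psi> x * partial_deriv u i x) * \<psi> y \<partial>lborel) \<partial>lborel)"
      using lborel_pair.integrable_snd[OF kp[OF iK(2) s1(1) sq(1)]]
        lborel_pair.integrable_snd[OF kp[OF iK(1) s1(2) sq(1)]] by simp
    also have "\<dots> = - (\<integral>y. (\<integral>x. ?K (x - y) * (g x $ i * u x) * \<psi> y \<partial>lborel) \<partial>lborel)"
      unfolding p2 by simp
    also have "\<dots> = - (\<integral>x. (\<integral>y. ?K (x - y) * (g x $ i * u x) * \<psi> y \<partial>lborel) \<partial>lborel)"
      using lborel_pair.Fubini_integral[OF kp[OF iK(1) s1(3) sq(1)]] by simp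
    finally have "(\<integral>z. ?K z * (\<integral>x. (\<psi> x * u x) * g (x - z) $ i \<partial>lborel) \<partial>lborel)
      + (\<integral>z. ?K z * (\<integral>x. (\<psi> x * partial_deriv u i x) * \<psi> (x - z) \<partial>lborel) \<partial>lborel)
      + (\<integral>z. ?K z * (\<integral>x. (g x $ i * u x) * \<psi> (x - z) \<partial>lborel) \<partial>lborel) = 0"
      unfolding p1 k1(1) k2(1) k3(1) by simp
    then show "(\<integral>z. bump d z * T z \<partial>lborel) = 0"
      using k1(2) k2(2) k3(2) unfolding T_def distrib_left by simp
  qed
  then show ?thesis by (simp add: T_def power2_eq_square mult_ac)
qed

text \<open>The field \<open>u\<close> is cut off by dilated bumps \<open>bump 1\<close> at scale 1
  / \<open>c n\<close>. These tend to \<open>bump 1 0\<close>, which is 1, and their derivatives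
  carry the factor \<open>c n\<close>, so the term produced by the cutoff disappears in the limit.
  Boundedness of \<open>u\<close> and of its derivative provides the dominating functions.\<close>

lemma H1_square_weak_derivative:
  assumes H: "H1_with_grad \<psi> g"
    and u: "\<And>x. (u has_derivative E x) (at x)" "\<And>v. continuous_on UNIV (\<lambda>x. E x v)"
    and b: "\<And>x. \<bar>u x\<bar> \<le> C" "\<And>x. \<bar>E x (axis i 1)\<bar> \<le> C"
  shows "(\<integral>x. (\<psi> x)\<^sup>2 * E x (axis i 1) \<partial>lborel) = - 2 * (\<integral>x. \<psi> x * g x $ i * u x \<partial>lborel)"
    and "integrable lborel (\<lambda>x. (\<psi> x)\<^sup>2 * E x (axis i 1))" "integrable lborel (\<lambda>x. \<psi> x * g x $ i * u x)"
proof -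
  note sq = H1_sq_integrable[OF H]
  have [measurable]: "\<psi> \<in> borel_measurable borel" "(\<lambda>x. g x $ i) \<in> borel_measurable borel"
    using sq(1,3) by (auto simp: sq_integrable_def)
  have uc: "continuous_on UNIV u"
    using u(1) by (blast intro: continuous_at_imp_continuous_on has_derivative_continuous)
  then have [measurable]: "u \<in> borel_measurable borel" by (rule borel_measurable_continuous_onI)
  have [measurable]: "(\<lambda>x. E x (axis i 1)) \<in> borel_measurable borel"
    using u(2) by (rule borel_measurable_continuous_onI)
  have s: "sq_integrable (\<lambda>x. \<psi> x * u x)" "sq_integrable (\<lambda>x. \<psi> x * E x (axis i 1))"
    using b sq by (auto intro!: sq_integrable_bounded_mult)
  show i1: "integrable lborel (\<lambda>x. (\<psi> x)\<^sup>2 * E x (axis i 1))"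
    using sq_integrable_mult_integrable[OF sq(1) s(2)] by (simp add: power2_eq_square mult_ac)
  show i2: "integrable lborel (\<lambda>x. \<psi> x * g x $ i * u x)"
    using sq_integrable_mult_integrable[OF s(1) sq(3)] by (simp add: power2_eq_square mult_ac)
  have t0: "test_fun (bump 1)" by (rule test_fun_bump) simp
  obtain K where K: "K \<ge> 0" "\<And>x. \<bar>bump 1 x\<bar> \<le> K" "\<And>x. \<bar>partial_deriv (bump 1) i x\<bar> \<le> K"
    using test_fun_bounded[OF t0] by metis
  define c where "c n = 1 / real (Suc n)" for n
  have c: "c n \<noteq> 0" "0 \<le> c n" "c n \<le> 1" for n by (auto simp: c_def)
  have clim: "c \<longlonglongrightarrow> 0" unfolding c_def using LIMSEQ_inverse_real_of_nat by (simp add: inverse_eq_divide)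
  define ch where "ch n x = bump 1 (0 + c n *\<^sub>R x)" for n x
  have t: "test_fun (ch n)" "partial_deriv (ch n) i x = c n * partial_deriv (bump 1) i (c n *\<^sub>R x)" for n x
    unfolding ch_def using test_fun_affine[OF t0 c(1), of 0] by simp_all
  note tm = test_fun_mult[OF t(1) u]
  have [measurable]: "partial_deriv (\<lambda>x. u x * ch n x) i \<in> borel_measurable borel" "ch n \<in> borel_measurable borel" for n
    using test_fun_sq_integrable[OF tm(1)] test_fun_sq_integrable[OF t(1)] by (auto simp: sq_integrable_def)
  have chlim: "(\<lambda>n. ch n x) \<longlonglongrightarrow> 1" for x
  proof -
    have "(\<lambda>n. bump 1 (0 + c n *\<^sub>R x)) \<longlonglongrightarrow> bump 1 (0 + 0 *\<^sub>R x)"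
      by (rule continuous_on_tendsto_compose[OF test_fun_continuous[OF t0]]) (intro tendsto_intros clim | simp)+
    then show ?thesis by (simp add: ch_def) (simp add: bump_def)
  qed
  have dlim: "(\<lambda>n. partial_deriv (\<lambda>x. u x * ch n x) i x) \<longlonglongrightarrow> E x (axis i 1)" for x
  proof -
    have "(\<lambda>n. partial_deriv (bump 1) i (c n *\<^sub>R x)) \<longlonglongrightarrow> partial_deriv (bump 1) i (0 *\<^sub>R x)"
      by (rule continuous_on_tendsto_compose[OF test_fun_partial_deriv_continuous[OF t0]])
        (intro tendsto_intros clim | simp)+
    then have "(\<lambda>n. u x * (c n * partial_deriv (bump 1) i (c n *\<^sub>R x)) + E x (axis i 1) * ch n x)
      \<longlonglongrightarrow> u x * (0 * partial_deriv (bump 1) i (0 *\<^sub>R x)) + E x (axis i 1) * 1"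
      by (intro tendsto_intros clim chlim)
    then show ?thesis by (simp add: tm(2) t(2))
  qed
  have C: "C \<ge> 0" using b(1)[of 0] by linarith
  \<comment> \<open>One \<open>C * K\<close> for each of the two terms of the product rule;
    \<open>c n\<close> being at most 1 makes it uniform in \<open>n\<close>.\<close>
  have dbd: "\<bar>partial_deriv (\<lambda>x. u x * ch n x) i x\<bar> \<le> 2 * (C * K)" for n x
  proof -
    have "\<bar>c n * partial_deriv (bump 1) i (c n *\<^sub>R x)\<bar> \<le> 1 * K"
      unfolding abs_mult using c K by (intro mult_mono) auto
    then have "\<bar>u x * (c n * partial_deriv (bump 1) i (c n *\<^sub>R x))\<bar> \<le> C * K"
      using b(1)[of x] C unfolding abs_mult[of "u x"] by (intro mult_mono) auto
    moreover have "\<bar>E x (axis i 1) * ch n x\<bar> \<le> C * K"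
      unfolding abs_mult ch_def using b K C by (intro mult_mono) auto
    ultimately show ?thesis unfolding tm(2) t(2) by linarith
  qed
  have L: "(\<lambda>n. \<integral>x. (\<psi> x)\<^sup>2 * partial_deriv (\<lambda>x. u x * ch n x) i x \<partial>lborel) \<longlonglongrightarrow> (\<integral>x. (\<psi> x)\<^sup>2 * E x (axis i 1) \<partial>lborel)"
  proof (rule integral_dominated_convergence)
    show "integrable lborel (\<lambda>x. (\<psi> x)\<^sup>2 * (2 * (C * K)))" using sq(1) by (simp add: sq_integrable_def)
    show "AE x in lborel. norm ((\<psi> x)\<^sup>2 * partial_deriv (\<lambda>x. u x * ch n x) i x) \<le> (\<psi> x)\<^sup>2 * (2 * (C * K))" for n
      using dbd by (intro AE_I2) (simp add: abs_mult mult_left_mono)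
  qed (auto intro!: tendsto_intros dlim)
  have R: "(\<lambda>n. \<integral>x. \<psi> x * g x $ i * (u x * ch n x) \<partial>lborel) \<longlonglongrightarrow> (\<integral>x. \<psi> x * g x $ i * (u x * 1) \<partial>lborel)"
  proof (rule integral_dominated_convergence)
    show "integrable lborel (\<lambda>x. \<bar>\<psi> x * g x $ i * u x\<bar> * K)" using i2 by simp
    show "AE x in lborel. norm (\<psi> x * g x $ i * (u x * ch n x)) \<le> \<bar>\<psi> x * g x $ i * u x\<bar> * K" for n
    proof (rule AE_I2)
      fix x
      show "norm (\<psi> x * g x $ i * (u x * ch n x)) \<le> \<bar>\<psi> x * g x $ i * u x\<bar> * K"
        using mult_left_mono[OF K(2)[of "c n *\<^sub>R x"] abs_ge_zero[of "\<psi> x * g x $ i * u x"]]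
        by (simp add: abs_mult ch_def mult.assoc)
    qed
    show "AE x in lborel. (\<lambda>n. \<psi> x * g x $ i * (u x * ch n x)) \<longlonglongrightarrow> \<psi> x * g x $ i * (u x * 1)"
      by (intro AE_I2 tendsto_intros chlim)
  qed measurable
  have "(\<lambda>n. - 2 * (\<integral>x. \<psi> x * g x $ i * (u x * ch n x) \<partial>lborel)) \<longlonglongrightarrow> - 2 * (\<integral>x. \<psi> x * g x $ i * (u x * 1) \<partial>lborel)"
    by (intro tendsto_mult_left R)
  then have "(\<lambda>n. \<integral>x. (\<psi> x)\<^sup>2 * partial_deriv (\<lambda>x. u x * ch n x) i x \<partial>lborel) \<longlonglongrightarrow> - 2 * (\<integral>x. \<psi> x * g x $ i * (u x * 1) \<partial>lborel)"
    unfolding H1_square_weak_derivative_test[OF H tm(1)] .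
  from LIMSEQ_unique[OF L this]
  show "(\<integral>x. (\<psi> x)\<^sup>2 * E x (axis i 1) \<partial>lborel) = - 2 * (\<integral>x. \<psi> x * g x $ i * u x \<partial>lborel)" by simp
qed

section \<open>The divergence identity for radial vector fields\<close>

lemma norm_power2_R3: "(norm (x::R3))\<^sup>2 = (\<Sum>i\<in>UNIV. (x $ i)\<^sup>2)"
  unfolding power2_norm_eq_inner inner_vec_def by (simp add: power2_eq_square)

lemma has_derivative_radial:
  fixes y :: R3
  assumes "(\<phi> has_real_derivative \<phi>' ((norm (x - y))\<^sup>2)) (at ((norm (x - y))\<^sup>2))"
  shows "((\<lambda>x. \<phi> ((norm (x - y))\<^sup>2)) has_derivative (\<lambda>v. 2 * \<phi>' ((norm (x - y))\<^sup>2) * ((x - y) \<bullet> v))) (at x)"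
proof -
  have "((\<lambda>x. (norm (x - y))\<^sup>2) has_derivative (\<lambda>v. 2 * ((x - y) \<bullet> v))) (at x)"
    unfolding power2_norm_eq_inner by (auto intro!: derivative_eq_intros simp: inner_commute)
  from has_derivative_compose[OF this assms[unfolded has_field_derivative_def]]
  show ?thesis by (simp add: algebra_simps)
qed

text \<open>This is the divergence theorem for \<open>\<psi>\<close> squared times the field
  \<open>\<phi> (r x)\<close> (x - y), whose divergence in dimension 3 is the bracket on the left.
  The profile is a function of the squared distance, which keeps the field differentiable at
  \<open>y\<close>; the bounds \<open>b\<close> say that the field and its diagonal partial
  derivatives are bounded.\<close>

lemma H1_radial_divergence:
  fixes y :: R3
  assumes H: "H1_with_grad \<psi> g"
    and \<phi>: "\<And>t. t \<ge> 0 \<Longrightarrow> (\<phi> has_real_derivative \<phi>' t) (at t)" "continuous_on {0..} \<phi>'"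
    and b: "\<And>t. t \<ge> 0 \<Longrightarrow> \<bar>\<phi> t\<bar> \<le> C" "\<And>t. t \<ge> 0 \<Longrightarrow> \<bar>\<phi> t\<bar> * sqrt t \<le> C" "\<And>t. t \<ge> 0 \<Longrightarrow> \<bar>\<phi>' t\<bar> * t \<le> C"
  defines "r \<equiv> \<lambda>x. (norm (x - y))\<^sup>2"
  shows "(\<integral>x. (\<psi> x)\<^sup>2 * (3 * \<phi> (r x) + 2 * \<phi>' (r x) * r x) \<partial>lborel)
      = - 2 * (\<integral>x. \<psi> x * \<phi> (r x) * (g x \<bullet> (x - y)) \<partial>lborel)"
    and "integrable lborel (\<lambda>x. (\<psi> x)\<^sup>2 * (3 * \<phi> (r x) + 2 * \<phi>' (r x) * r x))"
    and "integrable lborel (\<lambda>x. \<psi> x * \<phi> (r x) * (g x \<bullet> (x - y)))"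
proof -
  define u where "u i x = \<phi> (r x) * (x - y) $ i" for i and x :: R3
  define E where "E i x v = \<phi> (r x) * v $ i + 2 * \<phi>' (r x) * ((x - y) \<bullet> v) * (x - y) $ i" for i and x v :: R3
  have d: "(u i has_derivative E i x) (at x)" for i x
  proof -
    have "((\<lambda>x. \<phi> (r x)) has_derivative (\<lambda>v. 2 * \<phi>' (r x) * ((x - y) \<bullet> v))) (at x)"
      unfolding r_def by (intro has_derivative_radial \<phi>) simp
    moreover have "((\<lambda>x. (x - y) $ i) has_derivative (\<lambda>v. v $ i)) (at x)"
      by (auto intro!: derivative_eq_intros bounded_linear_imp_has_derivative bounded_linear_vec_nth)
    ultimately have "((\<lambda>x. \<phi> (r x) * (x - y) $ i) has_derivative
        (\<lambda>v. \<phi> (r x) * v $ i + 2 * \<phi>' (r x) * ((x - y) \<bullet> v) * (x - y) $ i)) (at x)"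
      by (rule has_derivative_mult)
    then show ?thesis by (simp add: u_def[abs_def] E_def[abs_def])
  qed
  have rc: "continuous_on UNIV r" unfolding r_def by (intro continuous_intros)
  have pc: "continuous_on {0..} \<phi>"
    using \<phi>(1) by (auto intro!: continuous_at_imp_continuous_on DERIV_isCont)
  have c: "continuous_on UNIV (\<lambda>x. E i x v)" for i v
    unfolding E_def
    by (intro continuous_intros continuous_on_compose2[OF \<phi>(2) rc] continuous_on_compose2[OF pc rc])
      (auto simp: r_def)
  have r0: "r x \<ge> 0" "norm (x - y) = sqrt (r x)" for x by (auto simp: r_def)
  \<comment> \<open>The field itself is bounded by \<open>C\<close>. The constant
    \<open>3 * C\<close> is what its derivative requires, \<open>C\<close> from
    \<open>\<phi>\<close> and \<open>2 * C\<close> from the term with \<open>\<phi>'\<close>, and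
    one constant has to serve both.\<close>
  have ub: "\<bar>u i x\<bar> \<le> 3 * C" for i x
  proof -
    have "\<bar>(x - y) $ i\<bar> \<le> sqrt (r x)" using component_le_norm_cart[of "x - y" i] by (simp add: r0(2))
    then have "\<bar>u i x\<bar> \<le> \<bar>\<phi> (r x)\<bar> * sqrt (r x)"
      by (simp add: u_def abs_mult mult_left_mono)
    also have "\<dots> \<le> C" using b(2) r0(1) by blast
    also have "\<dots> \<le> 3 * C" using b(1)[of 0] by linarith
    finally show ?thesis .
  qed
  have Ei: "E i x (axis i 1) = \<phi> (r x) + 2 * \<phi>' (r x) * ((x - y) $ i)\<^sup>2" for i x
    by (simp add: E_def inner_axis power2_eq_square)
  have Eb: "\<bar>E i x (axis i 1)\<bar> \<le> 3 * C" for i x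
  proof -
    have "((x - y) $ i)\<^sup>2 \<le> r x"
      using power_mono[OF component_le_norm_cart[of "x - y" i] abs_ge_zero, of 2] by (simp add: r_def)
    then have "\<bar>\<phi>' (r x) * ((x - y) $ i)\<^sup>2\<bar> \<le> \<bar>\<phi>' (r x)\<bar> * r x"
      by (simp add: abs_mult mult_left_mono)
    also have "\<dots> \<le> C" using b(3) r0(1) by blast
    finally show ?thesis using b(1)[OF r0(1)[of x]] unfolding Ei by linarith
  qed
  note ibp = H1_square_weak_derivative[OF H d c ub Eb]
  have divE: "(\<Sum>i\<in>UNIV. E i x (axis i 1)) = 3 * \<phi> (r x) + 2 * \<phi>' (r x) * r x" for x
    by (simp add: Ei sum.distrib sum_distrib_left[symmetric] norm_power2_R3[of "x - y"] r_def)
  have gu: "(\<Sum>i\<in>UNIV. \<psi> x * g x $ i * u i x) = \<psi> x * \<phi> (r x) * (g x \<bullet> (x - y))" for x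
    by (simp add: u_def inner_vec_def sum_distrib_left mult_ac)
  show "(\<integral>x. (\<psi> x)\<^sup>2 * (3 * \<phi> (r x) + 2 * \<phi>' (r x) * r x) \<partial>lborel)
      = - 2 * (\<integral>x. \<psi> x * \<phi> (r x) * (g x \<bullet> (x - y)) \<partial>lborel)"
    unfolding divE[symmetric] gu[symmetric] sum_distrib_left
    by (simp add: integral_sum ibp sum_distrib_left)
  show "integrable lborel (\<lambda>x. (\<psi> x)\<^sup>2 * (3 * \<phi> (r x) + 2 * \<phi>' (r x) * r x))"
    unfolding divE[symmetric] sum_distrib_left by (intro Bochner_Integration.integrable_sum ibp)
  show "integrable lborel (\<lambda>x. \<psi> x * \<phi> (r x) * (g x \<bullet> (x - y)))"
    unfolding gu[symmetric] by (intro Bochner_Integration.integrable_sum ibp)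
qed

subsection \<open>The Coulomb uncertainty principle\<close>

text \<open>The vector field \<open>(x - y) / |x - y|\<close>, of divergence \<open>2 / |x - y|\<close>, regularised at \<open>y\<close>.\<close>

lemma H1_coulomb_regularized:
  fixes y :: R3
  assumes H: "H1_with_grad \<psi> g" and d: "d > 0" and l: "l > 0"
  shows "(\<integral>x. (\<psi> x)\<^sup>2 / sqrt ((norm (x - y))\<^sup>2 + d) \<partial>lborel)
      \<le> (l * (\<integral>x. (\<psi> x)\<^sup>2 \<partial>lborel) + (\<integral>x. (norm (g x))\<^sup>2 \<partial>lborel) / l) / 2"
    and "integrable lborel (\<lambda>x. (\<psi> x)\<^sup>2 / sqrt ((norm (x - y))\<^sup>2 + d))"
proof -
  note sq = H1_sq_integrable[OF H]
  have [measurable]: "\<psi> \<in> borel_measurable borel" using sq by (simp add: sq_integrable_def)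
  define \<phi> where "\<phi> t = 1 / sqrt (t + d)" for t
  define \<phi>' where "\<phi>' t = - 1 / (2 * (t + d) * sqrt (t + d))" for t
  define C where "C = max 1 (1 / sqrt d)"
  have b0: "\<bar>\<phi> t\<bar> \<le> 1 / sqrt d" if "t \<ge> 0" for t
    using that d by (simp add: \<phi>_def frac_le)
  have b1: "\<bar>\<phi> t\<bar> * sqrt t \<le> 1" if "t \<ge> 0" for t
    using that d by (simp add: \<phi>_def)
  have b2: "\<bar>\<phi>' t\<bar> * t \<le> \<bar>\<phi> t\<bar>" if "t \<ge> 0" for t
    using that d by (simp add: \<phi>_def \<phi>'_def abs_mult divide_simps)
  have der: "(\<phi> has_real_derivative \<phi>' t) (at t)" if "t \<ge> 0" for t
    unfolding \<phi>_def[abs_def] \<phi>'_def using that d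
    by (auto intro!: derivative_eq_intros simp: field_simps)
  have cont: "continuous_on {0..} \<phi>'"
    unfolding \<phi>'_def using d by (intro continuous_intros) auto
  have bC: "\<bar>\<phi> t\<bar> \<le> C" "\<bar>\<phi> t\<bar> * sqrt t \<le> C" "\<bar>\<phi>' t\<bar> * t \<le> C" if "t \<ge> 0" for t
    using b0[OF that] b1[OF that] b2[OF that] by (auto simp: C_def)
  have twice: "- 2 * a \<le> b" if "\<bar>a\<bar> \<le> b / 2" for a b :: real using that by linarith
  note div = H1_radial_divergence[OF H der cont bC, of y]
  show int: "integrable lborel (\<lambda>x. (\<psi> x)\<^sup>2 / sqrt ((norm (x - y))\<^sup>2 + d))"
  proof (rule Bochner_Integration.integrable_bound)
    show "integrable lborel (\<lambda>x. (\<psi> x)\<^sup>2 * (1 / sqrt d))" using sq(1) by (simp add: sq_integrable_def)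
    have "\<bar>(\<psi> x)\<^sup>2 / sqrt ((norm (x - y))\<^sup>2 + d)\<bar> \<le> \<bar>(\<psi> x)\<^sup>2 * (1 / sqrt d)\<bar>" for x
      using mult_left_mono[OF b0[of "(norm (x - y))\<^sup>2"], of "(\<psi> x)\<^sup>2"] d by (simp add: \<phi>_def abs_mult)
    then show "AE x in lborel. norm ((\<psi> x)\<^sup>2 / sqrt ((norm (x - y))\<^sup>2 + d)) \<le> norm ((\<psi> x)\<^sup>2 * (1 / sqrt d))"
      by simp
  qed measurable
  \<comment> \<open>Here 2 \<open>\<phi>'\<close> t equals minus \<open>\<phi>\<close> t / (t + d),
    which is at least minus \<open>\<phi>\<close>. Regularising therefore errs on the favourable
    side: the divergence stays above twice the regularised potential.\<close>
  have ge: "2 * \<phi> t \<le> 3 * \<phi> t + 2 * \<phi>' t * t" if "t \<ge> 0" for t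
    using b2[OF that] that d by (simp add: \<phi>_def \<phi>'_def divide_simps)
  have "2 * (\<integral>x. (\<psi> x)\<^sup>2 / sqrt ((norm (x - y))\<^sup>2 + d) \<partial>lborel) = (\<integral>x. (\<psi> x)\<^sup>2 * (2 * \<phi> ((norm (x - y))\<^sup>2)) \<partial>lborel)"
    by (subst integral_mult_right_zero[symmetric]) (simp add: \<phi>_def mult.commute)
  also have "\<dots> \<le> (\<integral>x. (\<psi> x)\<^sup>2 * (3 * \<phi> ((norm (x - y))\<^sup>2) + 2 * \<phi>' ((norm (x - y))\<^sup>2) * (norm (x - y))\<^sup>2) \<partial>lborel)"
  proof (rule integral_mono)
    show "integrable lborel (\<lambda>x. (\<psi> x)\<^sup>2 * (2 * \<phi> ((norm (x - y))\<^sup>2)))"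
      using integrable_mult_right[OF int, of 2] by (simp add: \<phi>_def mult.commute)
    show "(\<psi> x)\<^sup>2 * (2 * \<phi> ((norm (x - y))\<^sup>2))
        \<le> (\<psi> x)\<^sup>2 * (3 * \<phi> ((norm (x - y))\<^sup>2) + 2 * \<phi>' ((norm (x - y))\<^sup>2) * (norm (x - y))\<^sup>2)" for x
      using ge by (intro mult_left_mono) auto
  qed (rule div(2))
  also have "\<dots> = (\<integral>x. - 2 * (\<psi> x * \<phi> ((norm (x - y))\<^sup>2) * (g x \<bullet> (x - y))) \<partial>lborel)"
    using div(1) by simp
  also have "\<dots> \<le> (\<integral>x. l * (\<psi> x)\<^sup>2 + (norm (g x))\<^sup>2 / l \<partial>lborel)"
  proof (rule integral_mono)
    show "integrable lborel (\<lambda>x. - 2 * (\<psi> x * \<phi> ((norm (x - y))\<^sup>2) * (g x \<bullet> (x - y))))"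
      using div(3) by (intro integrable_mult_right) simp
    show "integrable lborel (\<lambda>x. l * (\<psi> x)\<^sup>2 + (norm (g x))\<^sup>2 / l)"
      using sq(1,2) by (simp add: sq_integrable_def)
    fix x
    have "\<bar>\<phi> ((norm (x - y))\<^sup>2)\<bar> * \<bar>g x \<bullet> (x - y)\<bar> \<le> \<bar>\<phi> ((norm (x - y))\<^sup>2)\<bar> * (norm (g x) * norm (x - y))"
      by (intro mult_left_mono Cauchy_Schwarz_ineq2) simp
    also have "\<dots> \<le> norm (g x)"
      using mult_left_mono[OF b1[of "(norm (x - y))\<^sup>2"], of "norm (g x)"] by (simp add: mult_ac)
    finally have "\<bar>\<psi> x\<bar> * (\<bar>\<phi> ((norm (x - y))\<^sup>2)\<bar> * \<bar>g x \<bullet> (x - y)\<bar>) \<le> \<bar>\<psi> x\<bar> * norm (g x)"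
      by (intro mult_left_mono) auto
    then have "\<bar>\<psi> x * \<phi> ((norm (x - y))\<^sup>2) * (g x \<bullet> (x - y))\<bar> \<le> \<bar>\<psi> x * norm (g x)\<bar>"
      by (simp add: abs_mult mult_ac)
    also have "\<dots> \<le> (l * (\<psi> x)\<^sup>2 + (norm (g x))\<^sup>2 / l) / 2"
      by (rule abs_mult_le_weighted_squares[OF l])
    finally show "- 2 * (\<psi> x * \<phi> ((norm (x - y))\<^sup>2) * (g x \<bullet> (x - y))) \<le> l * (\<psi> x)\<^sup>2 + (norm (g x))\<^sup>2 / l"
      by (rule twice)
  qed
  also have "\<dots> = l * (\<integral>x. (\<psi> x)\<^sup>2 \<partial>lborel) + (\<integral>x. (norm (g x))\<^sup>2 \<partial>lborel) / l"
    using sq(1,2) by (simp add: sq_integrable_def)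
  finally show "(\<integral>x. (\<psi> x)\<^sup>2 / sqrt ((norm (x - y))\<^sup>2 + d) \<partial>lborel)
      \<le> (l * (\<integral>x. (\<psi> x)\<^sup>2 \<partial>lborel) + (\<integral>x. (norm (g x))\<^sup>2 \<partial>lborel) / l) / 2" by simp
qed

text \<open>Fatou's lemma as the regularisation \<open>d\<close> tends to 0, the regularised bound
  being independent of \<open>d\<close>. It is independent of \<open>y\<close> as well, which later
  bounds the potential generated by \<open>\<psi>\<close> squared uniformly.\<close>

lemma H1_coulomb:
  fixes y :: R3
  assumes H: "H1_with_grad \<psi> g" and l: "l > 0"
  shows "(\<integral>x. (\<psi> x)\<^sup>2 / norm (x - y) \<partial>lborel)
      \<le> (l * (\<integral>x. (\<psi> x)\<^sup>2 \<partial>lborel) + (\<integral>x. (norm (g x))\<^sup>2 \<partial>lborel) / l) / 2" (is "_ \<le> ?B")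
    and "integrable lborel (\<lambda>x. (\<psi> x)\<^sup>2 / norm (x - y))"
proof -
  have [measurable]: "\<psi> \<in> borel_measurable borel" using H1_sq_integrable[OF H] by (simp add: sq_integrable_def)
  have B: "?B \<ge> 0" using l by simp
  define d where "d n = 1 / real (Suc n)" for n
  have d: "d n > 0" for n by (simp add: d_def)
  have dlim: "d \<longlonglongrightarrow> 0" unfolding d_def using LIMSEQ_inverse_real_of_nat by (simp add: inverse_eq_divide)
  have pt: "ennreal ((\<psi> x)\<^sup>2 / norm (x - y)) \<le> liminf (\<lambda>n. ennreal ((\<psi> x)\<^sup>2 / sqrt ((norm (x - y))\<^sup>2 + d n)))" for x
  \<comment> \<open>On the diagonal the left side is 0, division by zero having the value 0.\<close>
  proof (cases "x = y")
    case False
    have "(\<lambda>n. ennreal ((\<psi> x)\<^sup>2 / sqrt ((norm (x - y))\<^sup>2 + d n))) \<longlonglongrightarrow> ennreal ((\<psi> x)\<^sup>2 / sqrt ((norm (x - y))\<^sup>2 + 0))"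
      using False by (intro tendsto_intros dlim) auto
    from lim_imp_Liminf[OF _ this] show ?thesis by simp
  qed simp
  have "(\<integral>\<^sup>+x. ennreal ((\<psi> x)\<^sup>2 / norm (x - y)) \<partial>lborel)
      \<le> (\<integral>\<^sup>+x. liminf (\<lambda>n. ennreal ((\<psi> x)\<^sup>2 / sqrt ((norm (x - y))\<^sup>2 + d n))) \<partial>lborel)"
    using pt by (intro nn_integral_mono) simp
  also have "\<dots> \<le> liminf (\<lambda>n. \<integral>\<^sup>+x. ennreal ((\<psi> x)\<^sup>2 / sqrt ((norm (x - y))\<^sup>2 + d n)) \<partial>lborel)"
    by (intro nn_integral_liminf) measurable
  also have "\<dots> \<le> liminf (\<lambda>n. ennreal ?B)"
  proof (intro Liminf_mono always_eventually allI)
    fix n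
    have "(\<integral>\<^sup>+x. ennreal ((\<psi> x)\<^sup>2 / sqrt ((norm (x - y))\<^sup>2 + d n)) \<partial>lborel)
      = ennreal (\<integral>x. (\<psi> x)\<^sup>2 / sqrt ((norm (x - y))\<^sup>2 + d n) \<partial>lborel)"
      using H1_coulomb_regularized(2)[OF H d l] d[of n]
      by (intro nn_integral_eq_integral) (auto simp: less_imp_le)
    then show "(\<integral>\<^sup>+x. ennreal ((\<psi> x)\<^sup>2 / sqrt ((norm (x - y))\<^sup>2 + d n)) \<partial>lborel) \<le> ennreal ?B"
      using H1_coulomb_regularized(1)[OF H d l] by (simp add: ennreal_leI)
  qed
  also have "\<dots> = ennreal ?B" by (simp add: Liminf_const)
  finally have le: "(\<integral>\<^sup>+x. ennreal ((\<psi> x)\<^sup>2 / norm (x - y)) \<partial>lborel) \<le> ennreal ?B" .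
  show int: "integrable lborel (\<lambda>x. (\<psi> x)\<^sup>2 / norm (x - y))"
    using le by (intro integrableI_bounded) (auto simp: top_unique less_top[symmetric] intro: order.strict_trans1)
  have "ennreal (\<integral>x. (\<psi> x)\<^sup>2 / norm (x - y) \<partial>lborel) \<le> ennreal ?B"
    using le nn_integral_eq_integral[OF int] by simp
  then show "(\<integral>x. (\<psi> x)\<^sup>2 / norm (x - y) \<partial>lborel) \<le> ?B"
    using B by (simp add: ennreal_le_iff)
qed

subsection \<open>Variations of the minimizer\<close>

text \<open>The weak gradient of \<open>\<psi>\<close> is tested with f times the test function, so
  Leibniz is needed for classical derivatives only. Bounds on \<open>f\<close> and on its gradient
  keep the product and its gradient square integrable; these are the competitors for the
  variation.\<close>

lemma H1_mult:
  assumes H: "H1_with_grad \<psi> g"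
    and f: "\<And>x. (f has_derivative (\<lambda>v. F x \<bullet> v)) (at x)" "continuous_on UNIV F"
    and b: "\<And>x. \<bar>f x\<bar> \<le> C" "\<And>x. norm (F x) \<le> C"
  shows "H1_with_grad (\<lambda>x. f x * \<psi> x) (\<lambda>x. f x *\<^sub>R g x + \<psi> x *\<^sub>R F x)"
proof -
  note sq = H1_sq_integrable[OF H]
  have [measurable]: "\<psi> \<in> borel_measurable borel" "g \<in> borel_measurable borel"
    using sq by (auto simp: sq_integrable_def)
  have "continuous_on UNIV f"
    using f(1) by (blast intro: continuous_at_imp_continuous_on has_derivative_continuous)
  then have fm[measurable]: "f \<in> borel_measurable borel" by (rule borel_measurable_continuous_onI)
  have Fm[measurable]: "F \<in> borel_measurable borel" using f(2) by (rule borel_measurable_continuous_onI)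
  have Fi: "(\<lambda>x. F x $ i) \<in> borel_measurable borel" for i by (rule measurable_vec_nth_comp[OF Fm])
  have Fb: "\<bar>F x $ i\<bar> \<le> C" for x i using component_le_norm_cart[of "F x" i] b(2)[of x] by simp
  have s: "sq_integrable (\<lambda>x. \<psi> x * f x)" "sq_integrable (\<lambda>x. g x $ i * f x)"
    "sq_integrable (\<lambda>x. \<psi> x * F x $ i)" "sq_integrable (\<lambda>x. norm (g x) * f x)" "sq_integrable (\<lambda>x. \<psi> x * norm (F x))" for i
    using sq b Fi Fb by (auto intro!: sq_integrable_bounded_mult)
  have "weak_gradient (\<lambda>x. f x * \<psi> x) (\<lambda>x. f x *\<^sub>R g x + \<psi> x *\<^sub>R F x)"
    unfolding weak_gradient_def
  proof (intro conjI allI impI)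
    fix \<phi> i assume \<phi>: "test_fun \<phi>"
    note s\<phi> = test_fun_sq_integrable[OF \<phi>]
    have E: "continuous_on UNIV (\<lambda>x. F x \<bullet> v)" for v by (intro continuous_intros f(2))
    note t = test_fun_mult[OF \<phi> f(1) E]
    have W: "(\<integral>x. \<psi> x * partial_deriv (\<lambda>x. f x * \<phi> x) i x \<partial>lborel) = - (\<integral>x. g x $ i * (f x * \<phi> x) \<partial>lborel)"
      using H t(1) by (simp add: H1_with_grad_def weak_gradient_def)
    have i1: "integrable lborel (\<lambda>x. (\<psi> x * f x) * partial_deriv \<phi> i x)"
      and i2: "integrable lborel (\<lambda>x. (\<psi> x * F x $ i) * \<phi> x)"
      and i3: "integrable lborel (\<lambda>x. (g x $ i * f x) * \<phi> x)"
      using s s\<phi> by (auto intro!: sq_integrable_mult_integrable)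
    show "integrable lborel (\<lambda>x. f x * \<psi> x * partial_deriv \<phi> i x)" using i1 by (simp add: mult_ac)
    have eq: "(f x *\<^sub>R g x + \<psi> x *\<^sub>R F x) $ i * \<phi> x = (g x $ i * f x) * \<phi> x + (\<psi> x * F x $ i) * \<phi> x" for x
      by (simp add: algebra_simps)
    show "integrable lborel (\<lambda>x. (f x *\<^sub>R g x + \<psi> x *\<^sub>R F x) $ i * \<phi> x)"
      unfolding eq using i3 i2 by (rule Bochner_Integration.integrable_add)
    have "(\<integral>x. \<psi> x * partial_deriv (\<lambda>x. f x * \<phi> x) i x \<partial>lborel)
        = (\<integral>x. (\<psi> x * f x) * partial_deriv \<phi> i x + (\<psi> x * F x $ i) * \<phi> x \<partial>lborel)"
      unfolding t(2) inner_axis by (simp add: algebra_simps)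
    also have "\<dots> = (\<integral>x. (\<psi> x * f x) * partial_deriv \<phi> i x \<partial>lborel) + (\<integral>x. (\<psi> x * F x $ i) * \<phi> x \<partial>lborel)"
      using i1 i2 by (rule Bochner_Integration.integral_add)
    finally have "(\<integral>x. (\<psi> x * f x) * partial_deriv \<phi> i x \<partial>lborel)
      = - (\<integral>x. (g x $ i * f x) * \<phi> x \<partial>lborel) - (\<integral>x. (\<psi> x * F x $ i) * \<phi> x \<partial>lborel)"
      using W by (simp add: mult_ac)
    also have "\<dots> = - (\<integral>x. (f x *\<^sub>R g x + \<psi> x *\<^sub>R F x) $ i * \<phi> x \<partial>lborel)"
      unfolding eq Bochner_Integration.integral_add[OF i3 i2] by simp
    finally show "(\<integral>x. f x * \<psi> x * partial_deriv \<phi> i x \<partial>lborel) = - (\<integral>x. (f x *\<^sub>R g x + \<psi> x *\<^sub>R F x) $ i * \<phi> x \<partial>lborel)"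
      by (simp add: mult_ac)
  qed measurable
  moreover have "integrable lborel (\<lambda>x. (f x * \<psi> x)\<^sup>2)"
    using s(1) by (simp add: sq_integrable_def mult.commute)
  moreover have "integrable lborel (\<lambda>x. (norm (f x *\<^sub>R g x + \<psi> x *\<^sub>R F x))\<^sup>2)"
  proof (rule Bochner_Integration.integrable_bound)
    show "integrable lborel (\<lambda>x. 2 * (norm (g x) * f x)\<^sup>2 + 2 * (\<psi> x * norm (F x))\<^sup>2)"
      using s(4,5) by (simp add: sq_integrable_def)
    have "(norm (f x *\<^sub>R g x + \<psi> x *\<^sub>R F x))\<^sup>2 \<le> 2 * (norm (g x) * f x)\<^sup>2 + 2 * (\<psi> x * norm (F x))\<^sup>2" for x
    proof -
      have "(norm (f x *\<^sub>R g x + \<psi> x *\<^sub>R F x))\<^sup>2 \<le> (norm (f x *\<^sub>R g x) + norm (\<psi> x *\<^sub>R F x))\<^sup>2"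
        by (intro power_mono norm_triangle_ineq) simp
      also have "\<dots> \<le> 2 * (norm (f x *\<^sub>R g x))\<^sup>2 + 2 * (norm (\<psi> x *\<^sub>R F x))\<^sup>2"
        using sum_squares_bound[of "norm (f x *\<^sub>R g x)" "norm (\<psi> x *\<^sub>R F x)"] unfolding power2_sum by simp
      finally show ?thesis by (simp add: power_mult_distrib mult.commute)
    qed
    then show "AE x in lborel. norm ((norm (f x *\<^sub>R g x + \<psi> x *\<^sub>R F x))\<^sup>2)
        \<le> norm (2 * (norm (g x) * f x)\<^sup>2 + 2 * (\<psi> x * norm (F x))\<^sup>2)"
      by (intro AE_I2) simp
  qed measurable
  ultimately show ?thesis by (simp add: H1_with_grad_def)
qed

lemma H1_scale:
  assumes H: "H1_with_grad \<psi> g" and t: "t > 0"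
  shows "H1_with_grad (\<lambda>x. s * \<psi> (t *\<^sub>R x)) (\<lambda>x. (s * t) *\<^sub>R g (t *\<^sub>R x))"
proof -
  note sq = H1_sq_integrable[OF H]
  have m[measurable]: "\<psi> \<in> borel_measurable borel" "g \<in> borel_measurable borel"
    using sq by (auto simp: sq_integrable_def)
  note gi[measurable] = measurable_vec_nth_comp[OF m(2)]
  have sc: "integrable lborel (\<lambda>x. h (t *\<^sub>R x)) \<longleftrightarrow> integrable lborel h"
    "(\<integral>x. h (t *\<^sub>R x) \<partial>lborel) = (\<integral>x. h x \<partial>lborel) / t ^ 3"
    if "h \<in> borel_measurable borel" for h :: "R3 \<Rightarrow> real"
    using integrable_lborel_affine[OF that, of t 0] integral_lborel_affine[OF that, of t 0] t by auto
  have "weak_gradient (\<lambda>x. s * \<psi> (t *\<^sub>R x)) (\<lambda>x. (s * t) *\<^sub>R g (t *\<^sub>R x))"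
    unfolding weak_gradient_def
  proof (intro conjI allI impI)
    fix \<phi> i assume \<phi>: "test_fun \<phi>"
    define \<phi>' where "\<phi>' x = \<phi> (0 + (1 / t) *\<^sub>R x)" for x
    have t\<phi>': "test_fun \<phi>'" "partial_deriv \<phi>' i x = (1 / t) * partial_deriv \<phi> i (0 + (1 / t) *\<^sub>R x)" for x
      unfolding \<phi>'_def using test_fun_affine[OF \<phi>, of "1/t" 0] t by auto
    have inv: "\<phi> x = \<phi>' (t *\<^sub>R x)" "partial_deriv \<phi> i x = t * partial_deriv \<phi>' i (t *\<^sub>R x)" for x
      unfolding t\<phi>'(2) using t by (simp_all add: \<phi>'_def)
    have [measurable]: "\<phi>' \<in> borel_measurable borel" "partial_deriv \<phi>' i \<in> borel_measurable borel"
      using test_fun_sq_integrable[OF t\<phi>'(1)] by (auto simp: sq_integrable_def)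
    have i: "integrable lborel (\<lambda>x. \<psi> x * partial_deriv \<phi>' i x)" "integrable lborel (\<lambda>x. g x $ i * \<phi>' x)"
      and W: "(\<integral>x. \<psi> x * partial_deriv \<phi>' i x \<partial>lborel) = - (\<integral>x. g x $ i * \<phi>' x \<partial>lborel)"
      using H t\<phi>'(1) by (auto simp: H1_with_grad_def weak_gradient_def)
    have e1: "s * \<psi> (t *\<^sub>R x) * partial_deriv \<phi> i x = (s * t) * (\<lambda>x. \<psi> x * partial_deriv \<phi>' i x) (t *\<^sub>R x)"
      and e2: "((s * t) *\<^sub>R g (t *\<^sub>R x)) $ i * \<phi> x = (s * t) * (\<lambda>x. g x $ i * \<phi>' x) (t *\<^sub>R x)" for x
      by (simp_all add: inv)
    have mm: "(\<lambda>x. \<psi> x * partial_deriv \<phi>' i x) \<in> borel_measurable borel" "(\<lambda>x. g x $ i * \<phi>' x) \<in> borel_measurable borel"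
      by measurable
    show "integrable lborel (\<lambda>x. s * \<psi> (t *\<^sub>R x) * partial_deriv \<phi> i x)"
      unfolding e1 using sc(1)[OF mm(1)] i(1) by (intro integrable_mult_right) simp
    show "integrable lborel (\<lambda>x. ((s * t) *\<^sub>R g (t *\<^sub>R x)) $ i * \<phi> x)"
      unfolding e2 using sc(1)[OF mm(2)] i(2) by (intro integrable_mult_right) simp
    show "(\<integral>x. s * \<psi> (t *\<^sub>R x) * partial_deriv \<phi> i x \<partial>lborel) = - (\<integral>x. ((s * t) *\<^sub>R g (t *\<^sub>R x)) $ i * \<phi> x \<partial>lborel)"
      unfolding e1 e2 integral_mult_right_zero sc(2)[OF mm(1)] sc(2)[OF mm(2)] W by simp
  qed measurable
  moreover have "integrable lborel (\<lambda>x. (s * \<psi> (t *\<^sub>R x))\<^sup>2)"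
    using sq(1) sc(1)[of "\<lambda>x. (\<psi> x)\<^sup>2"] by (simp add: sq_integrable_def power_mult_distrib)
  moreover have "integrable lborel (\<lambda>x. (norm ((s * t) *\<^sub>R g (t *\<^sub>R x)))\<^sup>2)"
    using sq(2) sc(1)[of "\<lambda>x. (norm (g x))\<^sup>2"] by (simp add: sq_integrable_def power_mult_distrib)
  ultimately show ?thesis by (simp add: H1_with_grad_def)
qed

text \<open>With amplitude s and dilation t in dimension 3 the three terms scale like s^2 / t, s^2 /
  t^2 and s^4 / t^5. Fixing the repulsion forces s = t^(5/4), and t = u^4 avoids fractional
  powers.\<close>

lemma hartree_energy_scale:
  assumes H: "H1_with_grad \<psi> g" and u: "u > 0"
  shows "hartree_energy Z (\<lambda>x. u ^ 5 * \<psi> (u ^ 4 *\<^sub>R x)) (\<lambda>x. (u ^ 5 * u ^ 4) *\<^sub>R g (u ^ 4 *\<^sub>R x)) =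
      u ^ 6 * (\<integral>x. (norm (g x))\<^sup>2 \<partial>lborel) - u\<^sup>2 * (\<integral>x. Z / norm x * (\<psi> x)\<^sup>2 \<partial>lborel)
      + 1/2 * (\<integral>x. (\<integral>y. (\<psi> x)\<^sup>2 * (\<psi> y)\<^sup>2 / norm (x - y) \<partial>lborel) \<partial>lborel)"
proof -
  note sq = H1_sq_integrable[OF H]
  have m[measurable]: "\<psi> \<in> borel_measurable borel" "g \<in> borel_measurable borel"
    using sq by (auto simp: sq_integrable_def)
  have sc: "(\<integral>x. h (u ^ 4 *\<^sub>R x) \<partial>lborel) = (\<integral>x. h x \<partial>lborel) / u ^ 12"
    if "h \<in> borel_measurable borel" for h :: "R3 \<Rightarrow> real"
    using integral_lborel_affine[OF that, of "u ^ 4" 0] u by (simp add: power_mult[symmetric])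
  have 1: "(\<integral>x. (norm ((u ^ 5 * u ^ 4) *\<^sub>R g (u ^ 4 *\<^sub>R x)))\<^sup>2 \<partial>lborel) = u ^ 6 * (\<integral>x. (norm (g x))\<^sup>2 \<partial>lborel)"
  proof -
    have "(\<integral>x. (norm ((u ^ 5 * u ^ 4) *\<^sub>R g (u ^ 4 *\<^sub>R x)))\<^sup>2 \<partial>lborel)
        = u ^ 18 * (\<integral>x. (\<lambda>x. (norm (g x))\<^sup>2) (u ^ 4 *\<^sub>R x) \<partial>lborel)"
      by (subst integral_mult_right_zero[symmetric])
        (simp add: power_mult_distrib power_mult[symmetric] power_add[symmetric])
    also have "\<dots> = u ^ 18 / u ^ 12 * (\<integral>x. (norm (g x))\<^sup>2 \<partial>lborel)"
      by (subst sc) auto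
    also have "u ^ 18 / u ^ 12 = u ^ 6" using u by (simp add: power_diff[symmetric])
    finally show ?thesis .
  qed
  have 2: "(\<integral>x. Z / norm x * (u ^ 5 * \<psi> (u ^ 4 *\<^sub>R x))\<^sup>2 \<partial>lborel) = u\<^sup>2 * (\<integral>x. Z / norm x * (\<psi> x)\<^sup>2 \<partial>lborel)"
  proof -
    have "(\<integral>x. Z / norm x * (u ^ 5 * \<psi> (u ^ 4 *\<^sub>R x))\<^sup>2 \<partial>lborel)
        = u ^ 14 * (\<integral>x. (\<lambda>x. Z / norm x * (\<psi> x)\<^sup>2) (u ^ 4 *\<^sub>R x) \<partial>lborel)"
    proof (subst integral_mult_right_zero[symmetric], intro Bochner_Integration.integral_cong refl)
      fix x :: R3
      have "Z / norm x = u ^ 4 * (Z / norm (u ^ 4 *\<^sub>R x))" using u by simp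
      moreover have "(u ^ 5 * \<psi> (u ^ 4 *\<^sub>R x))\<^sup>2 = u ^ 10 * (\<psi> (u ^ 4 *\<^sub>R x))\<^sup>2"
        by (simp add: power_mult_distrib power_mult[symmetric])
      moreover have "u ^ 14 = u ^ 10 * u ^ 4" by (simp add: power_add[symmetric])
      ultimately show "Z / norm x * (u ^ 5 * \<psi> (u ^ 4 *\<^sub>R x))\<^sup>2 = u ^ 14 * (Z / norm (u ^ 4 *\<^sub>R x) * (\<psi> (u ^ 4 *\<^sub>R x))\<^sup>2)"
        by (simp only: mult_ac)
    qed
    also have "\<dots> = u ^ 14 / u ^ 12 * (\<integral>x. Z / norm x * (\<psi> x)\<^sup>2 \<partial>lborel)"
      by (subst sc) auto
    also have "u ^ 14 / u ^ 12 = u\<^sup>2" using u by (simp add: power_diff[symmetric])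
    finally show ?thesis .
  qed
  define h where "h x = (\<integral>y. (\<psi> x)\<^sup>2 * (\<psi> y)\<^sup>2 / norm (x - y) \<partial>lborel)" for x
  have hm: "h \<in> borel_measurable borel" unfolding h_def by measurable
  have 3: "(\<integral>x. (\<integral>y. (u ^ 5 * \<psi> (u ^ 4 *\<^sub>R x))\<^sup>2 * (u ^ 5 * \<psi> (u ^ 4 *\<^sub>R y))\<^sup>2 / norm (x - y) \<partial>lborel) \<partial>lborel)
      = (\<integral>x. h x \<partial>lborel)"
  proof -
    have inner: "(\<integral>y. (u ^ 5 * \<psi> (u ^ 4 *\<^sub>R x))\<^sup>2 * (u ^ 5 * \<psi> (u ^ 4 *\<^sub>R y))\<^sup>2 / norm (x - y) \<partial>lborel)
        = u ^ 12 * h (u ^ 4 *\<^sub>R x)" for x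
    proof -
      have "(\<integral>y. (u ^ 5 * \<psi> (u ^ 4 *\<^sub>R x))\<^sup>2 * (u ^ 5 * \<psi> (u ^ 4 *\<^sub>R y))\<^sup>2 / norm (x - y) \<partial>lborel)
        = u ^ 24 * (\<integral>y. (\<lambda>y. (\<psi> (u ^ 4 *\<^sub>R x))\<^sup>2 * (\<psi> y)\<^sup>2 / norm (u ^ 4 *\<^sub>R x - y)) (u ^ 4 *\<^sub>R y) \<partial>lborel)"
      proof (subst integral_mult_right_zero[symmetric], intro Bochner_Integration.integral_cong refl)
        fix y :: R3
        let ?P = "(\<psi> (u ^ 4 *\<^sub>R x))\<^sup>2 * (\<psi> (u ^ 4 *\<^sub>R y))\<^sup>2"
        have "norm (u ^ 4 *\<^sub>R x - u ^ 4 *\<^sub>R y) = u ^ 4 * norm (x - y)"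
          using u by (simp add: scaleR_diff_right[symmetric] del: scaleR_diff_right)
        then have "?P / norm (x - y) = u ^ 4 * (?P / norm (u ^ 4 *\<^sub>R x - u ^ 4 *\<^sub>R y))"
          using u by simp
        moreover have "(u ^ 5 * \<psi> (u ^ 4 *\<^sub>R x))\<^sup>2 * (u ^ 5 * \<psi> (u ^ 4 *\<^sub>R y))\<^sup>2 / norm (x - y)
            = u ^ 10 * u ^ 10 * (?P / norm (x - y))"
          by (simp add: power_mult_distrib power_mult[symmetric])
        moreover have "u ^ 24 = u ^ 10 * u ^ 10 * u ^ 4" by (simp add: power_add[symmetric])
        ultimately show "(u ^ 5 * \<psi> (u ^ 4 *\<^sub>R x))\<^sup>2 * (u ^ 5 * \<psi> (u ^ 4 *\<^sub>R y))\<^sup>2 / norm (x - y)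
            = u ^ 24 * (?P / norm (u ^ 4 *\<^sub>R x - u ^ 4 *\<^sub>R y))"
          by (simp only: mult_ac)
      qed
      also have "\<dots> = u ^ 24 / u ^ 12 * h (u ^ 4 *\<^sub>R x)"
        by (subst sc) (auto simp: h_def)
      also have "u ^ 24 / u ^ 12 = u ^ 12" using u by (simp add: power_diff[symmetric])
      finally show ?thesis .
    qed
    show ?thesis unfolding inner integral_mult_right_zero sc[OF hm] using u by simp
  qed
  show ?thesis unfolding hartree_energy_def 1 2 3 h_def ..
qed

text \<open>The substitution \<open>\<psi> x \<mapsto> u\<^sup>5 \<psi> (u\<^sup>4 x)\<close> leaves the repulsion energy unchanged, so minimality
  relates the other two terms.\<close>

lemma hartree_minimizer_virial:
  assumes H: "H1_with_grad \<psi> g"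
    and min: "\<And>\<phi> h. H1_with_grad \<phi> h \<Longrightarrow> hartree_energy Z \<psi> g \<le> hartree_energy Z \<phi> h"
  shows "3 * (\<integral>x. (norm (g x))\<^sup>2 \<partial>lborel) \<le> (\<integral>x. Z / norm x * (\<psi> x)\<^sup>2 \<partial>lborel)" (is "3 * ?A \<le> ?B")
proof -
  \<comment> \<open>Minimality under scaling reads (1 - v^3) A <= (1 - v) B with v = u^2. Dividing
    by 1 - v > 0 and letting v tend to 1 from below produces the factor 3.\<close>
  have le: "(1 + v + v\<^sup>2) * ?A \<le> ?B" if v: "0 < v" "v < 1" for v
  proof -
    define u where "u = sqrt v"
    have u: "u > 0" "u\<^sup>2 = v" using v by (auto simp: u_def)
    have "u ^ 6 = (u\<^sup>2) ^ 3" by (simp only: power_mult[symmetric]) simp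
    then have u6: "u ^ 6 = v ^ 3" by (simp only: u(2))
    have "hartree_energy Z \<psi> g \<le>
        hartree_energy Z (\<lambda>x. u ^ 5 * \<psi> (u ^ 4 *\<^sub>R x)) (\<lambda>x. (u ^ 5 * u ^ 4) *\<^sub>R g (u ^ 4 *\<^sub>R x))"
      using H u by (intro min H1_scale) auto
    then have "?A - ?B \<le> v ^ 3 * ?A - v * ?B"
      unfolding hartree_energy_scale[OF H u(1)] unfolding hartree_energy_def u(2) u6 by simp
    then have "(1 - v) * ((1 + v + v\<^sup>2) * ?A) \<le> (1 - v) * ?B"
      by (simp add: algebra_simps power2_eq_square power3_eq_cube)
    then show ?thesis using v by (simp add: mult_le_cancel_left)
  qed
  have "((\<lambda>v. (1 + v + v\<^sup>2) * ?A) \<longlongrightarrow> (1 + 1 + 1\<^sup>2) * ?A) (at_left 1)"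
    by (intro tendsto_intros)
  moreover have "eventually (\<lambda>v. (1 + v + v\<^sup>2) * ?A \<le> ?B) (at_left 1)"
    using le by (intro eventually_at_leftI[of 0]) auto
  ultimately have "(1 + 1 + 1\<^sup>2) * ?A \<le> ?B" by (intro tendsto_upperbound) auto
  then show ?thesis by simp
qed

text \<open>The weight Z / 3 is the one for which the virial inequality turns the kinetic part of
  the uncertainty principle into \<open>?B\<close> itself, leaving \<open>?B\<close> at most the
  mean of Z / 3 times \<open>?N\<close> and \<open>?B\<close>.\<close>

lemma hartree_minimizer_attraction_bound:
  assumes H: "H1_with_grad \<psi> g" and Z: "Z > 0"
    and min: "\<And>\<phi> h. H1_with_grad \<phi> h \<Longrightarrow> hartree_energy Z \<psi> g \<le> hartree_energy Z \<phi> h"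
  shows "(\<integral>x. (\<psi> x)\<^sup>2 / norm x \<partial>lborel) \<le> Z / 3 * (\<integral>x. (\<psi> x)\<^sup>2 \<partial>lborel)" (is "?B \<le> Z / 3 * ?N")
proof -
  let ?A = "\<integral>x. (norm (g x))\<^sup>2 \<partial>lborel"
  have "(\<integral>x. Z / norm x * (\<psi> x)\<^sup>2 \<partial>lborel) = Z * ?B"
    by (subst integral_mult_right_zero[symmetric]) (simp add: mult_ac)
  then have A: "3 * ?A \<le> Z * ?B"
    using hartree_minimizer_virial[OF H min] by simp
  have "?A / (Z / 3) \<le> ?B" using A Z by (simp add: field_simps)
  moreover have "?B \<le> (Z / 3 * ?N + ?A / (Z / 3)) / 2"
    using H1_coulomb(1)[OF H, of "Z / 3" 0] Z by simp
  moreover have "b \<le> n" if "q \<le> b" "b \<le> (n + q) / 2" for b n q :: real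
    using that by (simp add: field_simps)
  ultimately show ?thesis by blast
qed

section \<open>The one-sided first variation of the energy\<close>

text \<open>The potential of \<open>\<psi>\<close> squared is bounded, because
  \<open>H1_coulomb\<close> is uniform in the centre; multiplying it by the integrable
  \<open>\<psi>\<close> squared gives Fubini's hypothesis.\<close>

lemma coulomb_kernel_integrable:
  assumes H: "H1_with_grad \<psi> g"
  shows "integrable (lborel \<Otimes>\<^sub>M lborel) (\<lambda>(x, y). (\<psi> x)\<^sup>2 * (\<psi> y)\<^sup>2 / norm (x - y))"
proof (rule lborel_pair.Fubini_integrable)
  note sq = H1_sq_integrable[OF H]
  have m[measurable]: "\<psi> \<in> borel_measurable borel" using sq by (auto simp: sq_integrable_def)
  show "(\<lambda>(x, y). (\<psi> x)\<^sup>2 * (\<psi> y)\<^sup>2 / norm (x - y)) \<in> borel_measurable (lborel \<Otimes>\<^sub>M lborel)"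
    by measurable
  have int: "integrable lborel (\<lambda>y. (\<psi> y)\<^sup>2 / norm (x - y))" for x
    using H1_coulomb(2)[OF H, of 1 x] by (simp add: norm_minus_commute)
  have eq: "(\<psi> x)\<^sup>2 * (\<psi> y)\<^sup>2 / norm (x - y) = (\<psi> x)\<^sup>2 * ((\<psi> y)\<^sup>2 / norm (x - y))" for x y by simp
  show "AE x in lborel. integrable lborel (\<lambda>y. case (x, y) of (x, y) \<Rightarrow> (\<psi> x)\<^sup>2 * (\<psi> y)\<^sup>2 / norm (x - y))"
    unfolding prod.case eq by (intro AE_I2 integrable_mult_right int)
  let ?c = "(1 * (\<integral>x. (\<psi> x)\<^sup>2 \<partial>lborel) + (\<integral>x. (norm (g x))\<^sup>2 \<partial>lborel) / 1) / 2"
  have c: "(\<integral>y. (\<psi> y)\<^sup>2 / norm (x - y) \<partial>lborel) \<le> ?c" for x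
    using H1_coulomb(1)[OF H, of 1 x] by (simp add: norm_minus_commute)
  have "integrable lborel (\<lambda>x. \<integral>y. (\<psi> x)\<^sup>2 * ((\<psi> y)\<^sup>2 / norm (x - y)) \<partial>lborel)"
  proof (rule Bochner_Integration.integrable_bound)
    show "integrable lborel (\<lambda>x. (\<psi> x)\<^sup>2 * ?c)" using sq(1) by (intro integrable_mult_left) (simp add: sq_integrable_def)
    show "AE x in lborel. norm (\<integral>y. (\<psi> x)\<^sup>2 * ((\<psi> y)\<^sup>2 / norm (x - y)) \<partial>lborel) \<le> norm ((\<psi> x)\<^sup>2 * ?c)"
    proof (rule AE_I2)
      fix x
      have "0 \<le> (\<integral>y. (\<psi> y)\<^sup>2 / norm (x - y) \<partial>lborel)" by (intro integral_nonneg_AE) simp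
      then show "norm (\<integral>y. (\<psi> x)\<^sup>2 * ((\<psi> y)\<^sup>2 / norm (x - y)) \<partial>lborel) \<le> norm ((\<psi> x)\<^sup>2 * ?c)"
        using c[of x] unfolding integral_mult_right_zero norm_mult real_norm_def abs_mult
        by (intro mult_left_mono) auto
    qed
  qed measurable
  then show "integrable lborel (\<lambda>x. \<integral>y. norm (case (x, y) of (x, y) \<Rightarrow> (\<psi> x)\<^sup>2 * (\<psi> y)\<^sup>2 / norm (x - y)) \<partial>lborel)"
    by simp
qed

lemma integrable_bounded_mult:
  fixes k w :: "'a \<Rightarrow> real"
  assumes "integrable M k" "w \<in> borel_measurable M" "\<And>x. \<bar>w x\<bar> \<le> C"
  shows "integrable M (\<lambda>x. w x * k x)"
proof (rule Bochner_Integration.integrable_bound)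
  show "integrable M (\<lambda>x. C * k x)" using assms(1) by simp
  have "\<bar>w x\<bar> * \<bar>k x\<bar> \<le> \<bar>C\<bar> * \<bar>k x\<bar>" for x
    using assms(3)[of x] by (intro mult_right_mono) auto
  then show "AE x in M. norm (w x * k x) \<le> norm (C * k x)"
    by (auto simp: abs_mult)
  show "(\<lambda>x. w x * k x) \<in> borel_measurable M"
    using assms(1,2) borel_measurable_integrable by (intro borel_measurable_times) auto
qed

text \<open>Controls the repulsion of (1 - t f) \<open>\<psi>\<close> up to second order in t. In
  the exact expansion the cubic terms have a favourable sign and are dropped. The constant collects
  4 C^2 from (p + q)^2, 2 C^2 from 2 p q, and C^4 from (p q)^2, where t^4 <= t^2.\<close>

lemma square_product_expansion_bound:
  fixes p q :: real
  assumes "0 \<le> p" "p \<le> t * C" "0 \<le> q" "q \<le> t * C" "0 \<le> t" "t \<le> 1"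
  shows "(1 - p)\<^sup>2 * (1 - q)\<^sup>2 \<le> 1 - 2 * (p + q) + t\<^sup>2 * (6 * C\<^sup>2 + C ^ 4)"
proof -
  have tC: "0 \<le> t * C" using assms by linarith
  have 1: "p * q \<le> (t * C)\<^sup>2" unfolding power2_eq_square using assms tC by (intro mult_mono) auto
  have 2: "(p + q)\<^sup>2 \<le> (2 * (t * C))\<^sup>2" using assms by (intro power_mono) auto
  have "(p * q)\<^sup>2 \<le> ((t * C)\<^sup>2)\<^sup>2" using 1 assms by (intro power_mono) auto
  also have "\<dots> = t\<^sup>2 * (t\<^sup>2 * C ^ 4)" by (simp add: power_mult_distrib power_mult[symmetric] power_add[symmetric])
  also have "\<dots> \<le> t\<^sup>2 * (1 * C ^ 4)" using assms
    by (intro mult_left_mono mult_right_mono power_le_one) auto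
  finally have 3: "(p * q)\<^sup>2 \<le> t\<^sup>2 * C ^ 4" by simp
  have 4: "0 \<le> p * q * (p + q)" using assms by simp
  have "(1 - p)\<^sup>2 * (1 - q)\<^sup>2 = 1 - 2 * (p + q) + ((p + q)\<^sup>2 + 2 * (p * q) + (p * q)\<^sup>2) - 2 * (p * q * (p + q))"
    by (simp add: power2_eq_square algebra_simps)
  also have "\<dots> \<le> 1 - 2 * (p + q) + t\<^sup>2 * (6 * C\<^sup>2 + C ^ 4)"
    using 1 2 3 4 by (simp add: power_mult_distrib algebra_simps)
  finally show ?thesis .
qed

text \<open>The integrand of \<open>?I\<close> is the inner product of the gradients of
  \<open>\<psi>\<close> and \<open>f\<close> \<open>\<psi>\<close>, so this is one side of the weak
  Hartree equation tested with \<open>f\<close> \<open>\<psi>\<close>. It comes from comparison with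
  (1 - t f) \<open>\<psi>\<close> for small t > 0.\<close>

lemma hartree_minimizer_variation:
  assumes H: "H1_with_grad \<psi> g"
    and min: "\<And>\<phi> h. H1_with_grad \<phi> h \<Longrightarrow> hartree_energy Z \<psi> g \<le> hartree_energy Z \<phi> h"
    and f: "\<And>x. (f has_derivative (\<lambda>v. F x \<bullet> v)) (at x)" "continuous_on UNIV F"
    and b: "\<And>x. 0 \<le> f x" "\<And>x. f x \<le> C" "\<And>x. norm (F x) \<le> C"
  shows "(\<integral>x. f x * (norm (g x))\<^sup>2 + \<psi> x * (g x \<bullet> F x) \<partial>lborel)
      + (\<integral>p. f (fst p) * ((\<psi> (fst p))\<^sup>2 * (\<psi> (snd p))\<^sup>2 / norm (fst p - snd p)) \<partial>(lborel \<Otimes>\<^sub>M lborel))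
      \<le> (\<integral>x. Z / norm x * (f x * (\<psi> x)\<^sup>2) \<partial>lborel)" (is "?I + ?X \<le> ?P")
    and "integrable lborel (\<lambda>x. f x * (norm (g x))\<^sup>2 + \<psi> x * (g x \<bullet> F x))"
proof -
  note sq = H1_sq_integrable[OF H]
  have [measurable]: "\<psi> \<in> borel_measurable borel" "g \<in> borel_measurable borel"
    using sq by (auto simp: sq_integrable_def)
  have "continuous_on UNIV f"
    using f(1) by (blast intro: continuous_at_imp_continuous_on has_derivative_continuous)
  then have fm[measurable]: "f \<in> borel_measurable borel" by (rule borel_measurable_continuous_onI)
  have Fm[measurable]: "F \<in> borel_measurable borel" using f(2) by (rule borel_measurable_continuous_onI)
  have fb: "\<bar>f x\<bar> \<le> C" for x using b(1,2)[of x] by simp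
  have C: "C \<ge> 0" using fb[of 0] by linarith
  have i1: "integrable lborel (\<lambda>x. (norm (g x))\<^sup>2)" using sq(2) by (simp add: sq_integrable_def)
  show iI: "integrable lborel (\<lambda>x. f x * (norm (g x))\<^sup>2 + \<psi> x * (g x \<bullet> F x))"
  proof (intro Bochner_Integration.integrable_add)
    show "integrable lborel (\<lambda>x. f x * (norm (g x))\<^sup>2)"
      using i1 fb by (intro integrable_bounded_mult) auto
    show "integrable lborel (\<lambda>x. \<psi> x * (g x \<bullet> F x))"
    proof (rule Bochner_Integration.integrable_bound)
      show "integrable lborel (\<lambda>x. C * (\<psi> x * norm (g x)))"
        using sq_integrable_mult_integrable[OF sq(1,2)] by simp
      have "\<bar>g x \<bullet> F x\<bar> \<le> C * norm (g x)" for x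
        using Cauchy_Schwarz_ineq2[of "g x" "F x"] mult_left_mono[OF b(3)[of x], of "norm (g x)"]
        by (simp add: mult.commute)
      from mult_left_mono[OF this abs_ge_zero]
      show "AE x in lborel. norm (\<psi> x * (g x \<bullet> F x)) \<le> norm (C * (\<psi> x * norm (g x)))"
        using C by (simp add: abs_mult mult_ac)
    qed measurable
  qed
  have iQ: "integrable lborel (\<lambda>x. (norm (f x *\<^sub>R g x + \<psi> x *\<^sub>R F x))\<^sup>2)"
    using H1_mult[OF H f fb b(3)] by (simp add: H1_with_grad_def)
  define Q where "Q = (\<integral>x. (norm (f x *\<^sub>R g x + \<psi> x *\<^sub>R F x))\<^sup>2 \<partial>lborel)"
  have iZ: "integrable lborel (\<lambda>x. Z / norm x * (\<psi> x)\<^sup>2)"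
    using integrable_mult_right[OF H1_coulomb(2)[OF H, of 1 0], of Z] by simp
  have iP: "integrable lborel (\<lambda>x. Z / norm x * (f x * (\<psi> x)\<^sup>2))"
    using integrable_bounded_mult[OF iZ _ fb] by (simp add: mult_ac)
  have "\<bar>(f x)\<^sup>2\<bar> \<le> C\<^sup>2" for x using power_mono[OF fb abs_ge_zero, of x 2] by simp
  from integrable_bounded_mult[OF iZ _ this]
  have iP2: "integrable lborel (\<lambda>x. Z / norm x * ((f x)\<^sup>2 * (\<psi> x)\<^sup>2))" by (simp add: mult_ac)
  define P2 where "P2 = (\<integral>x. Z / norm x * ((f x)\<^sup>2 * (\<psi> x)\<^sup>2) \<partial>lborel)"
  define k where "k p = (\<psi> (fst p))\<^sup>2 * (\<psi> (snd p))\<^sup>2 / norm (fst p - snd p)" for p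
  have ik: "integrable (lborel \<Otimes>\<^sub>M lborel) k"
    using coulomb_kernel_integrable[OF H] by (simp add: k_def[abs_def] split_def)
  have k0: "k p \<ge> 0" for p by (simp add: k_def)
  have ifk: "integrable (lborel \<Otimes>\<^sub>M lborel) (\<lambda>p. f (fst p) * k p)" "integrable (lborel \<Otimes>\<^sub>M lborel) (\<lambda>p. f (snd p) * k p)"
    using ik fb by (auto intro!: integrable_bounded_mult)
  \<comment> \<open>Symmetry of the kernel merges the contributions of the two variables into 4 t
    \<open>?X\<close>, which the factor 1/2 in the energy reduces to 2 t \<open>?X\<close>, on a par
    with the other terms.\<close>
  have sym: "(\<integral>p. f (snd p) * k p \<partial>(lborel \<Otimes>\<^sub>M lborel)) = ?X"
    using lborel_pair.integral_product_swap[of "\<lambda>p. f (fst p) * k p"] ifk(1)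
    by (simp add: k_def split_def norm_minus_commute mult.commute borel_measurable_integrable)
  define c where "c = 6 * C\<^sup>2 + C ^ 4"
  define K where "K = (\<integral>p. k p \<partial>(lborel \<Otimes>\<^sub>M lborel))"
  \<comment> \<open>The bracket on the right bounds the second-order part of the energy,
    independently of t. After division by t it still carries a factor t and vanishes as t tends to 0
    from above.\<close>
  have main: "2 * (?I + ?X - ?P) \<le> t * (Q - P2 + c * K / 2)" if t: "0 < t" "t \<le> 1" for t
  proof -
    define f' where "f' x = 1 - t * f x" for x
    define F' where "F' x = - (t *\<^sub>R F x)" for x
    have "(f' has_derivative (\<lambda>v. F' x \<bullet> v)) (at x)" for x
      unfolding f'_def[abs_def] F'_def by (rule derivative_eq_intros f(1) refl | simp)+
    moreover have "continuous_on UNIV F'" unfolding F'_def by (intro continuous_intros f(2))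
    moreover have "\<bar>f' x\<bar> \<le> 1 + C" for x
      using mult_nonneg_nonneg[OF less_imp_le[OF t(1)] b(1)[of x]] mult_mono[OF t(2) b(2)[of x]] b(1)[of x] C
      by (simp add: f'_def abs_le_iff)
    moreover have "norm (F' x) \<le> 1 + C" for x
      using mult_mono[OF t(2) b(3)[of x]] t C by (simp add: F'_def)
    ultimately have H': "H1_with_grad (\<lambda>x. f' x * \<psi> x) (\<lambda>x. f' x *\<^sub>R g x + \<psi> x *\<^sub>R F' x)"
      by (rule H1_mult[OF H])
    have nrm: "(norm (f' x *\<^sub>R g x + \<psi> x *\<^sub>R F' x))\<^sup>2 = (norm (g x))\<^sup>2
        - 2 * t * (f x * (norm (g x))\<^sup>2 + \<psi> x * (g x \<bullet> F x)) + t\<^sup>2 * (norm (f x *\<^sub>R g x + \<psi> x *\<^sub>R F x))\<^sup>2" for x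
    proof -
      have "f' x *\<^sub>R g x + \<psi> x *\<^sub>R F' x = g x - t *\<^sub>R (f x *\<^sub>R g x + \<psi> x *\<^sub>R F x)"
        by (simp add: f'_def F'_def algebra_simps)
      moreover have "(norm (u - t *\<^sub>R w))\<^sup>2 = (norm u)\<^sup>2 - 2 * t * (u \<bullet> w) + t\<^sup>2 * (norm w)\<^sup>2" for u w :: R3
        unfolding power2_norm_eq_inner by (simp add: inner_diff inner_commute power2_eq_square algebra_simps)
      moreover have "g x \<bullet> (f x *\<^sub>R g x + \<psi> x *\<^sub>R F x) = f x * (norm (g x))\<^sup>2 + \<psi> x * (g x \<bullet> F x)"
        by (simp add: inner_add_right power2_norm_eq_inner)
      ultimately show ?thesis by simp
    qed
    have A: "(\<integral>x. (norm (f' x *\<^sub>R g x + \<psi> x *\<^sub>R F' x))\<^sup>2 \<partial>lborel) = (\<integral>x. (norm (g x))\<^sup>2 \<partial>lborel) - 2 * t * ?I + t\<^sup>2 * Q"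
      unfolding nrm Q_def using i1 iI iQ by simp
    have pot: "Z / norm x * (f' x * \<psi> x)\<^sup>2 = Z / norm x * (\<psi> x)\<^sup>2 - 2 * t * (Z / norm x * (f x * (\<psi> x)\<^sup>2))
        + t\<^sup>2 * (Z / norm x * ((f x)\<^sup>2 * (\<psi> x)\<^sup>2))" for x
    proof -
      have "(f' x * \<psi> x)\<^sup>2 = (\<psi> x)\<^sup>2 - 2 * t * (f x * (\<psi> x)\<^sup>2) + t\<^sup>2 * ((f x)\<^sup>2 * (\<psi> x)\<^sup>2)"
        by (simp add: f'_def power2_eq_square algebra_simps)
      then show ?thesis by (simp only: distrib_left right_diff_distrib mult_ac)
    qed
    have B: "(\<integral>x. Z / norm x * (f' x * \<psi> x)\<^sup>2 \<partial>lborel) = (\<integral>x. Z / norm x * (\<psi> x)\<^sup>2 \<partial>lborel) - 2 * t * ?P + t\<^sup>2 * P2"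
      unfolding pot P2_def using iZ iP iP2
      by (simp del: times_divide_eq_left times_divide_eq_right)
    have D0: "(\<integral>x. (\<integral>y. (\<psi> x)\<^sup>2 * (\<psi> y)\<^sup>2 / norm (x - y) \<partial>lborel) \<partial>lborel) = K"
      using lborel_pair.integral_fst[OF coulomb_kernel_integrable[OF H]] by (simp add: K_def k_def split_def)
    have k': "(f' x * \<psi> x)\<^sup>2 * (f' y * \<psi> y)\<^sup>2 / norm (x - y) = (f' x)\<^sup>2 * (f' y)\<^sup>2 * k (x, y)" for x y
      by (simp add: k_def power_mult_distrib mult_ac)
    have ik': "integrable (lborel \<Otimes>\<^sub>M lborel) (\<lambda>p. (f' (fst p))\<^sup>2 * (f' (snd p))\<^sup>2 * k p)"
      using coulomb_kernel_integrable[OF H'] unfolding k' by (simp add: split_def)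
    have "(\<integral>x. (\<integral>y. (f' x * \<psi> x)\<^sup>2 * (f' y * \<psi> y)\<^sup>2 / norm (x - y) \<partial>lborel) \<partial>lborel)
        = (\<integral>p. (f' (fst p))\<^sup>2 * (f' (snd p))\<^sup>2 * k p \<partial>(lborel \<Otimes>\<^sub>M lborel))"
      using lborel_pair.integral_fst[OF coulomb_kernel_integrable[OF H']] unfolding k' by (simp add: split_def)
    also have "\<dots> \<le> (\<integral>p. k p - 2 * t * (f (fst p) * k p) - 2 * t * (f (snd p) * k p) + t\<^sup>2 * c * k p \<partial>(lborel \<Otimes>\<^sub>M lborel))"
    proof (rule integral_mono[OF ik'])
      show "integrable (lborel \<Otimes>\<^sub>M lborel) (\<lambda>p. k p - 2 * t * (f (fst p) * k p) - 2 * t * (f (snd p) * k p) + t\<^sup>2 * c * k p)"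
        using ik ifk by simp
      fix p
      have "(f' (fst p))\<^sup>2 * (f' (snd p))\<^sup>2 \<le> 1 - 2 * (t * f (fst p) + t * f (snd p)) + t\<^sup>2 * c"
        unfolding f'_def c_def using t b by (intro square_product_expansion_bound) auto
      from mult_right_mono[OF this k0[of p]]
      show "(f' (fst p))\<^sup>2 * (f' (snd p))\<^sup>2 * k p \<le> k p - 2 * t * (f (fst p) * k p) - 2 * t * (f (snd p) * k p) + t\<^sup>2 * c * k p"
        by (simp add: algebra_simps)
    qed
    also have "\<dots> = K - 4 * t * ?X + t\<^sup>2 * c * K"
      using ik ifk sym unfolding k_def[symmetric] by (simp add: K_def)
    finally have D: "(\<integral>x. (\<integral>y. (f' x * \<psi> x)\<^sup>2 * (f' y * \<psi> y)\<^sup>2 / norm (x - y) \<partial>lborel) \<partial>lborel)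
      \<le> K - 4 * t * ?X + t\<^sup>2 * c * K" .
    have "0 \<le> - 2 * t * ?I + t\<^sup>2 * Q + 2 * t * ?P - t\<^sup>2 * P2 - 2 * t * ?X + t\<^sup>2 * c * K / 2"
      using min[OF H'] D unfolding hartree_energy_def A B D0 by simp
    then have "t * (2 * (?I + ?X - ?P)) \<le> t * (t * (Q - P2 + c * K / 2))"
      by (simp add: algebra_simps power2_eq_square)
    then show ?thesis using t(1) by (simp only: mult_le_cancel_left_pos)
  qed
  have "((\<lambda>t. t * (Q - P2 + c * K / 2)) \<longlongrightarrow> 0 * (Q - P2 + c * K / 2)) (at_right 0)"
    by (intro tendsto_intros)
  moreover have "eventually (\<lambda>t. 2 * (?I + ?X - ?P) \<le> t * (Q - P2 + c * K / 2)) (at_right 0)"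
    using main by (intro eventually_at_rightI[of 0 1]) auto
  ultimately have "2 * (?I + ?X - ?P) \<le> 0 * (Q - P2 + c * K / 2)"
    by (intro tendsto_lowerbound) auto
  then show "?I + ?X \<le> ?P" by simp
qed

subsection \<open>The weighted Hardy inequality\<close>

text \<open>With t = |x|^2 these bound the truncated weight, the field x / (1 + e |x|^2), and the
  derivative of that field. The square-root bound follows from the square of
  \<open>sqrt e * sqrt t - 1\<close> being nonnegative.\<close>

lemma regularized_multiplier_bounds:
  fixes e t :: real
  assumes e: "e > 0" and t: "t \<ge> 0"
  shows "t / (1 + e * t) \<le> 1 / e" "sqrt t / (1 + e * t) \<le> 1 / sqrt e"
    "e * t / (1 + e * t)\<^sup>2 \<le> 1" "0 < 1 + e * t"
proof -
  show p: "0 < 1 + e * t" using assms by (simp add: add_pos_nonneg)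
  show "t / (1 + e * t) \<le> 1 / e" using assms p by (simp add: field_simps)
  have "0 \<le> (sqrt e * sqrt t - 1)\<^sup>2" by simp
  then have "2 * (sqrt e * sqrt t) \<le> 1 + e * t"
    using assms by (simp add: power2_diff power_mult_distrib)
  moreover have "0 \<le> sqrt e * sqrt t" using assms by simp
  ultimately have "sqrt e * sqrt t \<le> 1 + e * t" by linarith
  then show "sqrt t / (1 + e * t) \<le> 1 / sqrt e" using p e by (simp add: field_simps)
  show "e * t / (1 + e * t)\<^sup>2 \<le> 1"
  proof -
    have "0 \<le> e * t" using assms by simp
    then have "e * t \<le> (1 + e * t)\<^sup>2" by (simp add: power2_sum)
    then show ?thesis using p by (simp add: divide_le_eq)
  qed
qed

text \<open>With \<open>p = 1 + \<epsilon> |x|\<^sup>2\<close> and \<open>G x = - x / p\<close>, the square \<open>|\<nabla>\<psi> + V \<psi>|\<^sup>2 \<ge> 0\<close> for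
  \<open>V = (\<nabla>f - G) / (2 f)\<close> bounds the integrand below up to the divergence of \<open>\<psi>\<^sup>2 G\<close>; what remains is
  \<open>1 / p\<^sup>3 - 1 / (4 p) \<le> 3 / 4\<close>. For \<open>\<epsilon> = 0\<close> this is Hardy's inequality for \<open>|x| \<psi>\<close>.\<close>

lemma weighted_hardy_pointwise:
  fixes x v :: R3 and s e :: real
  assumes e: "e > 0"
  defines "p \<equiv> 1 + e * (norm x)\<^sup>2"
  shows "(norm x)\<^sup>2 / p * (norm v)\<^sup>2 + s * (v \<bullet> ((2 / p\<^sup>2) *\<^sub>R x))
    \<ge> s * (- 1 / p) * (v \<bullet> x) + 1/2 * (s\<^sup>2 * (3 * (- 1 / p) + 2 * (e / p\<^sup>2) * (norm x)\<^sup>2)) - 3/4 * s\<^sup>2"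
proof -
  have p: "p \<ge> 1" using e by (simp add: p_def)
  \<comment> \<open>\<open>m\<close> x is the gradient of the weight minus the field, that is 2 /
    p^2 + 1 / p times x.\<close>
  define m where "m = 2 / p\<^sup>2 + 1 / p"
  define q where "q = 1 / p"
  have q: "0 < q" "q \<le> 1" using p by (auto simp: q_def)
  have m: "m \<ge> 0" using p by (simp add: m_def)
  \<comment> \<open>The square of the comment above, already multiplied by the weight |x|^2 / p, so
    that nothing is divided by |x|; replacing \<open>v \<bullet> x\<close> by norms is harmless by
    Cauchy-Schwarz.\<close>
  have "0 \<le> (1 / p) * (norm v * norm x - \<bar>s\<bar> * m * p / 2)\<^sup>2" using p by simp
  also have "\<dots> = (norm x)\<^sup>2 / p * (norm v)\<^sup>2 - \<bar>s\<bar> * m * (norm v * norm x) + s\<^sup>2 * (p * m\<^sup>2 / 4)"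
    using p by (simp add: power2_diff power_mult_distrib field_simps power2_eq_square)
  also have "\<dots> \<le> (norm x)\<^sup>2 / p * (norm v)\<^sup>2 + s * m * (v \<bullet> x) + s\<^sup>2 * (p * m\<^sup>2 / 4)"
  proof -
    have "\<bar>s * m * (v \<bullet> x)\<bar> \<le> \<bar>s\<bar> * m * (norm v * norm x)"
      unfolding abs_mult using m by (intro mult_mono Cauchy_Schwarz_ineq2) auto
    then show ?thesis by linarith
  qed
  finally have 1: "0 \<le> (norm x)\<^sup>2 / p * (norm v)\<^sup>2 + s * m * (v \<bullet> x) + s\<^sup>2 * (p * m\<^sup>2 / 4)" .
  have er: "e * (norm x)\<^sup>2 = p - 1" by (simp add: p_def)
  have "p * m\<^sup>2 / 4 + 1/2 * (3 * (- 1 / p) + 2 * (e / p\<^sup>2) * (norm x)\<^sup>2) = q ^ 3 - q / 4"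
  proof -
    have "2 * (e / p\<^sup>2) * (norm x)\<^sup>2 = 2 * (p - 1) / p\<^sup>2" using er by simp
    also have "\<dots> = 2 * q - 2 * q\<^sup>2" using p by (simp add: q_def field_simps power2_eq_square)
    finally have a: "2 * (e / p\<^sup>2) * (norm x)\<^sup>2 = 2 * q - 2 * q\<^sup>2" .
    have "m = 2 * q\<^sup>2 + q" by (simp add: m_def q_def power_divide)
    then have "p * m\<^sup>2 = (p * q) * q * (2 * q + 1)\<^sup>2"
      by (simp add: power2_eq_square algebra_simps)
    also have "\<dots> = q * (2 * q + 1)\<^sup>2" using p by (simp add: q_def)
    finally have b: "p * m\<^sup>2 = q * (2 * q + 1)\<^sup>2" .
    have c: "- 1 / p = - q" by (simp add: q_def)
    show ?thesis unfolding a b c by (simp add: power2_eq_square power3_eq_cube algebra_simps)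
  qed
  also have "\<dots> \<le> 3 / 4"
  proof -
    have "q ^ 3 \<le> q ^ 1" using q by (intro power_decreasing) auto
    then show ?thesis using q by simp
  qed
  finally have "s\<^sup>2 * (p * m\<^sup>2 / 4 + 1/2 * (3 * (- 1 / p) + 2 * (e / p\<^sup>2) * (norm x)\<^sup>2)) \<le> s\<^sup>2 * (3 / 4)"
    by (intro mult_left_mono) auto
  then have 2: "s\<^sup>2 * (p * m\<^sup>2 / 4) + 1/2 * (s\<^sup>2 * (3 * (- 1 / p) + 2 * (e / p\<^sup>2) * (norm x)\<^sup>2)) \<le> 3/4 * s\<^sup>2"
    by (simp only: distrib_left mult_ac)
  have 3: "s * m * (v \<bullet> x) = s * (v \<bullet> ((2 / p\<^sup>2) *\<^sub>R x)) - s * (- 1 / p) * (v \<bullet> x)"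
    by (simp add: m_def algebra_simps)
  show ?thesis using 1 2 unfolding 3 by linarith
qed

text \<open>The integral is that of grad \<open>\<psi>\<close> . grad (f \<open>\<psi>\<close>) for
  f = |x|^2 / (1 + e |x|^2). The pointwise inequality is integrated, and its field terms cancel by
  \<open>H1_radial_divergence\<close> with profile -1 / (1 + e t).\<close>

lemma weighted_hardy:
  assumes H: "H1_with_grad \<psi> g" and e: "e > 0"
    and int: "integrable lborel (\<lambda>x. (norm x)\<^sup>2 / (1 + e * (norm x)\<^sup>2) * (norm (g x))\<^sup>2
      + \<psi> x * (g x \<bullet> ((2 / (1 + e * (norm x)\<^sup>2)\<^sup>2) *\<^sub>R x)))"
  shows "(\<integral>x. (norm x)\<^sup>2 / (1 + e * (norm x)\<^sup>2) * (norm (g x))\<^sup>2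
      + \<psi> x * (g x \<bullet> ((2 / (1 + e * (norm x)\<^sup>2)\<^sup>2) *\<^sub>R x)) \<partial>lborel) \<ge> - 3/4 * (\<integral>x. (\<psi> x)\<^sup>2 \<partial>lborel)"
proof -
  note sq = H1_sq_integrable[OF H]
  have iN: "integrable lborel (\<lambda>x. (\<psi> x)\<^sup>2)" using sq(1) by (simp add: sq_integrable_def)
  define \<phi> where "\<phi> t = - 1 / (1 + e * t)" for t
  define \<phi>' where "\<phi>' t = e / (1 + e * t)\<^sup>2" for t
  note rb = regularized_multiplier_bounds[OF e]
  have der: "(\<phi> has_real_derivative \<phi>' t) (at t)" if "t \<ge> 0" for t
    unfolding \<phi>_def[abs_def] \<phi>'_def using rb(4)[OF that]
    by (auto intro!: derivative_eq_intros simp: power2_eq_square)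
  have cont: "continuous_on {0..} \<phi>'"
    unfolding \<phi>'_def using rb(4) by (intro continuous_intros) (auto simp: less_imp_neq[symmetric])
  have se: "1 / sqrt e \<ge> 0" using e by simp
  have b: "\<bar>\<phi> t\<bar> \<le> 1 + 1 / sqrt e" "\<bar>\<phi> t\<bar> * sqrt t \<le> 1 + 1 / sqrt e" "\<bar>\<phi>' t\<bar> * t \<le> 1 + 1 / sqrt e"
    if "t \<ge> 0" for t
  proof -
    have "\<bar>\<phi> t\<bar> \<le> 1" using rb(4)[OF that] that e by (simp add: \<phi>_def abs_of_pos)
    then show "\<bar>\<phi> t\<bar> \<le> 1 + 1 / sqrt e" using se by linarith
    have "\<bar>\<phi> t\<bar> * sqrt t = sqrt t / (1 + e * t)" using rb(4)[OF that] by (simp add: \<phi>_def abs_of_pos)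
    then show "\<bar>\<phi> t\<bar> * sqrt t \<le> 1 + 1 / sqrt e" using rb(2)[OF that] by linarith
    have "\<bar>\<phi>' t\<bar> * t = e * t / (1 + e * t)\<^sup>2" using rb(4)[OF that] e by (simp add: \<phi>'_def)
    then show "\<bar>\<phi>' t\<bar> * t \<le> 1 + 1 / sqrt e" using rb(3)[OF that] se by linarith
  qed
  note div = H1_radial_divergence[OF H der cont b, of 0, simplified]
  have "- 3/4 * (\<integral>x. (\<psi> x)\<^sup>2 \<partial>lborel) = (\<integral>x. \<psi> x * \<phi> ((norm x)\<^sup>2) * (g x \<bullet> x)
      + 1/2 * ((\<psi> x)\<^sup>2 * (3 * \<phi> ((norm x)\<^sup>2) + 2 * \<phi>' ((norm x)\<^sup>2) * (norm x)\<^sup>2)) - 3/4 * (\<psi> x)\<^sup>2 \<partial>lborel)"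
    using div iN by simp
  also have "\<dots> \<le> (\<integral>x. (norm x)\<^sup>2 / (1 + e * (norm x)\<^sup>2) * (norm (g x))\<^sup>2
      + \<psi> x * (g x \<bullet> ((2 / (1 + e * (norm x)\<^sup>2)\<^sup>2) *\<^sub>R x)) \<partial>lborel)"
  proof (rule integral_mono[OF _ int])
    show "integrable lborel (\<lambda>x. \<psi> x * \<phi> ((norm x)\<^sup>2) * (g x \<bullet> x)
      + 1/2 * ((\<psi> x)\<^sup>2 * (3 * \<phi> ((norm x)\<^sup>2) + 2 * \<phi>' ((norm x)\<^sup>2) * (norm x)\<^sup>2)) - 3/4 * (\<psi> x)\<^sup>2)"
      using div iN by (intro Bochner_Integration.integrable_diff Bochner_Integration.integrable_add integrable_mult_right) auto
    show "\<psi> x * \<phi> ((norm x)\<^sup>2) * (g x \<bullet> x)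
      + 1/2 * ((\<psi> x)\<^sup>2 * (3 * \<phi> ((norm x)\<^sup>2) + 2 * \<phi>' ((norm x)\<^sup>2) * (norm x)\<^sup>2)) - 3/4 * (\<psi> x)\<^sup>2
      \<le> (norm x)\<^sup>2 / (1 + e * (norm x)\<^sup>2) * (norm (g x))\<^sup>2
      + \<psi> x * (g x \<bullet> ((2 / (1 + e * (norm x)\<^sup>2)\<^sup>2) *\<^sub>R x))" for x
      unfolding \<phi>_def \<phi>'_def by (rule weighted_hardy_pointwise[OF e])
  qed
  finally show ?thesis .
qed

text \<open>The variation is taken with the truncated weight: its kinetic part is bounded below by
  \<open>weighted_hardy\<close>, and in the attraction one power of |x| cancels against the Coulomb
  singularity.\<close>

lemma hartree_minimizer_interaction_bound:
  assumes H: "H1_with_grad \<psi> g"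
    and min: "\<And>\<phi> h. H1_with_grad \<phi> h \<Longrightarrow> hartree_energy Z \<psi> g \<le> hartree_energy Z \<phi> h"
    and e: "e > 0"
  shows "(\<integral>p. (norm (fst p))\<^sup>2 / (1 + e * (norm (fst p))\<^sup>2)
        * ((\<psi> (fst p))\<^sup>2 * (\<psi> (snd p))\<^sup>2 / norm (fst p - snd p)) \<partial>(lborel \<Otimes>\<^sub>M lborel))
      \<le> Z * (\<integral>x. norm x * ((\<psi> x)\<^sup>2 / (1 + e * (norm x)\<^sup>2)) \<partial>lborel) + 3/4 * (\<integral>x. (\<psi> x)\<^sup>2 \<partial>lborel)"
proof -
  note rb = regularized_multiplier_bounds[OF e]
  define f where "f x = (norm x)\<^sup>2 / (1 + e * (norm x)\<^sup>2)" for x :: R3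
  define F where "F x = (2 / (1 + e * (norm x)\<^sup>2)\<^sup>2) *\<^sub>R x" for x :: R3
  have pos: "0 < 1 + e * (norm x)\<^sup>2" for x :: R3 by (rule rb(4)) simp
  have der: "(f has_derivative (\<lambda>v. F x \<bullet> v)) (at x)" for x
  proof -
    have "((\<lambda>t. t / (1 + e * t)) has_real_derivative 1 / (1 + e * (norm (x - 0))\<^sup>2)\<^sup>2) (at ((norm (x - 0))\<^sup>2))"
      using pos[of x] by (auto intro!: derivative_eq_intros simp: power2_eq_square)
    from has_derivative_radial[where \<phi> = "\<lambda>t. t / (1 + e * t)" and \<phi>' = "\<lambda>t. 1 / (1 + e * t)\<^sup>2", OF this] show ?thesis
      by (simp add: f_def[abs_def] F_def mult.assoc)
  qed
  have cont: "continuous_on UNIV F"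
    unfolding F_def using pos by (intro continuous_intros) (auto simp: less_imp_neq[symmetric])
  have se: "1 / sqrt e \<ge> 0" "1 / e \<ge> 0" using e by simp_all
  have f0: "0 \<le> f x" for x using pos[of x] by (simp add: f_def)
  have f1: "f x \<le> 1 / e + 2 * (1 / sqrt e)" for x
    using rb(1)[OF zero_le_power2[of "norm x"]] se unfolding f_def by linarith
  have F1: "norm (F x) \<le> 1 / e + 2 * (1 / sqrt e)" for x
  proof -
    have "norm (F x) = 2 * (norm x / (1 + e * (norm x)\<^sup>2)\<^sup>2)" using pos[of x] by (simp add: F_def)
    also have "norm x / (1 + e * (norm x)\<^sup>2)\<^sup>2 \<le> norm x / (1 + e * (norm x)\<^sup>2)"
      using pos[of x] e by (intro divide_left_mono) (auto simp: power2_eq_square)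
    also have "\<dots> \<le> 1 / sqrt e" using rb(2)[of "(norm x)\<^sup>2"] by simp
    finally show ?thesis using se by linarith
  qed
  note var = hartree_minimizer_variation[OF H min der cont f0 f1 F1]
  have "- 3/4 * (\<integral>x. (\<psi> x)\<^sup>2 \<partial>lborel) \<le> (\<integral>x. f x * (norm (g x))\<^sup>2 + \<psi> x * (g x \<bullet> F x) \<partial>lborel)"
    using weighted_hardy[OF H e] var(2) unfolding f_def F_def by simp
  moreover have "(\<integral>x. Z / norm x * (f x * (\<psi> x)\<^sup>2) \<partial>lborel)
      = Z * (\<integral>x. norm x * ((\<psi> x)\<^sup>2 / (1 + e * (norm x)\<^sup>2)) \<partial>lborel)"
  proof (subst integral_mult_right_zero[symmetric], intro Bochner_Integration.integral_cong refl)
    fix x :: R3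
    have "(norm x)\<^sup>2 / norm x = norm x" by (simp add: power2_eq_square)
    then show "Z / norm x * (f x * (\<psi> x)\<^sup>2) = Z * (norm x * ((\<psi> x)\<^sup>2 / (1 + e * (norm x)\<^sup>2)))"
      by (simp add: f_def power2_eq_square)
  qed
  ultimately show ?thesis using var(1) unfolding f_def by linarith
qed

subsection \<open>The constant beta\<close>

definition beta_trial :: "(R3 \<Rightarrow> real) \<Rightarrow> bool" where
  "beta_trial \<psi> \<longleftrightarrow> \<psi> \<in> borel_measurable lborel \<and> integrable lborel (\<lambda>x. (\<psi> x)\<^sup>2) \<and>
     integrable lborel (\<lambda>x. norm x * (\<psi> x)\<^sup>2) \<and> (\<integral>x. (\<psi> x)\<^sup>2 \<partial>lborel) \<noteq> 0 \<and> beta_num \<psi> < \<infinity>"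

definition beta_quotient :: "(R3 \<Rightarrow> real) \<Rightarrow> real" where
  "beta_quotient \<psi> = (1/2) * enn2real (beta_num \<psi>) /
     ((\<integral>x. norm x * (\<psi> x)\<^sup>2 \<partial>lborel) * (\<integral>x. (\<psi> x)\<^sup>2 \<partial>lborel))"

lemma hartree_beta_eq: "hartree_beta = Inf (beta_quotient ` Collect beta_trial)"
  unfolding hartree_beta_def beta_quotient_def[abs_def] beta_trial_def[abs_def]
  by (rule arg_cong[of _ _ Inf]) blast

text \<open>The triangle inequality bounds the denominator by |x| + |y|, and (a + b)^2 <= 2 (a^2 +
  b^2) does the rest.\<close>

lemma sum_squares_over_norm_diff_ge:
  fixes x y :: "'a::real_normed_vector"
  assumes "x \<noteq> y"
  shows "(norm x + norm y) / 2 \<le> ((norm x)\<^sup>2 + (norm y)\<^sup>2) / norm (x - y)"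
proof -
  have "(norm x + norm y) / 2 * norm (x - y) \<le> (norm x + norm y) / 2 * (norm x + norm y)"
    by (intro mult_left_mono norm_triangle_ineq4) simp
  also have "\<dots> \<le> (norm x)\<^sup>2 + (norm y)\<^sup>2"
    using sum_squares_bound[of "norm x" "norm y"] by (simp add: power2_eq_square algebra_simps)
  finally show ?thesis using assms by (simp add: pos_le_divide_eq)
qed

text \<open>Off the null diagonal the kernel is at least (|x| + |y|) / 2, and each of the two
  summands integrates to half the product of the moments.\<close>

lemma beta_num_ge:
  assumes "beta_trial \<psi>"
  shows "ennreal ((\<integral>x. norm x * (\<psi> x)\<^sup>2 \<partial>lborel) * (\<integral>x. (\<psi> x)\<^sup>2 \<partial>lborel)) \<le> beta_num \<psi>"
proof -
  have [measurable]: "\<psi> \<in> borel_measurable borel" and iN: "integrable lborel (\<lambda>x. (\<psi> x)\<^sup>2)"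
    and iM: "integrable lborel (\<lambda>x. norm x * (\<psi> x)\<^sup>2)"
    using assms by (auto simp: beta_trial_def)
  define N M where "N = (\<integral>x. (\<psi> x)\<^sup>2 \<partial>lborel)" and "M = (\<integral>x. norm x * (\<psi> x)\<^sup>2 \<partial>lborel)"
  have NM: "N \<ge> 0" "M \<ge> 0" by (auto simp: N_def M_def)
  have inner: "ennreal ((\<psi> x)\<^sup>2 / 2 * (norm x * N + M)) \<le>
      (\<integral>\<^sup>+y. ennreal ((\<psi> x)\<^sup>2 * ((norm x)\<^sup>2 + (norm y)\<^sup>2) / norm (x - y) * (\<psi> y)\<^sup>2) \<partial>lborel)" for x
  proof -
    have i: "integrable lborel (\<lambda>y. (\<psi> x)\<^sup>2 / 2 * (norm x * (\<psi> y)\<^sup>2 + norm y * (\<psi> y)\<^sup>2))"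
      using iN iM by (intro integrable_mult_right Bochner_Integration.integrable_add) auto
    have "(\<psi> x)\<^sup>2 / 2 * (norm x * N + M) = (\<integral>y. (\<psi> x)\<^sup>2 / 2 * (norm x * (\<psi> y)\<^sup>2 + norm y * (\<psi> y)\<^sup>2) \<partial>lborel)"
      unfolding integral_mult_right_zero using iN iM by (simp add: N_def M_def)
    then have "ennreal ((\<psi> x)\<^sup>2 / 2 * (norm x * N + M))
        = ennreal (\<integral>y. (\<psi> x)\<^sup>2 / 2 * (norm x * (\<psi> y)\<^sup>2 + norm y * (\<psi> y)\<^sup>2) \<partial>lborel)"
      by (rule arg_cong)
    also have "\<dots> = (\<integral>\<^sup>+y. ennreal ((\<psi> x)\<^sup>2 / 2 * (norm x * (\<psi> y)\<^sup>2 + norm y * (\<psi> y)\<^sup>2)) \<partial>lborel)"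
      by (rule nn_integral_eq_integral[OF i, symmetric]) simp
    also have "\<dots> \<le> (\<integral>\<^sup>+y. ennreal ((\<psi> x)\<^sup>2 * ((norm x)\<^sup>2 + (norm y)\<^sup>2) / norm (x - y) * (\<psi> y)\<^sup>2) \<partial>lborel)"
    proof (rule nn_integral_mono_AE)
      show "AE y in lborel. ennreal ((\<psi> x)\<^sup>2 / 2 * (norm x * (\<psi> y)\<^sup>2 + norm y * (\<psi> y)\<^sup>2))
        \<le> ennreal ((\<psi> x)\<^sup>2 * ((norm x)\<^sup>2 + (norm y)\<^sup>2) / norm (x - y) * (\<psi> y)\<^sup>2)"
        using AE_lborel_singleton[of x]
      proof eventually_elim
        case (elim y)
        then have "(\<psi> x)\<^sup>2 * (\<psi> y)\<^sup>2 * ((norm x + norm y) / 2)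
            \<le> (\<psi> x)\<^sup>2 * (\<psi> y)\<^sup>2 * (((norm x)\<^sup>2 + (norm y)\<^sup>2) / norm (x - y))"
          by (intro mult_left_mono sum_squares_over_norm_diff_ge) auto
        moreover have "(\<psi> x)\<^sup>2 / 2 * (norm x * (\<psi> y)\<^sup>2 + norm y * (\<psi> y)\<^sup>2) = (\<psi> x)\<^sup>2 * (\<psi> y)\<^sup>2 * ((norm x + norm y) / 2)"
          by (simp add: algebra_simps)
        moreover have "(\<psi> x)\<^sup>2 * ((norm x)\<^sup>2 + (norm y)\<^sup>2) / norm (x - y) * (\<psi> y)\<^sup>2
            = (\<psi> x)\<^sup>2 * (\<psi> y)\<^sup>2 * (((norm x)\<^sup>2 + (norm y)\<^sup>2) / norm (x - y))"
          by simp
        ultimately show ?case by (simp only: ennreal_leI)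
      qed
    qed
    finally show ?thesis .
  qed
  have i2: "integrable lborel (\<lambda>x. 1 / 2 * (norm x * (\<psi> x)\<^sup>2 * N + (\<psi> x)\<^sup>2 * M))"
    using iN iM by (intro integrable_mult_right Bochner_Integration.integrable_add integrable_mult_left)
  have "M * N = (\<integral>x. 1 / 2 * (norm x * (\<psi> x)\<^sup>2 * N + (\<psi> x)\<^sup>2 * M) \<partial>lborel)"
    unfolding integral_mult_right_zero using iN iM by (simp add: N_def M_def)
  then have "ennreal (M * N) = (\<integral>\<^sup>+x. ennreal (1 / 2 * (norm x * (\<psi> x)\<^sup>2 * N + (\<psi> x)\<^sup>2 * M)) \<partial>lborel)"
    using nn_integral_eq_integral[OF i2] NM by simp
  also have "\<dots> = (\<integral>\<^sup>+x. ennreal ((\<psi> x)\<^sup>2 / 2 * (norm x * N + M)) \<partial>lborel)"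
    by (intro nn_integral_cong arg_cong[of _ _ ennreal]) (simp add: algebra_simps)
  also have "\<dots> \<le> beta_num \<psi>"
    unfolding beta_num_def using inner by (rule nn_integral_mono)
  finally show ?thesis by (simp add: N_def M_def)
qed

lemma beta_quotient_ge_half:
  assumes t: "beta_trial \<psi>"
  shows "1/2 \<le> beta_quotient \<psi>"
proof -
  have iN: "integrable lborel (\<lambda>x. (\<psi> x)\<^sup>2)" and iM: "integrable lborel (\<lambda>x. norm x * (\<psi> x)\<^sup>2)"
    and N: "(\<integral>x. (\<psi> x)\<^sup>2 \<partial>lborel) \<noteq> 0" and fin: "beta_num \<psi> < \<infinity>"
    using t by (auto simp: beta_trial_def)
  let ?N = "\<integral>x. (\<psi> x)\<^sup>2 \<partial>lborel" and ?M = "\<integral>x. norm x * (\<psi> x)\<^sup>2 \<partial>lborel"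
  \<comment> \<open>A vanishing first moment would make the trial function vanish almost everywhere
    off the origin, hence almost everywhere.\<close>
  have "?M \<noteq> 0"
  proof
    assume "?M = 0"
    then have "AE x in lborel. norm x * (\<psi> x)\<^sup>2 = 0"
      using iM by (subst (asm) integral_nonneg_eq_0_iff_AE) auto
    then have "AE x in lborel. (\<psi> x)\<^sup>2 = 0"
      using AE_lborel_singleton[of 0] by eventually_elim auto
    then have "?N = 0" using iN by (subst integral_nonneg_eq_0_iff_AE) auto
    with N show False by simp
  qed
  moreover have "?M \<ge> 0" "?N \<ge> 0" by simp_all
  ultimately have pos: "0 < ?M * ?N" using N by (simp add: less_le)
  have "?M * ?N \<le> enn2real (beta_num \<psi>)"
    using enn2real_mono[OF beta_num_ge[OF t] fin[unfolded infinity_ennreal_def]] pos by simp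
  then show ?thesis unfolding beta_quotient_def using pos by (simp add: pos_le_divide_eq)
qed

lemma hartree_beta_le:
  assumes "beta_trial \<psi>" shows "hartree_beta \<le> beta_quotient \<psi>"
  unfolding hartree_beta_eq using assms beta_quotient_ge_half
  by (intro cInf_lower) (auto intro!: bdd_belowI[of _ "1/2"])

text \<open>A dyadic decomposition replaces polar coordinates: 1 / |z| is dominated by the sum of 2
  * 2^n over the balls of radius 2^(-n) containing z. Their volumes decay like 8^(-n), leaving a
  geometric series of ratio 1/4.\<close>

lemma nn_integral_inverse_norm_unit_ball:
  "(\<integral>\<^sup>+z. ennreal (indicator (cball 0 1) z / norm z) \<partial>(lborel :: R3 measure)) < \<infinity>"
proof -
  have [measurable]: "cball (0::R3) r \<in> sets borel" for r by simp
  have pt: "ennreal (indicator (cball 0 1) z / norm z)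
      \<le> (\<Sum>n. ennreal (2 * 2 ^ n) * indicator (cball 0 (1 / 2 ^ n)) z)" for z :: R3
  proof (cases "z = 0 \<or> norm z > 1")
    case False
    define k where "k = nat \<lfloor>1 / norm z\<rfloor>"
    have z: "0 < norm z" "1 / norm z \<ge> 1" using False by auto
    then have k: "k \<ge> 1" "real k \<le> 1 / norm z" "1 / norm z < real k + 1"
      unfolding k_def by (simp_all add: le_nat_iff le_floor_iff of_nat_nat)
    \<comment> \<open>The binary order of magnitude of 1 / |z|: the lower bound on \<open>k\<close>
      puts z into the ball of radius 2^(-n), the upper one lets the single term 2 * 2^n
      suffice.\<close>
    obtain n where n: "2 ^ n \<le> k" "k < 2 ^ (n + 1)" using ex_power_ivl1[of 2 k] k(1) by auto
    have "(2::real) ^ n \<le> real k" using n(1) by simp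
    then have "2 ^ n \<le> 1 / norm z" using k(2) by (rule order.trans)
    then have 1: "norm z \<le> 1 / 2 ^ n" using z(1) by (simp add: field_simps)
    have "real (k + 1) \<le> real (2 ^ (n + 1))" using n(2) by (simp only: of_nat_le_iff)
    then have "real k + 1 \<le> 2 * 2 ^ n" by (simp only: of_nat_add of_nat_mult of_nat_power of_nat_1 of_nat_numeral power_add power_one_right mult.commute)
    then have 2: "1 / norm z \<le> 2 * 2 ^ n" using k(3) by linarith
    define a :: "nat \<Rightarrow> ennreal" where "a m = ennreal (2 * 2 ^ m) * indicator (cball 0 (1 / 2 ^ m)) z" for m
    have "ennreal (indicator (cball 0 1) z / norm z) \<le> a n"
      using False 1 2 by (simp add: a_def ennreal_leI)
    also have "\<dots> \<le> (\<Sum>m. a m)" using sum_le_suminf[of a "{n}"] by simp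
    also have "\<dots> = (\<Sum>n. ennreal (2 * 2 ^ n) * indicator (cball 0 (1 / 2 ^ n)) z)" by (simp only: a_def)
    finally show ?thesis .
  qed auto
  have "(\<integral>\<^sup>+z. ennreal (indicator (cball 0 1) z / norm z) \<partial>(lborel :: R3 measure))
      \<le> (\<integral>\<^sup>+z. (\<Sum>n. ennreal (2 * 2 ^ n) * indicator (cball 0 (1 / 2 ^ n)) z) \<partial>(lborel :: R3 measure))"
    using pt by (intro nn_integral_mono) simp
  also have "\<dots> = (\<Sum>n. ennreal (2 * 2 ^ n) * emeasure lborel (cball (0::R3) (1 / 2 ^ n)))"
    by (subst nn_integral_suminf) (measurable, simp add: nn_integral_cmult_indicator)
  also have "\<dots> = (\<Sum>n. ennreal (2 * unit_ball_vol 3 * (1 / 4) ^ n))"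
  proof (intro suminf_cong)
    fix n
    have "ennreal (2 * 2 ^ n) * emeasure lborel (cball (0::R3) (1 / 2 ^ n))
        = ennreal (2 * 2 ^ n * (unit_ball_vol 3 * (1 / 2 ^ n) ^ 3))"
      by (simp add: emeasure_cball ennreal_mult)
    also have "2 * 2 ^ n * (unit_ball_vol 3 * (1 / 2 ^ n) ^ 3) = 2 * unit_ball_vol 3 * (1 / 4 :: real) ^ n"
    proof -
      have "(4::real) ^ n = 2 ^ n * 2 ^ n" by (simp add: power_mult_distrib[symmetric])
      then show ?thesis by (simp add: power_one_over field_simps power3_eq_cube)
    qed
    finally show "ennreal (2 * 2 ^ n) * emeasure lborel (cball (0::R3) (1 / 2 ^ n))
        = ennreal (2 * unit_ball_vol 3 * (1 / 4) ^ n)" .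
  qed
  also have "\<dots> < \<infinity>"
    by (subst suminf_ennreal2) (auto intro!: summable_mult summable_geometric)
  finally show ?thesis .
qed

text \<open>Radius 1/2 makes both |x|^2 + |y|^2 and |x - y| at most 1 on the ball, so the inner
  integral is at most that of 1 / |z| over the unit ball. This is the witness that the infimum runs
  over a nonempty set.\<close>

lemma beta_trial_ball: "beta_trial (indicator (cball 0 (1/2)))"
proof -
  let ?B = "cball (0::R3) (1/2)"
  have [measurable]: "?B \<in> sets borel" by simp
  define J where "J = (\<integral>\<^sup>+z. ennreal (indicator (cball 0 1) z / norm z) \<partial>(lborel :: R3 measure))"
  have sq: "((indicator ?B x)\<^sup>2 :: real) = indicator ?B x" for x by (simp add: indicator_def)
  have iB: "integrable lborel (indicator ?B :: R3 \<Rightarrow> real)"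
    using integrable_const_on_cball[of 1 "1/2", where 'a = R3] by simp
  have jm: "(\<lambda>z::R3. ennreal (indicator (cball 0 1) z / norm z)) \<in> borel_measurable borel"
    by (intro measurable_compose[OF _ measurable_ennreal] borel_measurable_divide
      borel_measurable_indicator borel_measurable_norm) auto
  have minus: "(\<lambda>y. x - y) \<in> borel_measurable borel" for x :: R3
    by (intro borel_measurable_continuous_onI continuous_intros)
  have inner: "(\<integral>\<^sup>+y. ennreal ((indicator ?B x)\<^sup>2 * ((norm x)\<^sup>2 + (norm y)\<^sup>2) / norm (x - y) * (indicator ?B y)\<^sup>2) \<partial>lborel)
      \<le> J * indicator ?B x" for x :: R3
  proof -
    have "ennreal ((indicator ?B x)\<^sup>2 * ((norm x)\<^sup>2 + (norm y)\<^sup>2) / norm (x - y) * (indicator ?B y)\<^sup>2)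
        \<le> ennreal (indicator (cball 0 1) (x - y) / norm (x - y)) * indicator ?B x" for y
    proof (cases "x \<in> ?B \<and> y \<in> ?B")
      case True
      then have "(norm x)\<^sup>2 \<le> (1/2)\<^sup>2" "(norm y)\<^sup>2 \<le> (1/2)\<^sup>2" "norm (x - y) \<le> 1"
        using norm_triangle_ineq4[of x y] by (auto intro!: power_mono)
      then have "(norm x)\<^sup>2 + (norm y)\<^sup>2 \<le> 1" "x - y \<in> cball 0 1" by (auto simp: power2_eq_square)
      then show ?thesis using True by (auto intro!: ennreal_leI divide_right_mono)
    qed auto
    then have "(\<integral>\<^sup>+y. ennreal ((indicator ?B x)\<^sup>2 * ((norm x)\<^sup>2 + (norm y)\<^sup>2) / norm (x - y) * (indicator ?B y)\<^sup>2) \<partial>lborel)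
      \<le> (\<integral>\<^sup>+y. ennreal (indicator (cball 0 1) (x - y) / norm (x - y)) * indicator ?B x \<partial>lborel)"
      by (intro nn_integral_mono) simp
    also have "\<dots> = (\<integral>\<^sup>+y. ennreal (indicator (cball 0 1) (x - y) / norm (x - y)) \<partial>lborel) * indicator ?B x"
      using measurable_compose[OF minus jm] by (intro nn_integral_multc) simp
    also have "(\<integral>\<^sup>+y. ennreal (indicator (cball 0 1) (x - y) / norm (x - y)) \<partial>lborel) = J"
      using nn_integral_lborel_affine[OF jm, of "-1" x] by (simp add: J_def)
    finally show ?thesis .
  qed
  have "beta_num (indicator ?B) \<le> (\<integral>\<^sup>+x. J * indicator ?B x \<partial>lborel)"
    unfolding beta_num_def using inner by (rule nn_integral_mono)
  also have "\<dots> = J * emeasure lborel ?B" by (simp add: nn_integral_cmult_indicator)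
  also have "\<dots> < \<infinity>"
    using nn_integral_inverse_norm_unit_ball unfolding J_def[symmetric]
    by (simp add: ennreal_mult_less_top emeasure_cball)
  finally have fin: "beta_num (indicator ?B) < \<infinity>" .
  have "integrable lborel (\<lambda>x. norm x * indicator ?B x :: real)"
  proof (rule Bochner_Integration.integrable_bound[OF iB])
    show "AE x in lborel. norm (norm x * indicator ?B x) \<le> norm (indicator ?B x :: real)"
      by (intro AE_I2) (simp add: indicator_def)
  qed measurable
  moreover have "(\<integral>x. indicator ?B x \<partial>lborel) \<noteq> (0::real)"
    using content_cball_pos[of "1/2" "0::R3"] by (simp del: content_cball_conv_ball)
  ultimately show ?thesis using iB fin by (simp add: beta_trial_def sq)
qed

lemma hartree_beta_ge_half: "1/2 \<le> hartree_beta"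
  unfolding hartree_beta_eq using beta_trial_ball beta_quotient_ge_half
  by (intro cInf_greatest) auto

text \<open>Damping \<open>\<psi>\<^sup>2\<close> by \<open>h = 1 / (1 + \<epsilon> |x|\<^sup>2)\<close> makes the first moment finite, and dropping one factor
  \<open>h \<le> 1\<close> in the numerator of the quotient leaves exactly the weight \<open>|x|\<^sup>2 h\<close> used in the variation.\<close>

lemma hartree_beta_damped_bound:
  assumes H: "H1_with_grad \<psi> g" and e: "e > 0"
  defines "h \<equiv> \<lambda>x::R3. 1 / (1 + e * (norm x)\<^sup>2)"
  assumes N: "(\<integral>x. (\<psi> x)\<^sup>2 * h x \<partial>lborel) \<noteq> 0"
  shows "hartree_beta * (\<integral>x. norm x * ((\<psi> x)\<^sup>2 * h x) \<partial>lborel) * (\<integral>x. (\<psi> x)\<^sup>2 * h x \<partial>lborel)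
    \<le> (\<integral>p. (norm (fst p))\<^sup>2 * h (fst p) * ((\<psi> (fst p))\<^sup>2 * (\<psi> (snd p))\<^sup>2 / norm (fst p - snd p)) \<partial>(lborel \<Otimes>\<^sub>M lborel))"
    (is "hartree_beta * ?M * ?N \<le> ?X")
    and "integrable lborel (\<lambda>x. (\<psi> x)\<^sup>2 * h x)" "integrable lborel (\<lambda>x. norm x * ((\<psi> x)\<^sup>2 * h x))"
proof -
  note sq = H1_sq_integrable[OF H]
  have [measurable]: "\<psi> \<in> borel_measurable borel" using sq by (auto simp: sq_integrable_def)
  note rb = regularized_multiplier_bounds[OF e]
  have pos: "1 + e * (norm x)\<^sup>2 \<ge> 1" for x :: R3 using e by simp
  have h: "0 < h x" "h x \<le> 1" for x
    using pos[of x] by (auto simp: h_def)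
  have hm[measurable]: "h \<in> borel_measurable borel" unfolding h_def by measurable
  have iN0: "integrable lborel (\<lambda>x. (\<psi> x)\<^sup>2)" using sq(1) by (simp add: sq_integrable_def)
  have "\<bar>h x\<bar> \<le> 1" for x using h[of x] by simp
  from integrable_bounded_mult[OF iN0 _ this]
  show iN: "integrable lborel (\<lambda>x. (\<psi> x)\<^sup>2 * h x)" by (simp add: mult.commute)
  have "\<bar>norm x * h x\<bar> \<le> 1 / sqrt e" for x
    using rb(2)[of "(norm x)\<^sup>2"] pos[of x] by (simp add: h_def)
  from integrable_bounded_mult[OF iN0 _ this]
  show iM: "integrable lborel (\<lambda>x. norm x * ((\<psi> x)\<^sup>2 * h x))" by (simp add: mult_ac)
  define k where "k p = (\<psi> (fst p))\<^sup>2 * (\<psi> (snd p))\<^sup>2 / norm (fst p - snd p)" for p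
  have k0: "k p \<ge> 0" for p by (simp add: k_def)
  have ik: "integrable (lborel \<Otimes>\<^sub>M lborel) k"
    using coulomb_kernel_integrable[OF H] by (simp add: k_def[abs_def] split_def)
  define f where "f x = (norm x)\<^sup>2 * h x" for x
  have fm[measurable]: "f \<in> borel_measurable borel" unfolding f_def by measurable
  have f0: "0 \<le> f x" for x using h[of x] by (simp add: f_def)
  have fb: "\<bar>f x\<bar> \<le> 1 / e" for x
  proof -
    have "f x \<le> 1 / e" using rb(1)[of "(norm x)\<^sup>2"] by (simp add: f_def h_def)
    then show ?thesis using f0[of x] by (simp only: abs_of_nonneg)
  qed
  have ifk: "integrable (lborel \<Otimes>\<^sub>M lborel) (\<lambda>p. f (fst p) * k p)" "integrable (lborel \<Otimes>\<^sub>M lborel) (\<lambda>p. f (snd p) * k p)"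
    using ik fb by (auto intro!: integrable_bounded_mult)
  have X: "?X = (\<integral>p. f (fst p) * k p \<partial>(lborel \<Otimes>\<^sub>M lborel))" by (simp add: f_def k_def)
  have sym: "(\<integral>p. f (snd p) * k p \<partial>(lborel \<Otimes>\<^sub>M lborel)) = (\<integral>p. f (fst p) * k p \<partial>(lborel \<Otimes>\<^sub>M lborel))"
    using lborel_pair.integral_product_swap[of "\<lambda>p. f (fst p) * k p"] ifk(1)
    by (simp add: k_def split_def norm_minus_commute mult.commute borel_measurable_integrable)
  \<comment> \<open>The square root makes the density of the trial function exactly the damped
    one.\<close>
  define \<eta> where "\<eta> x = \<psi> x * sqrt (h x)" for x
  have \<eta>2: "(\<eta> x)\<^sup>2 = (\<psi> x)\<^sup>2 * h x" for x using h(1)[of x] by (simp add: \<eta>_def power_mult_distrib)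
  have [measurable]: "\<eta> \<in> borel_measurable borel" unfolding \<eta>_def by measurable
  \<comment> \<open>Expanding gives two products, each with a damping factor at x and one at y; the
    factor not attached to its squared norm is estimated by 1.\<close>
  have num: "(\<eta> x)\<^sup>2 * ((norm x)\<^sup>2 + (norm y)\<^sup>2) / norm (x - y) * (\<eta> y)\<^sup>2 \<le> f x * k (x, y) + f y * k (x, y)" for x y
  proof -
    have "f x * h y + f y * h x \<le> f x * 1 + f y * 1"
      using f0 h by (intro add_mono mult_left_mono) auto
    from mult_right_mono[OF this k0[of "(x, y)"]]
    show ?thesis unfolding \<eta>2 by (simp add: f_def k_def algebra_simps add_divide_distrib)
  qed
  have "beta_num \<eta> = (\<integral>\<^sup>+p. ennreal ((\<eta> (fst p))\<^sup>2 * ((norm (fst p))\<^sup>2 + (norm (snd p))\<^sup>2) / norm (fst p - snd p) * (\<eta> (snd p))\<^sup>2)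
      \<partial>(lborel \<Otimes>\<^sub>M lborel))"
    unfolding beta_num_def by (subst lborel.nn_integral_fst[symmetric]) auto
  also have "\<dots> \<le> (\<integral>\<^sup>+p. ennreal (f (fst p) * k p + f (snd p) * k p) \<partial>(lborel \<Otimes>\<^sub>M lborel))"
    using num by (intro nn_integral_mono ennreal_leI) (metis prod.collapse)
  also have "\<dots> = ennreal (\<integral>p. f (fst p) * k p + f (snd p) * k p \<partial>(lborel \<Otimes>\<^sub>M lborel))"
    using ifk f0 k0 by (intro nn_integral_eq_integral) auto
  also have "(\<integral>p. f (fst p) * k p + f (snd p) * k p \<partial>(lborel \<Otimes>\<^sub>M lborel)) = 2 * ?X"
    using ifk sym X by simp
  finally have le: "beta_num \<eta> \<le> ennreal (2 * ?X)" .
  have X0: "0 \<le> ?X" unfolding X using f0 k0 by (intro integral_nonneg_AE) simp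
  have half: "(1/2) * enn2real (beta_num \<eta>) \<le> ?X"
    using enn2real_mono[OF le] X0 by simp
  have "beta_trial \<eta>"
    unfolding beta_trial_def \<eta>2 using iN iM N le by (auto simp: top_unique less_top[symmetric])
  from hartree_beta_le[OF this]
  have quot: "hartree_beta \<le> (1/2) * enn2real (beta_num \<eta>) / (?M * ?N)"
    unfolding beta_quotient_def \<eta>2 .
  have nn: "?M \<ge> 0" "?N \<ge> 0" using less_imp_le[OF h(1)] by (auto intro!: integral_nonneg_AE)
  show "hartree_beta * ?M * ?N \<le> ?X"
  proof (cases "?M * ?N = 0")
    case False
    then have p: "?M * ?N > 0" using nn by simp
    have "hartree_beta * (?M * ?N) \<le> (1/2) * enn2real (beta_num \<eta>)"
      using quot p by (simp only: pos_le_divide_eq)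
    then show ?thesis using half by (simp only: mult.assoc)
  next
    case True
    then show ?thesis using X0 by (simp only: mult.assoc mult_zero_right)
  qed
qed

section \<open>Removal of the damping and the bound on N\<close>

theorem theorem3p1:
  fixes Z :: real and \<psi> :: "R3 \<Rightarrow> real"
  assumes "Z > 0"
    and "hartree_minimizer Z \<psi>"
    and "AE x in lborel. \<psi> x \<ge> 0"
  shows "(\<integral>x. (\<psi> x)\<^sup>2 \<partial>lborel) \<le> 5 / (4 * hartree_beta) * Z"
proof -
  obtain g where H: "H1_with_grad \<psi> g"
    and min: "\<And>\<phi> h. H1_with_grad \<phi> h \<Longrightarrow> hartree_energy Z \<psi> g \<le> hartree_energy Z \<phi> h"
    using assms(2) unfolding hartree_minimizer_def by blast
  have Z: "Z > 0" by fact
  note sq = H1_sq_integrable[OF H]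
  have [measurable]: "\<psi> \<in> borel_measurable borel" using sq by (auto simp: sq_integrable_def)
  have iN: "integrable lborel (\<lambda>x. (\<psi> x)\<^sup>2)" using sq(1) by (simp add: sq_integrable_def)
  define N where "N = (\<integral>x. (\<psi> x)\<^sup>2 \<partial>lborel)"
  have \<beta>: "hartree_beta > 0" using hartree_beta_ge_half by linarith
  have "hartree_beta * N \<le> 5 / 4 * Z"
  proof (rule ccontr)
    \<comment> \<open>The negation makes beta N - Z positive, hence eventually also its damped
      version, so that a lower bound on the damped first moment may be multiplied by it.\<close>
    assume "\<not> ?thesis"
    then have big: "hartree_beta * N > 5 / 4 * Z" by simp
    then have "0 < hartree_beta * N" using Z by linarith
    then have N: "N > 0" using \<beta> by (simp add: zero_less_mult_iff)
    define e where "e n = 1 / real (Suc n)" for n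
    have e: "e n > 0" for n by (simp add: e_def)
    have elim0: "e \<longlonglongrightarrow> 0" unfolding e_def using LIMSEQ_inverse_real_of_nat by (simp add: inverse_eq_divide)
    define h where "h n x = 1 / (1 + e n * (norm x)\<^sup>2)" for n and x :: R3
    have h: "0 < h n x" "h n x \<le> 1" for n x
      using e[of n] by (auto simp: h_def add_pos_nonneg less_imp_le)
    define Nn where "Nn n = (\<integral>x. (\<psi> x)\<^sup>2 * h n x \<partial>lborel)" for n
    define Mn where "Mn n = (\<integral>x. norm x * ((\<psi> x)\<^sup>2 * h n x) \<partial>lborel)" for n
    have [measurable]: "h n \<in> borel_measurable borel" for n unfolding h_def by measurable
    have Nlim: "Nn \<longlonglongrightarrow> N"
      unfolding Nn_def N_def
    proof (rule integral_dominated_convergence)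
      show "integrable lborel (\<lambda>x. (\<psi> x)\<^sup>2)" by (rule iN)
      show "AE x in lborel. norm ((\<psi> x)\<^sup>2 * h n x) \<le> (\<psi> x)\<^sup>2" for n
        using h(1)[of n] h(2)[of n] by (intro AE_I2) (simp add: abs_mult mult_left_le abs_of_pos)
      show "AE x in lborel. (\<lambda>n. (\<psi> x)\<^sup>2 * h n x) \<longlonglongrightarrow> (\<psi> x)\<^sup>2"
      proof (rule AE_I2)
        fix x
        have "(\<lambda>n. (\<psi> x)\<^sup>2 * (1 / (1 + e n * (norm x)\<^sup>2))) \<longlonglongrightarrow> (\<psi> x)\<^sup>2 * (1 / (1 + 0 * (norm x)\<^sup>2))"
          by (intro tendsto_intros elim0) simp
        then show "(\<lambda>n. (\<psi> x)\<^sup>2 * h n x) \<longlonglongrightarrow> (\<psi> x)\<^sup>2" by (simp add: h_def)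
      qed
    qed measurable
    have ineq: "(hartree_beta * Nn n - Z) * (3 / Z * (2 * Nn n - N)) \<le> 3 / 4 * N"
      if n: "Nn n > 0" "hartree_beta * Nn n - Z > 0" for n
    proof -
      note damped = hartree_beta_damped_bound[OF H e[of n], folded h_def, folded Nn_def Mn_def]
      have iNn: "integrable lborel (\<lambda>x. (\<psi> x)\<^sup>2 * h n x)" and iMn: "integrable lborel (\<lambda>x. norm x * ((\<psi> x)\<^sup>2 * h n x))"
        using damped(2,3) n(1) by auto
      have "hartree_beta * Mn n * Nn n
          \<le> (\<integral>p. (norm (fst p))\<^sup>2 * h n (fst p) * ((\<psi> (fst p))\<^sup>2 * (\<psi> (snd p))\<^sup>2 / norm (fst p - snd p)) \<partial>(lborel \<Otimes>\<^sub>M lborel))"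
        using damped(1) n(1) by simp
      also have "\<dots> \<le> Z * Mn n + 3 / 4 * N"
        using hartree_minimizer_interaction_bound[OF H min e[of n]]
        by (simp add: h_def Mn_def N_def)
      finally have 1: "(hartree_beta * Nn n - Z) * Mn n \<le> 3 / 4 * N" by (simp add: algebra_simps)
      have iB: "integrable lborel (\<lambda>x. (\<psi> x)\<^sup>2 / norm x)" using H1_coulomb(2)[OF H, of 1 0] by simp
      have "2 * Nn n = (\<integral>x. 2 * ((\<psi> x)\<^sup>2 * h n x) \<partial>lborel)" by (simp add: Nn_def)
      also have "\<dots> \<le> (\<integral>x. Z / 3 * (norm x * ((\<psi> x)\<^sup>2 * h n x)) + 3 / Z * ((\<psi> x)\<^sup>2 / norm x) \<partial>lborel)"
      proof (rule integral_mono_AE)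
        show "integrable lborel (\<lambda>x. 2 * ((\<psi> x)\<^sup>2 * h n x))" using iNn by (rule integrable_mult_right)
        show "integrable lborel (\<lambda>x. Z / 3 * (norm x * ((\<psi> x)\<^sup>2 * h n x)) + 3 / Z * ((\<psi> x)\<^sup>2 / norm x))"
          using iMn iB by (intro Bochner_Integration.integrable_add integrable_mult_right)
        \<comment> \<open>A pointwise form of N^2 <= M B: 2 <= s + 1 / s with s = Z |x| / 3, the
          value balancing both terms against the bound Z N / 3 on the attraction. The damping is
          kept where |x| appears and dropped where 1 / |x| does.\<close>
        show "AE x in lborel. 2 * ((\<psi> x)\<^sup>2 * h n x) \<le> Z / 3 * (norm x * ((\<psi> x)\<^sup>2 * h n x)) + 3 / Z * ((\<psi> x)\<^sup>2 / norm x)"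
          using AE_lborel_singleton[of 0]
        proof eventually_elim
          case (elim x)
          define s where "s = Z / 3 * norm x"
          have s: "s > 0" using elim Z by (simp add: s_def)
          have "2 \<le> s + 1 / s"
            using s sum_squares_bound[of s 1] by (simp add: field_simps power2_eq_square)
          then have "(\<psi> x)\<^sup>2 * h n x * 2 \<le> (\<psi> x)\<^sup>2 * h n x * (s + 1 / s)"
            using h(1)[of n x] by (intro mult_left_mono) auto
          also have "\<dots> = s * ((\<psi> x)\<^sup>2 * h n x) + (\<psi> x)\<^sup>2 * (1 / s) * h n x" by (simp add: algebra_simps)
          also have "(\<psi> x)\<^sup>2 * (1 / s) * h n x \<le> (\<psi> x)\<^sup>2 * (1 / s) * 1"
            using h(2)[of n x] s by (intro mult_left_mono) auto
          also have "(\<psi> x)\<^sup>2 * (1 / s) * 1 = 3 / Z * ((\<psi> x)\<^sup>2 / norm x)" by (simp add: s_def)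
          finally show ?case by (simp add: s_def mult_ac)
        qed
      qed
      also have "\<dots> = Z / 3 * Mn n + 3 / Z * (\<integral>x. (\<psi> x)\<^sup>2 / norm x \<partial>lborel)"
        unfolding Bochner_Integration.integral_add[OF integrable_mult_right[OF iMn] integrable_mult_right[OF iB]]
          integral_mult_right_zero Mn_def ..
      also have "3 / Z * (\<integral>x. (\<psi> x)\<^sup>2 / norm x \<partial>lborel) \<le> 3 / Z * (Z / 3 * N)"
        unfolding N_def using Z by (intro mult_left_mono hartree_minimizer_attraction_bound[OF H Z min]) auto
      also have "3 / Z * (Z / 3 * N) = N" using Z by simp
      finally have "3 / Z * (2 * Nn n - N) \<le> Mn n" using Z by (simp add: field_simps)
      then have "(hartree_beta * Nn n - Z) * (3 / Z * (2 * Nn n - N)) \<le> (hartree_beta * Nn n - Z) * Mn n"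
        using n(2) by (intro mult_left_mono) auto
      with 1 show ?thesis by linarith
    qed
    have "eventually (\<lambda>n. Nn n > 0) sequentially"
      using Nlim N by (rule order_tendstoD(1))
    moreover have "(\<lambda>n. hartree_beta * Nn n - Z) \<longlonglongrightarrow> hartree_beta * N - Z"
      by (intro tendsto_intros Nlim)
    then have "eventually (\<lambda>n. hartree_beta * Nn n - Z > 0) sequentially"
      by (rule order_tendstoD(1)) (use big Z in linarith)
    ultimately have ev: "eventually (\<lambda>n. (hartree_beta * Nn n - Z) * (3 / Z * (2 * Nn n - N)) \<le> 3 / 4 * N) sequentially"
      by eventually_elim (rule ineq)
    have "(\<lambda>n. (hartree_beta * Nn n - Z) * (3 / Z * (2 * Nn n - N)))
        \<longlonglongrightarrow> (hartree_beta * N - Z) * (3 / Z * (2 * N - N))"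
      \<comment> \<open>Only \<open>Nn\<close> occurs in this expression, so the finiteness of the
        undamped first moment is never at issue. Cancelling 3 N / Z in the limit leaves beta N - Z
        <= Z / 4.\<close>
      by (intro tendsto_intros Nlim)
    from tendsto_upperbound[OF this ev]
    have "(hartree_beta * N - Z) * (3 / Z * (2 * N - N)) \<le> 3 / 4 * N" by simp
    then have "hartree_beta * N \<le> 5 / 4 * Z" using Z N by (simp add: field_simps)
    with big show False by simp
  qed
  then show ?thesis using \<beta> by (simp add: N_def field_simps)
qed

end
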